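(* Let $G$ be an invertible operator on $H^1_0$. There is a unique unitary operator $U_G\in U(H^1_0)$ such that $U_GA^{1/2}=A^{1/2}G$ if and only if $G\in\mathbb{G}$. The map $G\mapsto U_G$ is a group isomorphism from $\mathbb{G}$ onto the group $$\mathcal{U}_{R(A^{1/2})}(H^1_0)=\{U\in U(H^1_0):U(R(A^{1/2}))=R(A^{1/2})\}.$$ Moreover, if $Ad_{\mathcal{A}^{1/2}}:\mathcal{B}(L^2)\to\mathcal{B}(H^1_0)$ denotes the $C^*$-algebra isomorphism implemented by the unitary transformation $\mathcal{A}^{1/2}$, $Ad_{\mathcal{A}^{1/2}}(X)=\mathcal{A}^{1/2}X\mathcal{A}^{-1/2}$, then $$Ad_{\mathcal{A}^{1/2}}(\{U\in U(L^2):U(H^1_0)=H^1_0\})=\mathcal{U}_{R(A^{1/2})}(H^1_0).$$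
   Context: Let $\Omega\subset\mathbb{R}^n$ be open, $L^2=L^2(\Omega,dx)$ the complex Lebesgue space with its usual inner product $\langle\cdot,\cdot\rangle$, and $H^1_0=H^1_0(\Omega)$ the closure in the Sobolev norm of the complex-valued $C^\infty$ functions with compact support in $\Omega$, a Hilbert space with inner product $[f,g]=\int_\Omega f\bar g\,dx+\int_\Omega\nabla f\cdot\nabla\bar g\,dx$. $\mathcal{B}(\cdot)$ denotes bounded operators, $Gl(H^1_0)$ the invertible operators in $\mathcal{B}(H^1_0)$, and $U(\cdot)$ the unitary group of a Hilbert space. $\mathbb{G}=\{G\in Gl(H^1_0):\langle Gf,Gg\rangle=\langle f,g\rangle\ \text{for all } f,g\in H^1_0\}$. $A\in\mathcal{B}(H^1_0)$ is the positive operator determined by $[Af,g]=\langle f,g\rangle$ for all $f,g\in H^1_0$; $A^{1/2}$ is its positive square root in $\mathcal{B}(H^1_0)$ and $R(A^{1/2})=A^{1/2}(H^1_0)$ its range. The operator $A$ extends to a bounded positive operator on $L^2$, whose square root maps $L^2$ isometrically onto $H^1_0$; this surjective isometry $(L^2,\langle\cdot,\cdot\rangle)\to(H^1_0,[\cdot,\cdot])$ is denoted $\mathcal{A}^{1/2}$, and $\mathcal{A}^{-1/2}$ is its inverse. *)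

theory Defs
  imports "HOL-Analysis.Analysis" "HOL-Algebra.Group"
begin

section \<open>Bounded operators between complex inner product spaces\<close>

class complex_vector = ab_group_add +
  fixes scaleC :: "complex \<Rightarrow> 'a \<Rightarrow> 'a"  (infixr \<open>*\<^sub>C\<close> 75)
  assumes scaleC_add_right: "c *\<^sub>C (x + y) = c *\<^sub>C x + c *\<^sub>C y"
    and scaleC_add_left: "(c + d) *\<^sub>C x = c *\<^sub>C x + d *\<^sub>C x"
    and scaleC_scaleC: "c *\<^sub>C (d *\<^sub>C x) = (c * d) *\<^sub>C x"
    and scaleC_one: "1 *\<^sub>C x = x"

text \<open>
  A linear subspace of an ambient complex vector space together with its own inner product
  (linear in the first argument). An operator between two such spaces is an extensional function,
  so that equality of operators is equality of functions on the carrier.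
\<close>

record 'v ip_space = "'v partial_object" +
  ip :: "'v \<Rightarrow> 'v \<Rightarrow> complex"

definition ip_norm :: "('v, 'm) ip_space_scheme \<Rightarrow> 'v \<Rightarrow> real" where
  "ip_norm H f = sqrt (Re (ip H f f))"

definition bounded_ops ::
  "('v::complex_vector, 'm) ip_space_scheme \<Rightarrow> ('w::complex_vector, 'n) ip_space_scheme \<Rightarrow> ('v \<Rightarrow> 'w) set"
  where
  "bounded_ops H K = {T \<in> carrier H \<rightarrow>\<^sub>E carrier K.
     (\<forall>f\<in>carrier H. \<forall>g\<in>carrier H. T (f + g) = T f + T g) \<and>
     (\<forall>c. \<forall>f\<in>carrier H. T (c *\<^sub>C f) = c *\<^sub>C T f) \<and>
     (\<exists>C. \<forall>f\<in>carrier H. ip_norm K (T f) \<le> C * ip_norm H f)}"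

definition invertible_ops :: "('v::complex_vector, 'm) ip_space_scheme \<Rightarrow> ('v \<Rightarrow> 'v) set" where
  "invertible_ops H = {T \<in> bounded_ops H H. \<exists>S \<in> bounded_ops H H.
     compose (carrier H) S T = (\<lambda>f\<in>carrier H. f) \<and> compose (carrier H) T S = (\<lambda>f\<in>carrier H. f)}"

definition unitary_ops ::
  "('v::complex_vector, 'm) ip_space_scheme \<Rightarrow> ('w::complex_vector, 'n) ip_space_scheme \<Rightarrow> ('v \<Rightarrow> 'w) set"
  where
  "unitary_ops H K = {U \<in> bounded_ops H K. U ` carrier H = carrier K \<and>
     (\<forall>f\<in>carrier H. \<forall>g\<in>carrier H. ip K (U f) (U g) = ip H f g)}"

definition positive_ops :: "('v::complex_vector, 'm) ip_space_scheme \<Rightarrow> ('v \<Rightarrow> 'v) set" where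
  "positive_ops H = {T \<in> bounded_ops H H.
     \<forall>f\<in>carrier H. Im (ip H (T f) f) = 0 \<and> 0 \<le> Re (ip H (T f) f)}"

definition sqrt_op :: "('v::complex_vector, 'm) ip_space_scheme \<Rightarrow> ('v \<Rightarrow> 'v) \<Rightarrow> ('v \<Rightarrow> 'v)" where
  "sqrt_op H T = (THE S. S \<in> positive_ops H \<and> compose (carrier H) S S = T)"

definition adjoint_op :: "('v::complex_vector, 'm) ip_space_scheme \<Rightarrow> ('v \<Rightarrow> 'v) \<Rightarrow> ('v \<Rightarrow> 'v)" where
  "adjoint_op H T = (THE S. S \<in> bounded_ops H H \<and>
     (\<forall>f\<in>carrier H. \<forall>g\<in>carrier H. ip H (T f) g = ip H f (S g)))"

text \<open>Bijective $*$-homomorphisms of $C^*$-algebras are automatically isometric.\<close>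

definition cstar_iso ::
  "('v::complex_vector, 'm) ip_space_scheme \<Rightarrow> ('w::complex_vector, 'n) ip_space_scheme \<Rightarrow>
   (('v \<Rightarrow> 'v) \<Rightarrow> ('w \<Rightarrow> 'w)) \<Rightarrow> bool"
  where
  "cstar_iso H K \<Phi> \<longleftrightarrow>
     bij_betw \<Phi> (bounded_ops H H) (bounded_ops K K) \<and>
     (\<forall>X\<in>bounded_ops H H. \<forall>Y\<in>bounded_ops H H.
        \<Phi> (\<lambda>f\<in>carrier H. X f + Y f) = (\<lambda>f\<in>carrier K. \<Phi> X f + \<Phi> Y f) \<and>
        \<Phi> (compose (carrier H) X Y) = compose (carrier K) (\<Phi> X) (\<Phi> Y)) \<and>
     (\<forall>c. \<forall>X\<in>bounded_ops H H. \<Phi> (\<lambda>f\<in>carrier H. c *\<^sub>C X f) = (\<lambda>f\<in>carrier K. c *\<^sub>C \<Phi> X f)) \<and>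
     (\<forall>X\<in>bounded_ops H H. \<Phi> (adjoint_op H X) = adjoint_op K (\<Phi> X))"

definition op_group :: "('v::complex_vector, 'm) ip_space_scheme \<Rightarrow> ('v \<Rightarrow> 'v) set \<Rightarrow> ('v \<Rightarrow> 'v) monoid"
  where
  "op_group H \<G> = \<lparr>carrier = \<G>, mult = compose (carrier H), one = (\<lambda>f\<in>carrier H. f)\<rparr>"

definition Ad ::
  "('v::complex_vector, 'm) ip_space_scheme \<Rightarrow> ('w::complex_vector, 'n) ip_space_scheme \<Rightarrow>
   ('v \<Rightarrow> 'w) \<Rightarrow> ('v \<Rightarrow> 'v) \<Rightarrow> ('w \<Rightarrow> 'w)"
  where
  "Ad H K W X = (\<lambda>f\<in>carrier K. W (X (inv_into (carrier H) W f)))"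


section \<open>The space $L^2$\<close>

definition square_integrable :: "('a::euclidean_space \<Rightarrow> complex) \<Rightarrow> bool" where
  "square_integrable f \<longleftrightarrow>
     f \<in> borel_measurable lebesgue \<and> integrable lebesgue (\<lambda>x. (cmod (f x))\<^sup>2)"

definition l2_rel :: "('a::euclidean_space \<Rightarrow> complex) \<Rightarrow> ('a \<Rightarrow> complex) \<Rightarrow> bool" where
  "l2_rel f g \<longleftrightarrow> square_integrable f \<and> square_integrable g \<and> (AE x in lebesgue. f x = g x)"

lemma square_integrable_zero: "square_integrable (\<lambda>x. 0)"
  by (simp add: square_integrable_def)

lemma square_integrable_add:
  assumes "square_integrable f" "square_integrable g"
  shows "square_integrable (\<lambda>x. f x + g x)"
proof -
  have meas [measurable]: "f \<in> borel_measurable lebesgue" "g \<in> borel_measurable lebesgue"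
    using assms by (auto simp: square_integrable_def)
  have le: "(cmod (f x + g x))\<^sup>2 \<le> 2 * (cmod (f x))\<^sup>2 + 2 * (cmod (g x))\<^sup>2" for x
  proof -
    have "(cmod (f x + g x))\<^sup>2 \<le> (cmod (f x) + cmod (g x))\<^sup>2"
      by (simp add: norm_triangle_ineq power_mono)
    also have "\<dots> \<le> 2 * (cmod (f x))\<^sup>2 + 2 * (cmod (g x))\<^sup>2"
      using zero_le_power2[of "cmod (f x) - cmod (g x)"]
      by (simp add: power2_eq_square algebra_simps)
    finally show ?thesis .
  qed
  have "integrable lebesgue (\<lambda>x. (cmod (f x + g x))\<^sup>2)"
  proof (rule Bochner_Integration.integrable_bound)
    show "integrable lebesgue (\<lambda>x. 2 * (cmod (f x))\<^sup>2 + 2 * (cmod (g x))\<^sup>2)"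
      using assms by (auto simp: square_integrable_def)
    show "AE x in lebesgue. norm ((cmod (f x + g x))\<^sup>2) \<le> norm (2 * (cmod (f x))\<^sup>2 + 2 * (cmod (g x))\<^sup>2)"
      using le by auto
  qed measurable
  then show ?thesis
    by (simp add: square_integrable_def)
qed

lemma square_integrable_scale:
  assumes "square_integrable f"
  shows "square_integrable (\<lambda>x. c * f x)"
  using assms by (auto simp: square_integrable_def norm_mult power_mult_distrib)

lemma square_integrable_uminus:
  assumes "square_integrable f"
  shows "square_integrable (\<lambda>x. - f x)"
  using assms by (auto simp: square_integrable_def)

lemma square_integrable_diff:
  assumes "square_integrable f" "square_integrable g"
  shows "square_integrable (\<lambda>x. f x - g x)"
  using square_integrable_add[OF assms(1) square_integrable_uminus[OF assms(2)]] by simp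

quotient_type (overloaded) 'a l2 = "'a::euclidean_space \<Rightarrow> complex" / partial: l2_rel
proof (rule part_equivpI)
  show "\<exists>f. l2_rel f (f :: 'a \<Rightarrow> complex)"
    using square_integrable_zero by (auto simp: l2_rel_def)
  show "symp (l2_rel :: ('a \<Rightarrow> complex) \<Rightarrow> _)"
    by (auto simp: symp_def l2_rel_def)
  show "transp (l2_rel :: ('a \<Rightarrow> complex) \<Rightarrow> _)"
    unfolding transp_def l2_rel_def by (auto elim: eventually_elim2)
qed

instantiation l2 :: (euclidean_space) complex_vector
begin

lift_definition zero_l2 :: "'a l2" is "\<lambda>x. 0"
  by (simp add: l2_rel_def square_integrable_zero)

lift_definition plus_l2 :: "'a l2 \<Rightarrow> 'a l2 \<Rightarrow> 'a l2" is "\<lambda>f g x. f x + g x"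
  unfolding l2_rel_def by (auto intro: square_integrable_add elim: eventually_elim2)

lift_definition uminus_l2 :: "'a l2 \<Rightarrow> 'a l2" is "\<lambda>f x. - f x"
  unfolding l2_rel_def by (auto intro: square_integrable_uminus elim: eventually_mono)

lift_definition minus_l2 :: "'a l2 \<Rightarrow> 'a l2 \<Rightarrow> 'a l2" is "\<lambda>f g x. f x - g x"
  unfolding l2_rel_def by (auto intro: square_integrable_diff elim: eventually_elim2)

lift_definition scaleC_l2 :: "complex \<Rightarrow> 'a l2 \<Rightarrow> 'a l2" is "\<lambda>c f x. c * f x"
  unfolding l2_rel_def by (auto intro: square_integrable_scale elim: eventually_mono)

instance
proof
  fix a b c :: "'a l2" and s t :: complex
  show "a + b + c = a + (b + c)"
    by transfer (auto simp: l2_rel_def algebra_simps intro!: square_integrable_add)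
  show "a + b = b + a"
    by transfer (auto simp: l2_rel_def algebra_simps intro!: square_integrable_add)
  show "0 + a = a"
    by transfer (auto simp: l2_rel_def)
  show "- a + a = 0"
    by transfer (auto simp: l2_rel_def square_integrable_zero)
  show "a - b = a + - b"
    by transfer (auto simp: l2_rel_def intro!: square_integrable_diff)
  show "s *\<^sub>C (a + b) = s *\<^sub>C a + s *\<^sub>C b"
    by transfer (auto simp: l2_rel_def algebra_simps intro!: square_integrable_add square_integrable_scale)
  show "(s + t) *\<^sub>C a = s *\<^sub>C a + t *\<^sub>C a"
    by transfer (auto simp: l2_rel_def algebra_simps intro!: square_integrable_add square_integrable_scale)
  show "s *\<^sub>C (t *\<^sub>C a) = (s * t) *\<^sub>C a"
    by transfer (auto simp: l2_rel_def algebra_simps intro!: square_integrable_scale)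
  show "1 *\<^sub>C a = a"
    by transfer (auto simp: l2_rel_def)
qed

end

lift_definition l2_inner :: "'a::euclidean_space l2 \<Rightarrow> 'a l2 \<Rightarrow> complex" is
  "\<lambda>f g. LINT x|lebesgue. f x * cnj (g x)"
proof -
  fix f f' g g' :: "'a \<Rightarrow> complex"
  assume "l2_rel f f'" "l2_rel g g'"
  then have [measurable]: "f \<in> borel_measurable lebesgue" "f' \<in> borel_measurable lebesgue"
      "g \<in> borel_measurable lebesgue" "g' \<in> borel_measurable lebesgue"
    and ae: "AE x in lebesgue. f x = f' x" "AE x in lebesgue. g x = g' x"
    by (auto simp: l2_rel_def square_integrable_def)
  have meas: "(\<lambda>x. cnj (h x)) \<in> borel_measurable lebesgue"
    if "h \<in> borel_measurable lebesgue" for h :: "'a \<Rightarrow> complex"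
    by (rule borel_measurable_continuous_on[OF _ that]) (intro continuous_intros)
  show "(LINT x|lebesgue. f x * cnj (g x)) = (LINT x|lebesgue. f' x * cnj (g' x))"
    using ae by (intro integral_cong_AE borel_measurable_times meas) auto
qed

lift_definition l2_vanishes_off :: "'a::euclidean_space set \<Rightarrow> 'a l2 \<Rightarrow> bool" is
  "\<lambda>\<Omega> f. AE x in lebesgue. x \<notin> \<Omega> \<longrightarrow> f x = 0"
  unfolding l2_rel_def by (auto elim: eventually_elim2)

text \<open>
  Elements of $L^2(\Omega)$ are identified with their extensions by zero, so the
  integral over the whole space in \<^const>\<open>l2_inner\<close> is the integral over \<open>\<Omega>\<close>.
\<close>

definition L2 :: "'a::euclidean_space set \<Rightarrow> 'a l2 ip_space" where
  "L2 \<Omega> = \<lparr>carrier = {f. l2_vanishes_off \<Omega> f}, ip = l2_inner\<rparr>"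


section \<open>The Sobolev space $H^1_0$\<close>

fun times_cont_diff :: "nat \<Rightarrow> ('a::euclidean_space \<Rightarrow> complex) \<Rightarrow> bool" where
  "times_cont_diff 0 \<phi> \<longleftrightarrow> continuous_on UNIV \<phi>"
| "times_cont_diff (Suc k) \<phi> \<longleftrightarrow> (\<forall>x. \<phi> differentiable at x) \<and>
     (\<forall>b\<in>Basis. times_cont_diff k (\<lambda>x. frechet_derivative \<phi> (at x) b))"

definition test_functions :: "'a::euclidean_space set \<Rightarrow> ('a \<Rightarrow> complex) set" where
  "test_functions \<Omega> = {\<phi>. (\<forall>k. times_cont_diff k \<phi>) \<and>
     compact (closure {x. \<phi> x \<noteq> 0}) \<and> closure {x. \<phi> x \<noteq> 0} \<subseteq> \<Omega>}"

text \<open>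
  Test functions are closed under complex conjugation, so pairing with the sesquilinear
  inner product is the usual integration by parts formula. Here \<^const>\<open>abs_l2\<close> sends a
  square integrable function to its class.
\<close>

definition has_weak_deriv :: "'a::euclidean_space set \<Rightarrow> 'a \<Rightarrow> 'a l2 \<Rightarrow> 'a l2 \<Rightarrow> bool" where
  "has_weak_deriv \<Omega> b f g \<longleftrightarrow> (\<forall>\<phi>\<in>test_functions \<Omega>.
     l2_inner f (abs_l2 (\<lambda>x. frechet_derivative \<phi> (at x) b)) = - l2_inner g (abs_l2 \<phi>))"

definition weak_deriv :: "'a::euclidean_space set \<Rightarrow> 'a \<Rightarrow> 'a l2 \<Rightarrow> 'a l2" where
  "weak_deriv \<Omega> b f = (THE g. g \<in> carrier (L2 \<Omega>) \<and> has_weak_deriv \<Omega> b f g)"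

definition H1 :: "'a::euclidean_space set \<Rightarrow> 'a l2 ip_space" where
  "H1 \<Omega> = \<lparr>carrier = {f \<in> carrier (L2 \<Omega>). \<forall>b\<in>Basis. \<exists>g\<in>carrier (L2 \<Omega>). has_weak_deriv \<Omega> b f g},
     ip = (\<lambda>f g. l2_inner f g + (\<Sum>b\<in>Basis. l2_inner (weak_deriv \<Omega> b f) (weak_deriv \<Omega> b g)))\<rparr>"

definition H10 :: "'a::euclidean_space set \<Rightarrow> 'a l2 ip_space" where
  "H10 \<Omega> = \<lparr>carrier = {f \<in> carrier (H1 \<Omega>).
       \<forall>\<epsilon>>0. \<exists>\<phi>\<in>test_functions \<Omega>. ip_norm (H1 \<Omega>) (f - abs_l2 \<phi>) < \<epsilon>},
     ip = ip (H1 \<Omega>)\<rparr>"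


section \<open>The operators $A$, $A^{1/2}$, $\mathcal{A}^{1/2}$ and the groups\<close>

definition A_op :: "'a::euclidean_space set \<Rightarrow> 'a l2 \<Rightarrow> 'a l2" where
  "A_op \<Omega> = (THE T. T \<in> bounded_ops (H10 \<Omega>) (H10 \<Omega>) \<and>
     (\<forall>f\<in>carrier (H10 \<Omega>). \<forall>g\<in>carrier (H10 \<Omega>). ip (H10 \<Omega>) (T f) g = ip (L2 \<Omega>) f g))"

definition A_half :: "'a::euclidean_space set \<Rightarrow> 'a l2 \<Rightarrow> 'a l2" where
  "A_half \<Omega> = sqrt_op (H10 \<Omega>) (A_op \<Omega>)"

definition A_ext :: "'a::euclidean_space set \<Rightarrow> 'a l2 \<Rightarrow> 'a l2" where
  "A_ext \<Omega> = (THE T. T \<in> bounded_ops (L2 \<Omega>) (L2 \<Omega>) \<and> (\<forall>f\<in>carrier (H10 \<Omega>). T f = A_op \<Omega> f))"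

definition A_ext_half :: "'a::euclidean_space set \<Rightarrow> 'a l2 \<Rightarrow> 'a l2" where
  "A_ext_half \<Omega> = sqrt_op (L2 \<Omega>) (A_ext \<Omega>)"

definition GG :: "'a::euclidean_space set \<Rightarrow> ('a l2 \<Rightarrow> 'a l2) set" where
  "GG \<Omega> = {G \<in> invertible_ops (H10 \<Omega>).
     \<forall>f\<in>carrier (H10 \<Omega>). \<forall>g\<in>carrier (H10 \<Omega>). ip (L2 \<Omega>) (G f) (G g) = ip (L2 \<Omega>) f g}"

definition intertwines :: "'a::euclidean_space set \<Rightarrow> ('a l2 \<Rightarrow> 'a l2) \<Rightarrow> ('a l2 \<Rightarrow> 'a l2) \<Rightarrow> bool" where
  "intertwines \<Omega> G U \<longleftrightarrow> U \<in> unitary_ops (H10 \<Omega>) (H10 \<Omega>) \<and>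
     compose (carrier (H10 \<Omega>)) U (A_half \<Omega>) = compose (carrier (H10 \<Omega>)) (A_half \<Omega>) G"

definition U_of :: "'a::euclidean_space set \<Rightarrow> ('a l2 \<Rightarrow> 'a l2) \<Rightarrow> ('a l2 \<Rightarrow> 'a l2)" where
  "U_of \<Omega> G = (THE U. intertwines \<Omega> G U)"

definition unitaries_fixing_range :: "'a::euclidean_space set \<Rightarrow> ('a l2 \<Rightarrow> 'a l2) set" where
  "unitaries_fixing_range \<Omega> = {U \<in> unitary_ops (H10 \<Omega>) (H10 \<Omega>).
     U ` (A_half \<Omega> ` carrier (H10 \<Omega>)) = A_half \<Omega> ` carrier (H10 \<Omega>)}"

end

theory Submission
  imports Defs
begin

text \<open>
The proposition is a statement about two Hilbert spaces: \<open>H = H10 \<Omega>\<close> lies inside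
\<open>L = L2 \<Omega>\<close>, its norm dominates that of \<open>L\<close>, and only \<open>0\<close> is orthogonal to \<open>H\<close> in \<open>L\<close>.
The locale \<open>dense_embedding\<close> isolates this situation, and the proposition holds in it. Below,
$\langle f, g\rangle$ is the inner product of \<open>L\<close> and $[f, g]$ that of \<open>H\<close>.

The Riesz theorem yields \<open>J\<close> from \<open>L\<close> to \<open>H\<close> with $[Jf, v] = \langle f, v\rangle$. On \<open>H\<close>
it is the operator $A$, and as an operator on \<open>L\<close> it is the positive extension of $A$. Let \<open>S\<close> be
the square root of \<open>J\<close> on \<open>L\<close>. From $[Jf, Jg] = \langle Jf, g\rangle = \langle Sf, Sg\rangle$ and
\<open>J = S S\<close> one sees that \<open>S\<close> carries its own range, with the norm of \<open>L\<close>, isometrically into \<open>H\<close>.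
That range is dense, so \<open>S\<close> is an isometry of \<open>L\<close> into \<open>H\<close>, and it is onto because its range is
closed and dense (\<open>S_unitary\<close>). Writing \<open>f = S h\<close> gives $[Sf, f] = \langle f, h\rangle \ge 0$,
so the restriction of \<open>S\<close> to \<open>H\<close> is a positive root of $A$ and by uniqueness it is $A^{1/2}$
(\<open>R_eq\<close>).

From here on the intertwining relation reads \<open>U S = S G\<close> on \<open>H\<close>, that is, \<open>U\<close> is the conjugate of
\<open>G\<close> by the unitary \<open>S\<close> on the dense subspace \<open>S(H)\<close>. Hence \<open>U\<close> is determined by \<open>G\<close>, it
exists as a unitary precisely when \<open>G\<close> preserves the inner product of \<open>L\<close>, and it maps \<open>S(H)\<close> onto
itself. The one step that is not algebra is the surjectivity of \<open>U_map\<close>: for a unitary \<open>U\<close>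
preserving \<open>S(H)\<close>, the pullback of \<open>U\<close> by \<open>S\<close> maps \<open>H\<close> to \<open>H\<close> and is isometric for \<open>L\<close>, but it has
to be bounded for the stronger norm. This is a closed graph argument
(\<open>bounded_if_L_contraction\<close>) and rests on uniform boundedness.

Two general facts about Hilbert spaces are developed for this purpose: a positive contraction has
exactly one positive square root (\<open>sqrt_unique_exists\<close>), and a linear isometry of a total subspace
onto itself extends to a unitary (\<open>isometry_extends_to_unitary\<close>).

What remains is analysis. The spaces \<open>L2 \<Omega>\<close>, \<open>H1 \<Omega>\<close> and \<open>H10 \<Omega>\<close> are complete: the first by
the Riesz-Fischer theorem, the second because weak derivatives pass to $L^2$ limits, the third as a
closed subspace of the second. A function in \<open>L2 \<Omega>\<close> that is orthogonal to all test functions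
vanishes (\<open>orthogonal_to_test_functions\<close>); this makes weak derivatives unique and \<open>H10 \<Omega>\<close> dense in
\<open>L2 \<Omega>\<close>. Test functions lie in \<open>H1 \<Omega>\<close> by integration by parts.
\<close>

section \<open>Complex inner product spaces\<close>

lemma scaleC_zero_left [simp]: "0 *\<^sub>C (x::'v::complex_vector) = 0"
  using scaleC_add_left[of 0 0 x] by simp

lemma scaleC_zero_right [simp]: "c *\<^sub>C (0::'v::complex_vector) = 0"
  using scaleC_add_right[of c 0 "0::'v"] by simp

lemma scaleC_minus_one: "(-1) *\<^sub>C (x::'v::complex_vector) = - x"
proof -
  have "(-1) *\<^sub>C x + x = (-1) *\<^sub>C x + 1 *\<^sub>C x" by (simp add: scaleC_one)
  also have "\<dots> = 0" by (simp only: scaleC_add_left[symmetric]) simp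
  finally show ?thesis by (simp add: eq_neg_iff_add_eq_0)
qed

lemma scaleC_minus_right: "c *\<^sub>C (- x) = - (c *\<^sub>C (x::'v::complex_vector))"
  by (metis add.right_inverse add_eq_0_iff scaleC_add_right scaleC_zero_right)

lemma scaleC_diff_right: "c *\<^sub>C (x - y) = c *\<^sub>C x - c *\<^sub>C (y::'v::complex_vector)"
  using scaleC_add_right[of c x "- y"] by (simp add: scaleC_minus_right)

text \<open>
Definiteness is postponed to \<open>inner_space\<close>, because the Cauchy-Schwarz inequality is also needed
for the form $(x, y) \mapsto \langle Tx, y\rangle$ of a positive operator \<open>T\<close>, which may have a kernel.
\<close>

locale semi_ip =
  fixes H :: "('v::complex_vector, 'm) ip_space_scheme"
  assumes zero_mem: "0 \<in> carrier H"
    and add_mem: "x \<in> carrier H \<Longrightarrow> y \<in> carrier H \<Longrightarrow> x + y \<in> carrier H"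
    and scale_mem: "x \<in> carrier H \<Longrightarrow> c *\<^sub>C x \<in> carrier H"
    and ip_add_left: "x \<in> carrier H \<Longrightarrow> y \<in> carrier H \<Longrightarrow> z \<in> carrier H \<Longrightarrow>
      ip H (x + y) z = ip H x z + ip H y z"
    and ip_scale_left: "x \<in> carrier H \<Longrightarrow> y \<in> carrier H \<Longrightarrow> ip H (c *\<^sub>C x) y = c * ip H x y"
    and ip_commute: "x \<in> carrier H \<Longrightarrow> y \<in> carrier H \<Longrightarrow> ip H y x = cnj (ip H x y)"
    and ip_nonneg: "x \<in> carrier H \<Longrightarrow> 0 \<le> Re (ip H x x)"
begin

lemma neg_mem: "x \<in> carrier H \<Longrightarrow> - x \<in> carrier H"
  using scale_mem[of x "-1"] by (simp add: scaleC_minus_one)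

lemma diff_mem: "x \<in> carrier H \<Longrightarrow> y \<in> carrier H \<Longrightarrow> x - y \<in> carrier H"
  using add_mem[of x "- y"] neg_mem[of y] by simp

lemmas mem = zero_mem add_mem scale_mem neg_mem diff_mem

lemma ip_add_right:
  "x \<in> carrier H \<Longrightarrow> y \<in> carrier H \<Longrightarrow> z \<in> carrier H \<Longrightarrow> ip H z (x + y) = ip H z x + ip H z y"
  by (metis add_mem complex_cnj_add ip_add_left ip_commute)

lemma ip_scale_right:
  "x \<in> carrier H \<Longrightarrow> y \<in> carrier H \<Longrightarrow> ip H x (c *\<^sub>C y) = cnj c * ip H x y"
  by (metis complex_cnj_mult ip_commute ip_scale_left scale_mem)

lemma ip_minus_left: "x \<in> carrier H \<Longrightarrow> y \<in> carrier H \<Longrightarrow> ip H (- x) y = - ip H x y"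
  using ip_scale_left[of x y "-1"] by (simp add: scaleC_minus_one)

lemma ip_minus_right: "x \<in> carrier H \<Longrightarrow> y \<in> carrier H \<Longrightarrow> ip H x (- y) = - ip H x y"
  using ip_scale_right[of x y "-1"] by (simp add: scaleC_minus_one)

lemma ip_diff_left:
  "x \<in> carrier H \<Longrightarrow> y \<in> carrier H \<Longrightarrow> z \<in> carrier H \<Longrightarrow> ip H (x - y) z = ip H x z - ip H y z"
  using ip_add_left[of x "- y" z] by (simp add: ip_minus_left neg_mem)

lemma ip_diff_right:
  "x \<in> carrier H \<Longrightarrow> y \<in> carrier H \<Longrightarrow> z \<in> carrier H \<Longrightarrow> ip H z (x - y) = ip H z x - ip H z y"
  using ip_add_right[of x "- y" z] by (simp add: ip_minus_right neg_mem)

lemma ip_zero_left: "x \<in> carrier H \<Longrightarrow> ip H 0 x = 0"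
  using ip_scale_left[of x x 0] by simp

lemma ip_zero_right: "x \<in> carrier H \<Longrightarrow> ip H x 0 = 0"
  using ip_scale_right[of x x 0] by simp

lemmas ip_simps = ip_add_left ip_add_right ip_scale_left ip_scale_right ip_minus_left ip_minus_right
  ip_diff_left ip_diff_right ip_zero_left ip_zero_right

lemma ip_self_im: "x \<in> carrier H \<Longrightarrow> Im (ip H x x) = 0"
  using ip_commute[of x x] by (metis complex_cnj_cancel_iff complex_In_mult_cnj_zero
    Reals_cnj_iff complex_is_Real_iff)

lemma norm_nonneg: "x \<in> carrier H \<Longrightarrow> 0 \<le> ip_norm H x"
  by (simp add: ip_norm_def ip_nonneg)

lemma norm_sq: "x \<in> carrier H \<Longrightarrow> (ip_norm H x)\<^sup>2 = Re (ip H x x)"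
  by (simp add: ip_norm_def ip_nonneg)

lemma ip_self: "x \<in> carrier H \<Longrightarrow> ip H x x = complex_of_real ((ip_norm H x)\<^sup>2)"
  by (simp add: norm_sq complex_eq_iff ip_self_im)

lemma norm_add_sq:
  "x \<in> carrier H \<Longrightarrow> y \<in> carrier H \<Longrightarrow>
    (ip_norm H (x + y))\<^sup>2 = (ip_norm H x)\<^sup>2 + 2 * Re (ip H x y) + (ip_norm H y)\<^sup>2"
  using ip_commute[of x y] by (simp add: norm_sq mem ip_simps)

lemma norm_scale: "x \<in> carrier H \<Longrightarrow> ip_norm H (c *\<^sub>C x) = cmod c * ip_norm H x"
proof -
  assume x: "x \<in> carrier H"
  have "ip H (c *\<^sub>C x) (c *\<^sub>C x) = (c * cnj c) * ip H x x"
    using x by (simp add: ip_simps mem)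
  also have "\<dots> = complex_of_real ((cmod c)\<^sup>2 * (ip_norm H x)\<^sup>2)"
    using x by (simp add: ip_self complex_norm_square[symmetric])
  finally have "(ip_norm H (c *\<^sub>C x))\<^sup>2 = (cmod c * ip_norm H x)\<^sup>2"
    using x by (simp add: norm_sq[OF scale_mem] power_mult_distrib)
  then show ?thesis
    using x norm_nonneg scale_mem by (simp add: power2_eq_iff_nonneg)
qed

lemma norm_minus: "x \<in> carrier H \<Longrightarrow> ip_norm H (- x) = ip_norm H x"
  using norm_scale[of x "-1"] by (simp add: scaleC_minus_one)

lemma norm_zero: "ip_norm H 0 = 0"
  using norm_scale[OF zero_mem, of 0] by simp

lemma norm_diff_commute:
  "x \<in> carrier H \<Longrightarrow> y \<in> carrier H \<Longrightarrow> ip_norm H (x - y) = ip_norm H (y - x)"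
  using norm_minus[of "x - y"] by (simp add: mem)

lemma norm_diff_sq:
  "x \<in> carrier H \<Longrightarrow> y \<in> carrier H \<Longrightarrow>
    (ip_norm H (x - y))\<^sup>2 = (ip_norm H x)\<^sup>2 - 2 * Re (ip H x y) + (ip_norm H y)\<^sup>2"
  using norm_add_sq[of x "- y"] by (simp add: mem ip_simps norm_minus)

text \<open>
The squared norm of \<open>x - t c y\<close>, with \<open>c\<close> the inner product of \<open>x\<close> and \<open>y\<close>, is a quadratic
polynomial in the real number \<open>t\<close> that is nowhere negative. If \<open>y\<close> has norm \<open>0\<close> the polynomial is affine and
must be constant, so \<open>c\<close> vanishes.
\<close>

lemma Cauchy_Schwarz:
  assumes x: "x \<in> carrier H" and y: "y \<in> carrier H"
  shows "cmod (ip H x y) \<le> ip_norm H x * ip_norm H y"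
proof -
  define c where "c = ip H x y"
  have key: "0 \<le> (ip_norm H x)\<^sup>2 - 2 * t * (cmod c)\<^sup>2 + t\<^sup>2 * (cmod c)\<^sup>2 * (ip_norm H y)\<^sup>2" for t
  proof -
    have "0 \<le> (ip_norm H (x - (of_real t * c) *\<^sub>C y))\<^sup>2" by simp
    also have "\<dots> = (ip_norm H x)\<^sup>2 - 2 * Re (cnj (of_real t * c) * c)
        + (cmod (of_real t * c))\<^sup>2 * (ip_norm H y)\<^sup>2"
      using x y by (simp add: norm_diff_sq mem norm_scale ip_simps c_def power_mult_distrib)
    also have "Re (cnj (of_real t * c) * c) = t * (cmod c)\<^sup>2"
      by (simp only: cmod_power2) (simp add: power2_eq_square distrib_left)
    finally show ?thesis by (simp add: norm_mult power_mult_distrib algebra_simps)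
  qed
  have "(cmod c)\<^sup>2 \<le> (ip_norm H x * ip_norm H y)\<^sup>2"
  proof (cases "ip_norm H y = 0")
    case True
    have "(cmod c)\<^sup>2 = 0"
    proof (rule ccontr)
      assume ne: "(cmod c)\<^sup>2 \<noteq> 0"
      have "(ip_norm H x)\<^sup>2 + 2 \<le> 0"
        using key[of "((ip_norm H x)\<^sup>2 + 1) / (cmod c)\<^sup>2"] ne True by simp
      then show False using zero_le_power2[of "ip_norm H x"] by linarith
    qed
    then show ?thesis by (simp add: True)
  next
    case False
    then have pos: "0 < (ip_norm H y)\<^sup>2" by simp
    have "0 \<le> (ip_norm H x)\<^sup>2 - (cmod c)\<^sup>2 / (ip_norm H y)\<^sup>2"
      using key[of "1 / (ip_norm H y)\<^sup>2"] pos False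
      by (simp add: power2_eq_square field_simps)
    then show ?thesis using pos by (simp add: field_simps power_mult_distrib)
  qed
  then show ?thesis
    unfolding c_def[symmetric] by (rule power2_le_imp_le) (intro mult_nonneg_nonneg norm_nonneg x y)
qed

lemma norm_triangle:
  assumes x: "x \<in> carrier H" and y: "y \<in> carrier H"
  shows "ip_norm H (x + y) \<le> ip_norm H x + ip_norm H y"
proof (rule power2_le_imp_le)
  have "Re (ip H x y) \<le> ip_norm H x * ip_norm H y"
    using Cauchy_Schwarz[OF x y] complex_Re_le_cmod[of "ip H x y"] by linarith
  then show "(ip_norm H (x + y))\<^sup>2 \<le> (ip_norm H x + ip_norm H y)\<^sup>2"
    using x y by (simp add: norm_add_sq power2_sum)
qed (use x y norm_nonneg in auto)

lemma norm_triangle_diff: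
  assumes "x \<in> carrier H" "y \<in> carrier H"
  shows "ip_norm H (x - y) \<le> ip_norm H x + ip_norm H y"
  using norm_triangle[of x "- y"] assms by (simp add: mem norm_minus)

lemma norm_triangle_sub:
  assumes "x \<in> carrier H" "y \<in> carrier H" "z \<in> carrier H"
  shows "ip_norm H (x - z) \<le> ip_norm H (x - y) + ip_norm H (y - z)"
  using norm_triangle[of "x - y" "y - z"] assms by (simp add: mem)

lemma norm_reverse_triangle:
  assumes "x \<in> carrier H" "y \<in> carrier H"
  shows "\<bar>ip_norm H x - ip_norm H y\<bar> \<le> ip_norm H (x - y)"
  using norm_triangle[of "x - y" y] norm_triangle[of "y - x" x] assms
  by (simp add: mem norm_diff_commute[of x y])

lemma norm_parallelogram:
  assumes "x \<in> carrier H" "y \<in> carrier H"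
  shows "(ip_norm H (x + y))\<^sup>2 + (ip_norm H (x - y))\<^sup>2 = 2 * (ip_norm H x)\<^sup>2 + 2 * (ip_norm H y)\<^sup>2"
  using assms by (simp add: norm_add_sq norm_diff_sq)

definition ip_lim :: "(nat \<Rightarrow> 'v) \<Rightarrow> 'v \<Rightarrow> bool" where
  "ip_lim X x \<longleftrightarrow> (\<forall>n. X n \<in> carrier H) \<and> x \<in> carrier H \<and> (\<lambda>n. ip_norm H (X n - x)) \<longlonglongrightarrow> 0"

definition ip_cauchy :: "(nat \<Rightarrow> 'v) \<Rightarrow> bool" where
  "ip_cauchy X \<longleftrightarrow> (\<forall>n. X n \<in> carrier H) \<and>
    (\<forall>e>0. \<exists>N. \<forall>m\<ge>N. \<forall>n\<ge>N. ip_norm H (X m - X n) < e)"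

definition subspace_of :: "'v set \<Rightarrow> bool" where
  "subspace_of V \<longleftrightarrow> V \<subseteq> carrier H \<and> 0 \<in> V \<and> (\<forall>x\<in>V. \<forall>y\<in>V. x + y \<in> V) \<and> (\<forall>c. \<forall>x\<in>V. c *\<^sub>C x \<in> V)"

lemma subspace_of_carrier: "subspace_of (carrier H)"
  by (simp add: subspace_of_def mem)

lemma ip_limI:
  assumes "\<And>n. X n \<in> carrier H" "x \<in> carrier H"
    and "\<And>n. ip_norm H (X n - x) \<le> r n" and "r \<longlonglongrightarrow> 0"
  shows "ip_lim X x"
  unfolding ip_lim_def
proof (intro conjI allI)
  show "(\<lambda>n. ip_norm H (X n - x)) \<longlonglongrightarrow> 0"
  proof (rule tendsto_sandwich[OF _ _ tendsto_const assms(4)])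
    show "\<forall>\<^sub>F n in sequentially. 0 \<le> ip_norm H (X n - x)"
      by (intro always_eventually allI norm_nonneg diff_mem assms)
    show "\<forall>\<^sub>F n in sequentially. ip_norm H (X n - x) \<le> r n"
      by (intro always_eventually allI assms)
  qed
qed (rule assms)+

lemma ip_lim_norm: "ip_lim X x \<Longrightarrow> (\<lambda>n. ip_norm H (X n)) \<longlonglongrightarrow> ip_norm H x"
  unfolding ip_lim_def
  by (rule LIM_zero_cancel, rule tendsto_rabs_zero_cancel,
      rule tendsto_sandwich[where f="\<lambda>_. 0" and h="\<lambda>n. ip_norm H (X n - x)"])
     (auto simp: norm_reverse_triangle)

lemma ip_lim_ip_left:
  assumes "ip_lim X x" and y: "y \<in> carrier H"
  shows "(\<lambda>n. ip H (X n) y) \<longlonglongrightarrow> ip H x y"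
proof (rule LIM_zero_cancel, rule tendsto_norm_zero_cancel)
  have X: "\<And>n. X n \<in> carrier H" "x \<in> carrier H" and l: "(\<lambda>n. ip_norm H (X n - x)) \<longlonglongrightarrow> 0"
    using assms by (auto simp: ip_lim_def)
  show "(\<lambda>n. cmod (ip H (X n) y - ip H x y)) \<longlonglongrightarrow> 0"
  proof (rule tendsto_sandwich[where f="\<lambda>_. 0" and h="\<lambda>n. ip_norm H (X n - x) * ip_norm H y"])
    show "\<forall>\<^sub>F n in sequentially. cmod (ip H (X n) y - ip H x y) \<le> ip_norm H (X n - x) * ip_norm H y"
      using X y Cauchy_Schwarz[OF diff_mem[OF X(1) X(2)] y] by (simp add: ip_diff_left)
    show "(\<lambda>n. ip_norm H (X n - x) * ip_norm H y) \<longlonglongrightarrow> 0"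
      using tendsto_mult[OF l tendsto_const[of "ip_norm H y"]] by simp
  qed auto
qed

lemma ip_lim_ip_right:
  assumes "ip_lim X x" and y: "y \<in> carrier H"
  shows "(\<lambda>n. ip H y (X n)) \<longlonglongrightarrow> ip H y x"
proof -
  have X: "\<And>n. X n \<in> carrier H" "x \<in> carrier H"
    using assms by (auto simp: ip_lim_def)
  show ?thesis
    using tendsto_cnj[OF ip_lim_ip_left[OF assms]] ip_commute[OF _ y] X by simp
qed

lemma ip_lim_add:
  assumes "ip_lim X x" "ip_lim Y y"
  shows "ip_lim (\<lambda>n. X n + Y n) (x + y)"
proof (rule ip_limI[where r="\<lambda>n. ip_norm H (X n - x) + ip_norm H (Y n - y)"])
  fix n
  have "ip_norm H ((X n - x) + (Y n - y)) \<le> ip_norm H (X n - x) + ip_norm H (Y n - y)"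
    using assms by (intro norm_triangle) (auto simp: ip_lim_def mem)
  then show "ip_norm H (X n + Y n - (x + y)) \<le> ip_norm H (X n - x) + ip_norm H (Y n - y)"
    by (simp add: algebra_simps)
qed (use assms tendsto_add[of _ 0 _ _ 0] in \<open>auto simp: ip_lim_def mem\<close>)

lemma ip_lim_scale:
  assumes "ip_lim X x"
  shows "ip_lim (\<lambda>n. c *\<^sub>C X n) (c *\<^sub>C x)"
proof (rule ip_limI[where r="\<lambda>n. cmod c * ip_norm H (X n - x)"])
  show "(\<lambda>n. cmod c * ip_norm H (X n - x)) \<longlonglongrightarrow> 0"
    using assms by (auto simp: ip_lim_def intro: tendsto_mult_right_zero)
qed (use assms in \<open>auto simp: ip_lim_def mem norm_scale scaleC_diff_right[symmetric]\<close>)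

lemma ip_lim_imp_cauchy:
  assumes "ip_lim X x"
  shows "ip_cauchy X"
  unfolding ip_cauchy_def
proof (intro conjI allI impI)
  have X: "\<And>n. X n \<in> carrier H" "x \<in> carrier H" and l: "(\<lambda>n. ip_norm H (X n - x)) \<longlonglongrightarrow> 0"
    using assms by (auto simp: ip_lim_def)
  fix e :: real assume "0 < e"
  then obtain N where N: "\<And>n. n \<ge> N \<Longrightarrow> ip_norm H (X n - x) < e / 2"
    using order_tendstoD(2)[OF l, of "e/2"] by (auto simp: eventually_sequentially)
  show "\<exists>N. \<forall>m\<ge>N. \<forall>n\<ge>N. ip_norm H (X m - X n) < e"
  proof (intro exI allI impI)
    fix m n assume "N \<le> m" "N \<le> n"
    then show "ip_norm H (X m - X n) < e"
      using N[of m] N[of n] norm_triangle_sub[of "X m" x "X n"] X norm_diff_commute[of x "X n"]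
      by fastforce
  qed
qed (use assms in \<open>auto simp: ip_lim_def\<close>)

end

locale inner_space = semi_ip +
  assumes ip_definite: "x \<in> carrier H \<Longrightarrow> ip H x x = 0 \<Longrightarrow> x = 0"
begin

lemma norm_eq_zero: "x \<in> carrier H \<Longrightarrow> ip_norm H x = 0 \<Longrightarrow> x = 0"
  using ip_definite ip_self by simp

lemma ip_lim_unique:
  assumes "ip_lim X x" "ip_lim X y"
  shows "x = y"
proof -
  have X: "\<And>n. X n \<in> carrier H" "x \<in> carrier H" "y \<in> carrier H"
    using assms by (auto simp: ip_lim_def)
  have "(\<lambda>n. ip_norm H (X n - x) + ip_norm H (X n - y)) \<longlonglongrightarrow> 0 + 0"
    using assms by (intro tendsto_add) (auto simp: ip_lim_def)
  moreover have "ip_norm H (x - y) \<le> ip_norm H (X n - x) + ip_norm H (X n - y)" for n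
    using norm_triangle_sub[OF X(2) X(1) X(3), of n] norm_diff_commute[OF X(2) X(1), of n] by simp
  ultimately have "ip_norm H (x - y) \<le> 0"
    by (intro LIMSEQ_le_const) auto
  then have "x - y = 0"
    using norm_eq_zero[of "x - y"] norm_nonneg[of "x - y"] X by (auto simp: mem)
  then show ?thesis by simp
qed

lemma eq_if_ip_eq:
  assumes "x \<in> carrier H" "y \<in> carrier H" "\<And>z. z \<in> carrier H \<Longrightarrow> ip H z x = ip H z y"
  shows "x = y"
proof -
  have "ip H (x - y) (x - y) = 0"
    using assms(1,2) assms(3)[of "x - y"] by (simp only: ip_diff_right mem) simp
  then show ?thesis using ip_definite[of "x - y"] assms by (auto simp: mem)
qed

end

section \<open>Riesz representation and density\<close>

locale hilbert = inner_space +
  assumes complete: "ip_cauchy X \<Longrightarrow> \<exists>x. ip_lim X x"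
begin

text \<open>
Dirichlet's principle: a sequence in \<open>V\<close> that minimizes $\|x\|^2 - 2\,\mathrm{Re}\,\phi(x)$ is a
Cauchy sequence by the parallelogram identity, and its limit \<open>u\<close> represents \<open>\<phi>\<close> because the
derivative of the functional in each direction \<open>v \<in> V\<close> vanishes there. Since \<open>V\<close> is not
assumed closed and \<open>u\<close> comes as a limit of elements of \<open>V\<close>, this covers both the Riesz theorem
and the density of subspaces with trivial orthogonal complement.
\<close>

lemma riesz_on_subspace:
  assumes V: "subspace_of V"
    and add: "\<And>x y. x \<in> V \<Longrightarrow> y \<in> V \<Longrightarrow> \<phi> (x + y) = \<phi> x + \<phi> y"
    and scale: "\<And>c x. x \<in> V \<Longrightarrow> \<phi> (c *\<^sub>C x) = c * \<phi> x"
    and bound: "\<And>x. x \<in> V \<Longrightarrow> cmod (\<phi> x) \<le> C * ip_norm H x"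
  obtains u X where "\<And>n. X n \<in> V" "ip_lim X u" "\<And>v. v \<in> V \<Longrightarrow> ip H v u = \<phi> v"
proof -
  have VH: "x \<in> V \<Longrightarrow> x \<in> carrier H" for x
    using V by (auto simp: subspace_of_def)
  have Vadd: "x \<in> V \<Longrightarrow> y \<in> V \<Longrightarrow> x + y \<in> V" and Vscale: "x \<in> V \<Longrightarrow> c *\<^sub>C x \<in> V" for x y c
    using V by (auto simp: subspace_of_def)
  define F where "F x = (ip_norm H x)\<^sup>2 - 2 * Re (\<phi> x)" for x
  have lb: "- (C\<^sup>2) \<le> F x" if "x \<in> V" for x
  proof -
    have "Re (\<phi> x) \<le> C * ip_norm H x"
      using bound[OF that] complex_Re_le_cmod[of "\<phi> x"] by linarith
    moreover have "0 \<le> (ip_norm H x - C)\<^sup>2" by simp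
    ultimately show ?thesis unfolding F_def power2_diff by (simp add: algebra_simps)
  qed
  define m where "m = Inf (F ` V)"
  have bdd: "bdd_below (F ` V)" using lb by (auto intro!: bdd_belowI)
  have ne: "F ` V \<noteq> {}" using V by (auto simp: subspace_of_def)
  have m_le: "m \<le> F x" if "x \<in> V" for x
    unfolding m_def using that bdd by (auto intro: cInf_lower)
  have "\<exists>x\<in>V. F x < m + 1 / real (Suc n)" for n
    using cInf_lessD[OF ne, of "m + 1 / real (Suc n)"] unfolding m_def by auto
  then obtain X where XV: "\<And>n. X n \<in> V" and XF: "\<And>n. F (X n) < m + 1 / real (Suc n)"
    by metis
  have close: "(ip_norm H (X n - X k))\<^sup>2 \<le> 2 / real (Suc n) + 2 / real (Suc k)" for n k
  proof -
    let ?a = "X n" and ?b = "X k"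
    define mid where "mid = (1/2) *\<^sub>C (?a + ?b)"
    have mV: "mid \<in> V" unfolding mid_def by (intro Vadd Vscale XV)
    have n1: "(ip_norm H mid)\<^sup>2 = (ip_norm H (?a + ?b))\<^sup>2 / 4"
      unfolding mid_def using VH XV by (simp add: norm_scale mem power_divide norm_divide)
    have n2: "\<phi> mid = (\<phi> ?a + \<phi> ?b) / 2"
      unfolding mid_def using scale[OF Vadd[OF XV[of n] XV[of k]]] add[OF XV[of n] XV[of k]] by simp
    have "m \<le> (ip_norm H (?a + ?b))\<^sup>2 / 4 - Re (\<phi> ?a + \<phi> ?b)"
      using m_le[OF mV] unfolding F_def n1 n2 by (simp add: add_divide_distrib)
    then show ?thesis
      using norm_parallelogram[OF VH[OF XV[of n]] VH[OF XV[of k]]] XF[of n] XF[of k]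
      unfolding F_def by simp
  qed
  have "ip_cauchy X"
    unfolding ip_cauchy_def
  proof (intro conjI allI impI)
    fix e :: real assume e: "0 < e"
    then obtain N where N: "inverse (real (Suc N)) < e\<^sup>2 / 4"
      using reals_Archimedean[of "e\<^sup>2 / 4"] by auto
    have inv: "1 / real (Suc n) < e\<^sup>2 / 4" if "N \<le> n" for n
      using N le_imp_inverse_le[of "real (Suc N)" "real (Suc n)"] that
      by (simp add: inverse_eq_divide)
    show "\<exists>N. \<forall>m\<ge>N. \<forall>n\<ge>N. ip_norm H (X m - X n) < e"
    proof (intro exI allI impI)
      fix i j assume "N \<le> i" "N \<le> j"
      then have "(ip_norm H (X i - X j))\<^sup>2 < e\<^sup>2"
        using close[of i j] inv[of i] inv[of j] by simp
      then show "ip_norm H (X i - X j) < e" using e power2_less_imp_less by fastforce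
    qed
  qed (use VH XV in auto)
  then obtain u where u: "ip_lim X u" using complete by auto
  then have uH: "u \<in> carrier H" by (auto simp: ip_lim_def)
  have re: "Re (ip H v u) = Re (\<phi> v)" if v: "v \<in> V" for v
  proof -
    have ineq: "- 2 * t * (Re (ip H v u) - Re (\<phi> v)) \<le> t\<^sup>2 * (ip_norm H v)\<^sup>2" for t :: real
    proof -
      have "m \<le> m + 1 / real (Suc n) + 2 * t * (Re (ip H v (X n)) - Re (\<phi> v)) + t\<^sup>2 * (ip_norm H v)\<^sup>2" for n
      proof -
        have "m \<le> F (X n + of_real t *\<^sub>C v)"
          by (intro m_le Vadd Vscale XV v)
        also have "\<dots> = F (X n) + 2 * t * (Re (ip H v (X n)) - Re (\<phi> v)) + t\<^sup>2 * (ip_norm H v)\<^sup>2"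
          unfolding F_def
          using ip_commute[of v "X n"] VH[OF XV[of n]] VH[OF v] add[OF XV[of n] Vscale[OF v]] scale[OF v]
          by (simp add: norm_add_sq mem norm_scale ip_simps power_mult_distrib algebra_simps)
        finally show ?thesis using XF[of n] by simp
      qed
      then have "- (1 / real (Suc n)) \<le> 2 * t * (Re (ip H v (X n)) - Re (\<phi> v)) + t\<^sup>2 * (ip_norm H v)\<^sup>2" for n
        by (simp only: add_le_same_cancel1 add.assoc le_add_same_cancel1) (simp add: minus_le_iff algebra_simps)
      moreover have "(\<lambda>n. - (1 / real (Suc n))) \<longlonglongrightarrow> - 0"
        by (intro tendsto_minus) (use LIMSEQ_inverse_real_of_nat in \<open>simp add: inverse_eq_divide\<close>)
      moreover have "(\<lambda>n. 2 * t * (Re (ip H v (X n)) - Re (\<phi> v)) + t\<^sup>2 * (ip_norm H v)\<^sup>2)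
          \<longlonglongrightarrow> 2 * t * (Re (ip H v u) - Re (\<phi> v)) + t\<^sup>2 * (ip_norm H v)\<^sup>2"
        by (intro tendsto_intros ip_lim_ip_right u VH v)
      ultimately have "- 0 \<le> 2 * t * (Re (ip H v u) - Re (\<phi> v)) + t\<^sup>2 * (ip_norm H v)\<^sup>2"
        by (intro LIMSEQ_le[where X="\<lambda>n. - (1 / real (Suc n))"]) auto
      then show ?thesis by simp
    qed
    define d where "d = Re (ip H v u) - Re (\<phi> v)"
    \<comment> \<open>Adding \<open>1\<close> keeps the divisor positive even if \<open>v = 0\<close>.\<close>
    define w where "w = (ip_norm H v)\<^sup>2 + 1"
    have w: "w > 0" unfolding w_def by (simp add: add_nonneg_pos)
    have "2 * (d / w) * d \<le> (d / w)\<^sup>2 * (ip_norm H v)\<^sup>2"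
      using ineq[of "- d / w"] unfolding d_def[symmetric] by simp
    also have "\<dots> \<le> (d / w)\<^sup>2 * w"
      by (intro mult_left_mono) (auto simp: w_def)
    finally have "2 * (d / w) * d \<le> (d / w)\<^sup>2 * w" .
    then have "2 * d\<^sup>2 \<le> d\<^sup>2" using w by (simp add: field_simps power2_eq_square)
    then have "d = 0" by simp
    then show ?thesis by (simp add: d_def)
  qed
  have "ip H v u = \<phi> v" if v: "v \<in> V" for v
  proof (rule complex_eqI)
    show "Im (ip H v u) = Im (\<phi> v)"
      using re[OF Vscale[OF v, of "\<i>"]] scale[OF v, of "\<i>"] VH[OF v] uH by (simp add: ip_simps)
  qed (rule re[OF v])
  with XV u show ?thesis using that by blast
qed

text \<open>
For a Hilbert space this is density of the subspace \<open>V\<close>, stated through its orthogonal complement,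
which is the form in which density is verified below; \<open>total_in_approx\<close> recovers approximation in norm.
\<close>

definition total_in :: "'a set \<Rightarrow> bool" where
  "total_in V \<longleftrightarrow> subspace_of V \<and> (\<forall>u\<in>carrier H. (\<forall>v\<in>V. ip H v u = 0) \<longrightarrow> u = 0)"

lemma total_in_carrier: "total_in (carrier H)"
  unfolding total_in_def using subspace_of_carrier ip_definite by auto

lemma total_in_eq:
  assumes "total_in V" "x \<in> carrier H" "y \<in> carrier H" "\<And>v. v \<in> V \<Longrightarrow> ip H v x = ip H v y"
  shows "x = y"
proof -
  have "v \<in> V \<Longrightarrow> ip H v (x - y) = 0" for v
    using assms by (auto simp: total_in_def subspace_of_def ip_diff_right subset_iff)
  then show ?thesis using assms diff_mem[of x y] by (auto simp: total_in_def)
qed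

text \<open>
The functional represented by \<open>x\<close> is also represented on \<open>V\<close> by a limit \<open>u\<close> of elements of
\<open>V\<close>; then \<open>x - u\<close> is orthogonal to \<open>V\<close>.
\<close>

lemma total_in_approx:
  assumes V: "total_in V" and x: "x \<in> carrier H"
  obtains X where "\<And>n. X n \<in> V" "ip_lim X x"
proof -
  have sub: "subspace_of V" and VH: "\<And>v. v \<in> V \<Longrightarrow> v \<in> carrier H"
    using V by (auto simp: total_in_def subspace_of_def)
  obtain u X where *: "\<And>n. X n \<in> V" "ip_lim X u" "\<And>v. v \<in> V \<Longrightarrow> ip H v u = ip H v x"
    by (rule riesz_on_subspace[OF sub, of "\<lambda>v. ip H v x" "ip_norm H x"])
       (use x VH Cauchy_Schwarz[OF _ x] in \<open>auto simp: ip_simps mult.commute\<close>)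
  have "u = x" using total_in_eq[OF V _ x *(3)] *(2) by (auto simp: ip_lim_def)
  with * that show ?thesis by blast
qed

end

context semi_ip begin

lemma ip_cauchyI:
  assumes X: "\<And>n. X n \<in> carrier H"
    and bound: "\<And>m n. n \<le> m \<Longrightarrow> ip_norm H (X m - X n) \<le> r n" and r: "r \<longlonglongrightarrow> 0"
  shows "ip_cauchy X"
  unfolding ip_cauchy_def
proof (intro conjI allI impI)
  fix e :: real assume "0 < e"
  then obtain N where N: "\<And>n. n \<ge> N \<Longrightarrow> r n < e"
    using order_tendstoD(2)[OF r] by (auto simp: eventually_sequentially)
  show "\<exists>N. \<forall>m\<ge>N. \<forall>n\<ge>N. ip_norm H (X m - X n) < e"
  proof (intro exI allI impI)
    fix m n assume mn: "N \<le> m" "N \<le> n"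
    show "ip_norm H (X m - X n) < e"
    proof (cases "n \<le> m")
      case True
      then show ?thesis using bound[of n m] N[of n] mn by simp
    next
      case False
      then show ?thesis using bound[of m n] N[of m] mn norm_diff_commute[OF X X, of m n] by simp
    qed
  qed
qed (rule X)

lemma ip_lim_const: "x \<in> carrier H \<Longrightarrow> ip_lim (\<lambda>n. x) x"
  by (simp add: ip_lim_def norm_zero)

lemma ip_lim_diff:
  assumes "ip_lim X x" "ip_lim Y y"
  shows "ip_lim (\<lambda>n. X n - Y n) (x - y)"
  using ip_lim_add[OF assms(1) ip_lim_scale[OF assms(2), of "-1"]] by (simp add: scaleC_minus_one)

lemma ip_lim_bound:
  assumes l: "ip_lim X x" and y: "y \<in> carrier H" and "\<And>n. n \<ge> N \<Longrightarrow> ip_norm H (X n - y) \<le> b"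
  shows "ip_norm H (x - y) \<le> b"
proof (rule LIMSEQ_le_const2)
  show "(\<lambda>n. ip_norm H (X n - y)) \<longlonglongrightarrow> ip_norm H (x - y)"
    by (rule ip_lim_norm[OF ip_lim_diff[OF l ip_lim_const[OF y]]])
  show "\<exists>N. \<forall>n\<ge>N. ip_norm H (X n - y) \<le> b"
    using assms(3) by (intro exI[of _ N] allI impI)
qed

end

section \<open>Bounded operators\<close>

lemma bounded_opsD:
  assumes "T \<in> bounded_ops H K"
  shows "f \<in> carrier H \<Longrightarrow> T f \<in> carrier K"
    and "f \<in> carrier H \<Longrightarrow> g \<in> carrier H \<Longrightarrow> T (f + g) = T f + T g"
    and "f \<in> carrier H \<Longrightarrow> T (c *\<^sub>C f) = c *\<^sub>C T f"
    and "f \<notin> carrier H \<Longrightarrow> T f = undefined"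
proof -
  have T: "T \<in> carrier H \<rightarrow>\<^sub>E carrier K"
    "\<forall>f\<in>carrier H. \<forall>g\<in>carrier H. T (f + g) = T f + T g"
    "\<forall>c. \<forall>f\<in>carrier H. T (c *\<^sub>C f) = c *\<^sub>C T f"
    using assms unfolding bounded_ops_def by blast+
  show "f \<in> carrier H \<Longrightarrow> T f \<in> carrier K" by (rule PiE_mem[OF T(1)])
  show "f \<in> carrier H \<Longrightarrow> g \<in> carrier H \<Longrightarrow> T (f + g) = T f + T g" using T(2) by blast
  show "f \<in> carrier H \<Longrightarrow> T (c *\<^sub>C f) = c *\<^sub>C T f" using T(3) by blast
  show "f \<notin> carrier H \<Longrightarrow> T f = undefined" by (rule PiE_arb[OF T(1)])
qed

lemma bounded_ops_bound:
  assumes "T \<in> bounded_ops H K" and "semi_ip H"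
  obtains C where "0 \<le> C" "\<And>f. f \<in> carrier H \<Longrightarrow> ip_norm K (T f) \<le> C * ip_norm H f"
proof -
  interpret semi_ip H by fact
  obtain C where C: "\<And>f. f \<in> carrier H \<Longrightarrow> ip_norm K (T f) \<le> C * ip_norm H f"
    using assms(1) unfolding bounded_ops_def by blast
  have "ip_norm K (T f) \<le> max C 0 * ip_norm H f" if "f \<in> carrier H" for f
    using C[OF that] mult_right_mono[of C "max C 0" "ip_norm H f"] norm_nonneg[OF that] by linarith
  then show ?thesis using that[of "max C 0"] by auto
qed

lemma bounded_opsI:
  assumes "\<And>f. f \<in> carrier H \<Longrightarrow> T f \<in> carrier K"
    and "\<And>f g. f \<in> carrier H \<Longrightarrow> g \<in> carrier H \<Longrightarrow> T (f + g) = T f + T g"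
    and "\<And>c f. f \<in> carrier H \<Longrightarrow> T (c *\<^sub>C f) = c *\<^sub>C T f"
    and "\<And>f. f \<in> carrier H \<Longrightarrow> ip_norm K (T f) \<le> C * ip_norm H f"
    and "\<And>f. f \<notin> carrier H \<Longrightarrow> T f = undefined"
  shows "T \<in> bounded_ops H K"
  unfolding bounded_ops_def
proof (intro CollectI conjI ballI allI exI[of _ C])
  show "T \<in> carrier H \<rightarrow>\<^sub>E carrier K" by (rule PiE_I) (use assms in blast)+
qed (rule assms; assumption)+

lemma bounded_ops_restrictI:
  assumes "semi_ip H"
    and "\<And>f. f \<in> carrier H \<Longrightarrow> T f \<in> carrier K"
    and "\<And>f g. f \<in> carrier H \<Longrightarrow> g \<in> carrier H \<Longrightarrow> T (f + g) = T f + T g"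
    and "\<And>c f. f \<in> carrier H \<Longrightarrow> T (c *\<^sub>C f) = c *\<^sub>C T f"
    and "\<And>f. f \<in> carrier H \<Longrightarrow> ip_norm K (T f) \<le> C * ip_norm H f"
  shows "(\<lambda>f\<in>carrier H. T f) \<in> bounded_ops H K"
  using assms by (intro bounded_opsI[where C=C]) (auto simp: semi_ip.add_mem semi_ip.scale_mem)

lemma bounded_ops_eqI:
  assumes "S \<in> bounded_ops H K" "T \<in> bounded_ops H K" "\<And>f. f \<in> carrier H \<Longrightarrow> S f = T f"
  shows "S = T"
proof
  show "S f = T f" for f
    using assms by (cases "f \<in> carrier H") (auto simp: bounded_opsD(4))
qed

lemma bounded_ops_diff:
  assumes T: "T \<in> bounded_ops H K" and H: "semi_ip H" and "f \<in> carrier H" "g \<in> carrier H"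
  shows "T (f - g) = T f - T g"
proof -
  have "T (f + (-1) *\<^sub>C g) = T f + (-1) *\<^sub>C T g"
    using assms semi_ip.scale_mem[OF H] by (simp only: bounded_opsD[OF T])
  then show ?thesis by (simp add: scaleC_minus_one)
qed

lemma bounded_ops_zero: "T \<in> bounded_ops H K \<Longrightarrow> semi_ip H \<Longrightarrow> T 0 = 0"
  using bounded_ops_diff[of T H K 0 0] by (simp add: semi_ip.zero_mem)

lemma bounded_ops_subspace_image:
  assumes T: "T \<in> bounded_ops H K" and H: "semi_ip H" and K: "semi_ip K"
    and V: "semi_ip.subspace_of H V"
  shows "semi_ip.subspace_of K (T ` V)"
proof -
  interpret H: semi_ip H by fact
  interpret K: semi_ip K by fact
  note TD = bounded_opsD[OF T]
  have VH: "x \<in> V \<Longrightarrow> x \<in> carrier H" and V0: "0 \<in> V" for x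
    using V by (auto simp: H.subspace_of_def)
  have Vadd: "x \<in> V \<Longrightarrow> y \<in> V \<Longrightarrow> x + y \<in> V" and Vscale: "x \<in> V \<Longrightarrow> c *\<^sub>C x \<in> V" for x y c
    using V by (auto simp: H.subspace_of_def)
  show ?thesis
    unfolding K.subspace_of_def
  proof (intro conjI ballI allI)
    show "T ` V \<subseteq> carrier K" using TD(1) VH by blast
    show "0 \<in> T ` V" using bounded_ops_zero[OF T H] V0 by (metis imageI)
    show "x + y \<in> T ` V" if xy: "x \<in> T ` V" "y \<in> T ` V" for x y
    proof -
      obtain f g where "x = T f" "y = T g" "f \<in> V" "g \<in> V" using xy by blast
      then show ?thesis using TD(2)[of f g] Vadd[of f g] VH by (metis imageI)
    qed
    show "c *\<^sub>C x \<in> T ` V" if x: "x \<in> T ` V" for c x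
    proof -
      obtain f where "x = T f" "f \<in> V" using x by blast
      then show ?thesis using TD(3)[of f c] Vscale[of f c] VH by (metis imageI)
    qed
  qed
qed

lemma bounded_ops_compose:
  assumes S: "S \<in> bounded_ops K M" and T: "T \<in> bounded_ops H K" and H: "semi_ip H" and K: "semi_ip K"
  shows "compose (carrier H) S T \<in> bounded_ops H M"
proof -
  obtain C where C: "0 \<le> C" "\<And>f. f \<in> carrier H \<Longrightarrow> ip_norm K (T f) \<le> C * ip_norm H f"
    using bounded_ops_bound[OF T H] by blast
  obtain D where D: "0 \<le> D" "\<And>f. f \<in> carrier K \<Longrightarrow> ip_norm M (S f) \<le> D * ip_norm K f"
    using bounded_ops_bound[OF S K] by blast
  show ?thesis
    unfolding compose_def
  proof (rule bounded_ops_restrictI[OF H, where C="D * C"])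
    fix f assume f: "f \<in> carrier H"
    have "ip_norm M (S (T f)) \<le> D * ip_norm K (T f)" using D(2) bounded_opsD(1)[OF T f] by blast
    also have "\<dots> \<le> D * (C * ip_norm H f)" by (rule mult_left_mono[OF C(2)[OF f] D(1)])
    finally show "ip_norm M (S (T f)) \<le> D * C * ip_norm H f" by (simp add: mult.assoc)
  qed (auto simp: bounded_opsD[OF S] bounded_opsD[OF T])
qed

lemma bounded_ops_id: "semi_ip H \<Longrightarrow> (\<lambda>f\<in>carrier H. f) \<in> bounded_ops H H"
  by (rule bounded_ops_restrictI[where C=1]) auto

lemma bounded_ops_lim:
  assumes T: "T \<in> bounded_ops H K" and H: "semi_ip H" and K: "semi_ip K" and l: "semi_ip.ip_lim H X x"
  shows "semi_ip.ip_lim K (\<lambda>n. T (X n)) (T x)"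
proof -
  interpret H: semi_ip H by fact
  interpret K: semi_ip K by fact
  have X: "\<And>n. X n \<in> carrier H" "x \<in> carrier H" and l0: "(\<lambda>n. ip_norm H (X n - x)) \<longlonglongrightarrow> 0"
    using l by (auto simp: H.ip_lim_def)
  obtain C where C: "0 \<le> C" "\<And>f. f \<in> carrier H \<Longrightarrow> ip_norm K (T f) \<le> C * ip_norm H f"
    using bounded_ops_bound[OF T H] by blast
  show ?thesis
  proof (rule K.ip_limI[where r="\<lambda>n. C * ip_norm H (X n - x)"])
    show "ip_norm K (T (X n) - T x) \<le> C * ip_norm H (X n - x)" for n
      using C(2)[OF H.diff_mem[OF X(1) X(2)], of n] X by (simp add: bounded_ops_diff[OF T H])
    show "(\<lambda>n. C * ip_norm H (X n - x)) \<longlonglongrightarrow> 0"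
      by (rule tendsto_mult_right_zero[OF l0])
  qed (use X bounded_opsD(1)[OF T] in auto)
qed

lemma bounded_ops_eq_on_total:
  assumes H: "hilbert H" and K: "inner_space K" and V: "hilbert.total_in H V"
    and S: "S \<in> bounded_ops H K" and T: "T \<in> bounded_ops H K"
    and eq: "\<And>v. v \<in> V \<Longrightarrow> S v = T v"
  shows "S = T"
proof (rule bounded_ops_eqI[OF S T])
  interpret H: hilbert H by fact
  interpret K: inner_space K by fact
  fix f assume "f \<in> carrier H"
  then obtain X where X: "\<And>n. X n \<in> V" "H.ip_lim X f"
    using H.total_in_approx[OF V] by blast
  show "S f = T f"
    using K.ip_lim_unique[OF bounded_ops_lim[OF S _ _ X(2)], of "T f"]
      bounded_ops_lim[OF T _ _ X(2)] X(1) eq H.semi_ip_axioms K.semi_ip_axioms by simp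
qed

text \<open>
Riesz's theorem applied for each \<open>f\<close> to the functional \<open>\<phi> f\<close>. The form only has to be given for
second arguments in a total subspace; this flexibility serves adjoints, the embedding of \<open>H\<close>
into \<open>L\<close>, and the extension of isometries.
\<close>

lemma (in hilbert) operator_from_form:
  assumes L: "semi_ip L" and V: "total_in V" and C: "0 \<le> C"
    and add1: "\<And>f g v. f \<in> carrier L \<Longrightarrow> g \<in> carrier L \<Longrightarrow> v \<in> V \<Longrightarrow> \<phi> (f + g) v = \<phi> f v + \<phi> g v"
    and scale1: "\<And>c f v. f \<in> carrier L \<Longrightarrow> v \<in> V \<Longrightarrow> \<phi> (c *\<^sub>C f) v = cnj c * \<phi> f v"
    and add2: "\<And>f v w. f \<in> carrier L \<Longrightarrow> v \<in> V \<Longrightarrow> w \<in> V \<Longrightarrow> \<phi> f (v + w) = \<phi> f v + \<phi> f w"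
    and scale2: "\<And>c f v. f \<in> carrier L \<Longrightarrow> v \<in> V \<Longrightarrow> \<phi> f (c *\<^sub>C v) = c * \<phi> f v"
    and bound: "\<And>f v. f \<in> carrier L \<Longrightarrow> v \<in> V \<Longrightarrow> cmod (\<phi> f v) \<le> C * ip_norm L f * ip_norm H v"
  obtains T where "T \<in> bounded_ops L H"
    and "\<And>f v. f \<in> carrier L \<Longrightarrow> v \<in> V \<Longrightarrow> ip H v (T f) = \<phi> f v"
    and "\<And>f. f \<in> carrier L \<Longrightarrow> ip_norm H (T f) \<le> C * ip_norm L f"
proof -
  interpret L: semi_ip L by fact
  have sub: "subspace_of V" and VH: "\<And>v. v \<in> V \<Longrightarrow> v \<in> carrier H"
    using V by (auto simp: total_in_def subspace_of_def)
  have "\<exists>u. u \<in> carrier H \<and> (\<forall>v\<in>V. ip H v u = \<phi> f v)" if f: "f \<in> carrier L" for f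
    by (rule riesz_on_subspace[OF sub, of "\<phi> f" "C * ip_norm L f"])
       (use f add2 scale2 bound in \<open>auto simp: ip_lim_def\<close>)
  then obtain T0 where T0: "\<And>f. f \<in> carrier L \<Longrightarrow> T0 f \<in> carrier H"
    "\<And>f v. f \<in> carrier L \<Longrightarrow> v \<in> V \<Longrightarrow> ip H v (T0 f) = \<phi> f v"
    by metis
  have nrm: "ip_norm H (T0 f) \<le> C * ip_norm L f" if f: "f \<in> carrier L" for f
  proof -
    obtain X where X: "\<And>n. X n \<in> V" "ip_lim X (T0 f)"
      using total_in_approx[OF V T0(1)[OF f]] by blast
    have "(\<lambda>n. cmod (ip H (X n) (T0 f))) \<longlonglongrightarrow> cmod (ip H (T0 f) (T0 f))"
      by (intro tendsto_norm ip_lim_ip_left X T0 f)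
    moreover have "(\<lambda>n. C * ip_norm L f * ip_norm H (X n)) \<longlonglongrightarrow> C * ip_norm L f * ip_norm H (T0 f)"
      by (intro tendsto_intros ip_lim_norm X)
    ultimately have "cmod (ip H (T0 f) (T0 f)) \<le> C * ip_norm L f * ip_norm H (T0 f)"
      by (rule LIMSEQ_le) (use X T0 f bound in auto)
    then have "ip_norm H (T0 f) * ip_norm H (T0 f) \<le> C * ip_norm L f * ip_norm H (T0 f)"
      using T0 f by (simp add: ip_self power2_eq_square norm_mult)
    then show ?thesis
      using norm_nonneg[OF T0(1)[OF f]] C L.norm_nonneg[OF f]
      by (cases "ip_norm H (T0 f) = 0") (auto simp: mult_nonneg_nonneg)
  qed
  show ?thesis
  proof (rule that[of "\<lambda>f\<in>carrier L. T0 f"])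
    show "(\<lambda>f\<in>carrier L. T0 f) \<in> bounded_ops L H"
    proof (rule bounded_ops_restrictI[OF L, where C=C])
      fix f g assume f: "f \<in> carrier L" and g: "g \<in> carrier L"
      show "T0 (f + g) = T0 f + T0 g"
        by (rule total_in_eq[OF V]) (use f g T0 add1 VH in \<open>auto simp: mem L.mem ip_simps\<close>)
    next
      fix c f assume f: "f \<in> carrier L"
      show "T0 (c *\<^sub>C f) = c *\<^sub>C T0 f"
        by (rule total_in_eq[OF V]) (use f T0 scale1 VH in \<open>auto simp: mem L.mem ip_simps\<close>)
    qed (use T0 nrm in auto)
  qed (use T0 nrm in auto)
qed

text \<open>
Existence makes the definite description in \<open>adjoint_op\<close> meaningful, so that compatibility of
\<open>Ad\<close> with adjoints is a statement about the actual adjoint.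
\<close>

lemma (in hilbert) adjoint_exists:
  assumes T: "T \<in> bounded_ops H H"
  shows "\<exists>!S. S \<in> bounded_ops H H \<and> (\<forall>f\<in>carrier H. \<forall>g\<in>carrier H. ip H (T f) g = ip H f (S g))"
proof (rule ex_ex1I)
  obtain C where C: "0 \<le> C" "\<And>f. f \<in> carrier H \<Longrightarrow> ip_norm H (T f) \<le> C * ip_norm H f"
    using bounded_ops_bound[OF T semi_ip_axioms] by blast
  have bound: "cmod (ip H (T v) f) \<le> C * ip_norm H f * ip_norm H v"
    if f: "f \<in> carrier H" and v: "v \<in> carrier H" for f v
  proof -
    have "cmod (ip H (T v) f) \<le> ip_norm H (T v) * ip_norm H f"
      by (intro Cauchy_Schwarz bounded_opsD(1)[OF T] f v)
    also have "\<dots> \<le> (C * ip_norm H v) * ip_norm H f"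
      by (intro mult_right_mono C v norm_nonneg f)
    finally show ?thesis by (simp add: algebra_simps)
  qed
  show "\<exists>S. S \<in> bounded_ops H H \<and> (\<forall>f\<in>carrier H. \<forall>g\<in>carrier H. ip H (T f) g = ip H f (S g))"
    by (rule operator_from_form[OF semi_ip_axioms total_in_carrier C(1), of "\<lambda>f v. ip H (T v) f"])
       (use bound in \<open>auto simp: bounded_opsD[OF T] ip_simps\<close>)
next
  fix S S'
  assume S: "S \<in> bounded_ops H H \<and> (\<forall>f\<in>carrier H. \<forall>g\<in>carrier H. ip H (T f) g = ip H f (S g))"
    and S': "S' \<in> bounded_ops H H \<and> (\<forall>f\<in>carrier H. \<forall>g\<in>carrier H. ip H (T f) g = ip H f (S' g))"
  show "S = S'"
  proof (rule bounded_ops_eqI[of _ H H])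
    fix f assume "f \<in> carrier H"
    then show "S f = S' f"
      using S S' by (intro eq_if_ip_eq) (metis bounded_opsD(1))+
  qed (use S S' in auto)
qed

section \<open>Positive operators and their square roots\<close>

context hilbert begin

text \<open>
Polarization: the imaginary part of $\langle Th, h\rangle$ vanishes for \<open>h = f + g\<close> and for
\<open>h = f + \<i> g\<close>, which determines the imaginary and the real part of
$\langle Tf, g\rangle - \overline{\langle Tg, f\rangle}$.
\<close>

lemma positive_self_adjoint:
  assumes T: "T \<in> positive_ops H" and f: "f \<in> carrier H" and g: "g \<in> carrier H"
  shows "ip H (T f) g = ip H f (T g)"
proof -
  have Tb: "T \<in> bounded_ops H H" and im: "\<And>f. f \<in> carrier H \<Longrightarrow> Im (ip H (T f) f) = 0"
    using T by (auto simp: positive_ops_def)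
  note TD = bounded_opsD[OF Tb]
  have "Im (ip H (T f) g) + Im (ip H (T g) f) = 0"
    using im[of "f + g"] im[OF f] im[OF g] f g by (simp add: TD ip_simps mem)
  moreover have "Re (ip H (T g) f) - Re (ip H (T f) g) = 0"
    using im[of "f + \<i> *\<^sub>C g"] im[OF f] im[OF g] f g by (simp add: TD ip_simps mem)
  ultimately have "ip H (T f) g = cnj (ip H (T g) f)" by (simp add: complex_eq_iff)
  then show ?thesis using ip_commute[OF TD(1)[OF g] f] by simp
qed

lemma positive_form:
  assumes T: "T \<in> positive_ops H"
  shows "semi_ip \<lparr>carrier = carrier H, ip = (\<lambda>x y. ip H (T x) y)\<rparr>"
proof -
  have Tb: "T \<in> bounded_ops H H" using T by (auto simp: positive_ops_def)
  note TD = bounded_opsD[OF Tb]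
  have comm: "ip H (T y) x = cnj (ip H (T x) y)" if "x \<in> carrier H" "y \<in> carrier H" for x y
    using positive_self_adjoint[OF T that] ip_commute[OF that(1) TD(1)[OF that(2)]] by simp
  have pos: "0 \<le> Re (ip H (T x) x)" if "x \<in> carrier H" for x
    using T that by (simp add: positive_ops_def)
  show ?thesis
    by unfold_locales (simp add: mem TD ip_simps, simp add: mem TD, simp add: mem TD, simp add: mem TD ip_simps,
      simp add: mem TD ip_simps, simp, rule comm, assumption, assumption, simp add: pos)
qed

lemma positive_Cauchy_Schwarz:
  assumes T: "T \<in> positive_ops H" and "f \<in> carrier H" "g \<in> carrier H"
  shows "cmod (ip H (T f) g) \<le> sqrt (Re (ip H (T f) f)) * sqrt (Re (ip H (T g) g))"
  using semi_ip.Cauchy_Schwarz[OF positive_form[OF T], of f g] assms by (simp add: ip_norm_def)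

lemma positive_kernel:
  assumes T: "T \<in> positive_ops H" and f: "f \<in> carrier H" and z: "ip H (T f) f = 0"
  shows "T f = 0"
proof -
  have Tf: "T f \<in> carrier H" using T f by (auto simp: positive_ops_def bounded_opsD(1))
  have "cmod (ip H (T f) (T f)) \<le> 0"
    using positive_Cauchy_Schwarz[OF T f Tf] z by simp
  then show ?thesis using ip_definite[OF Tf] by simp
qed

text \<open>
With \<open>B = 1 - T\<close> the form of \<open>B\<close> lies between \<open>0\<close> and $\|f\|^2$. Cauchy-Schwarz for this form,
applied to \<open>f\<close> and \<open>B f\<close>, bounds $\|Bf\|^2$ by $\|f\|\,\|Bf\|$.
\<close>

lemma positive_contraction_complement:
  assumes T: "T \<in> positive_ops H"
    and contr: "\<And>f. f \<in> carrier H \<Longrightarrow> ip_norm H (T f) \<le> ip_norm H f"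
    and f: "f \<in> carrier H"
  shows "ip_norm H (f - T f) \<le> ip_norm H f"
proof -
  have Tb: "T \<in> bounded_ops H H" and im: "\<And>f. f \<in> carrier H \<Longrightarrow> Im (ip H (T f) f) = 0"
    using T by (auto simp: positive_ops_def)
  note TD = bounded_opsD[OF Tb]
  have sub: "semi_ip H" ..
  define B where "B = (\<lambda>f\<in>carrier H. f - T f)"
  have Bb: "B \<in> bounded_ops H H"
    unfolding B_def
  proof (rule bounded_ops_restrictI[OF sub, where C=2])
    fix f assume f: "f \<in> carrier H"
    show "ip_norm H (f - T f) \<le> 2 * ip_norm H f"
      using norm_triangle_diff[OF f TD(1)[OF f]] contr[OF f] by simp
  qed (auto simp: TD mem scaleC_diff_right)
  have le: "0 \<le> Re (ip H (B f) f) \<and> Re (ip H (B f) f) \<le> (ip_norm H f)\<^sup>2" if f: "f \<in> carrier H" for f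
  proof -
    have "Re (ip H (T f) f) \<le> ip_norm H (T f) * ip_norm H f"
      using Cauchy_Schwarz[OF TD(1)[OF f] f] complex_Re_le_cmod order_trans by blast
    also have "\<dots> \<le> (ip_norm H f)\<^sup>2"
      unfolding power2_eq_square by (intro mult_right_mono contr norm_nonneg f)
    finally show ?thesis
      using f T TD by (auto simp: B_def ip_simps norm_sq positive_ops_def)
  qed
  have B: "B \<in> positive_ops H"
    unfolding positive_ops_def
    using Bb le im by (auto simp: B_def ip_simps TD ip_self_im)
  have Bf: "B f \<in> carrier H" using Bb f by (rule bounded_opsD(1))
  have sq: "sqrt (Re (ip H (B h) h)) \<le> ip_norm H h" if "h \<in> carrier H" for h
    using le[OF that] norm_nonneg[OF that] by (intro real_le_lsqrt) auto
  have "(ip_norm H (B f))\<^sup>2 = cmod (ip H (B f) (B f))"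
    using ip_self[OF Bf] by (simp add: norm_power)
  also have "\<dots> \<le> sqrt (Re (ip H (B f) f)) * sqrt (Re (ip H (B (B f)) (B f)))"
    by (rule positive_Cauchy_Schwarz[OF B f Bf])
  also have "\<dots> \<le> ip_norm H f * ip_norm H (B f)"
    using le[OF f] le[OF Bf] by (intro mult_mono sq f Bf norm_nonneg) auto
  finally have "ip_norm H (B f) \<le> ip_norm H f"
    using norm_nonneg[OF Bf] norm_nonneg[OF f]
    by (cases "ip_norm H (B f) = 0") (auto simp: power2_eq_square)
  then show ?thesis using f by (simp add: B_def)
qed

end

text \<open>
The iteration $Y_{n+1} = (B + Y_n^2)/2$ with $Y_0 = 0$. A limit \<open>Y\<close> satisfies
$(1 - Y)^2 = 1 - 2Y + Y^2 = 1 - B$, so \<open>1 - Y\<close> is a square root of \<open>1 - B\<close>.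
\<close>

fun half_iter :: "('v \<Rightarrow> 'v) \<Rightarrow> nat \<Rightarrow> 'v \<Rightarrow> 'v::complex_vector" where
  "half_iter B 0 f = 0"
| "half_iter B (Suc n) f = (1/2) *\<^sub>C (B f + half_iter B n (half_iter B n f))"

text \<open>
The same iteration for the number \<open>B = 1\<close>. It is increasing and bounded by \<open>1\<close>, and its increments
dominate those of the operator iteration for every contraction \<open>B\<close>.
\<close>

fun half_seq :: "nat \<Rightarrow> real" where
  "half_seq 0 = 0"
| "half_seq (Suc n) = (1 + (half_seq n)\<^sup>2) / 2"

lemma half_seq_bounds: "0 \<le> half_seq n \<and> half_seq n \<le> 1"
proof (induction n)
  case (Suc n)
  then have "(half_seq n)\<^sup>2 \<le> 1" by (simp add: power_le_one)
  then show ?case by simp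
qed simp

lemma half_seq_mono: "half_seq n \<le> half_seq (Suc n)"
proof -
  have "0 \<le> (half_seq n - 1)\<^sup>2" by simp
  then show ?thesis by (simp add: power2_diff)
qed

context hilbert begin

context
  fixes B :: "'a \<Rightarrow> 'a"
  assumes B_mem: "f \<in> carrier H \<Longrightarrow> B f \<in> carrier H"
    and B_add: "f \<in> carrier H \<Longrightarrow> g \<in> carrier H \<Longrightarrow> B (f + g) = B f + B g"
    and B_scale: "f \<in> carrier H \<Longrightarrow> B (c *\<^sub>C f) = c *\<^sub>C B f"
    and B_norm: "f \<in> carrier H \<Longrightarrow> ip_norm H (B f) \<le> ip_norm H f"
begin

lemma half_iter_mem: "f \<in> carrier H \<Longrightarrow> half_iter B n f \<in> carrier H"
  by (induction n arbitrary: f) (auto simp: mem B_mem)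

lemma half_iter_add:
  "f \<in> carrier H \<Longrightarrow> g \<in> carrier H \<Longrightarrow> half_iter B n (f + g) = half_iter B n f + half_iter B n g"
proof (induction n arbitrary: f g)
  case (Suc n)
  then show ?case
    by (simp add: B_add half_iter_mem scaleC_add_right[symmetric] algebra_simps)
qed simp

lemma half_iter_scale: "f \<in> carrier H \<Longrightarrow> half_iter B n (c *\<^sub>C f) = c *\<^sub>C half_iter B n f"
  by (induction n arbitrary: f)
     (simp_all add: B_scale half_iter_mem scaleC_add_right[symmetric] scaleC_scaleC mult.commute)

lemma half_iter_diff:
  "f \<in> carrier H \<Longrightarrow> g \<in> carrier H \<Longrightarrow> half_iter B n (f - g) = half_iter B n f - half_iter B n g"
  using half_iter_add[of f "(-1) *\<^sub>C g" n] half_iter_scale[of g n "-1"]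
  by (simp add: mem scaleC_minus_one)

lemma half_iter_norm:
  "f \<in> carrier H \<Longrightarrow> ip_norm H (half_iter B n f) \<le> half_seq n * ip_norm H f"
proof (induction n arbitrary: f)
  case (Suc n)
  let ?Y = "half_iter B n"
  have "ip_norm H (B f + ?Y (?Y f)) \<le> ip_norm H (B f) + ip_norm H (?Y (?Y f))"
    by (intro norm_triangle B_mem half_iter_mem Suc.prems)
  also have "\<dots> \<le> ip_norm H f + half_seq n * (half_seq n * ip_norm H f)"
    using Suc.IH[OF half_iter_mem[OF Suc.prems]] B_norm[OF Suc.prems]
      mult_left_mono[OF Suc.IH[OF Suc.prems], of "half_seq n"] half_seq_bounds[of n] 
    by (meson add_mono order_trans)
  finally show ?case
    using Suc.prems by (simp add: norm_scale mem B_mem half_iter_mem power2_eq_square field_simps norm_divide)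
qed (simp add: norm_zero)

text \<open>
Induction on \<open>n\<close>, by the identity
$Y_{n+1}^2 - Y_n^2 = Y_{n+1}(Y_{n+1} - Y_n) + (Y_{n+1} - Y_n)Y_n$, whose scalar counterpart is
$y_{n+1}^2 - y_n^2 = (y_{n+1} + y_n)(y_{n+1} - y_n)$.
\<close>

lemma half_iter_step:
  "f \<in> carrier H \<Longrightarrow>
    ip_norm H (half_iter B (Suc n) f - half_iter B n f) \<le> (half_seq (Suc n) - half_seq n) * ip_norm H f"
proof (induction n arbitrary: f)
  case 0
  then show ?case using B_norm[OF 0] by (simp add: norm_scale mem B_mem norm_divide)
next
  case (Suc n)
  let ?Y = "half_iter B n" and ?Z = "half_iter B (Suc n)" and ?d = "half_seq (Suc n) - half_seq n"
  note f = Suc.prems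
  have Ym: "?Y g \<in> carrier H" and Zm: "?Z g \<in> carrier H" if "g \<in> carrier H" for g
    using that by (rule half_iter_mem)+
  have "half_iter B (Suc (Suc n)) f - ?Z f = (1/2) *\<^sub>C (B f + ?Z (?Z f)) - (1/2) *\<^sub>C (B f + ?Y (?Y f))"
    by (simp only: half_iter.simps(2)[of B "Suc n" f]) (simp only: half_iter.simps(2)[of B n f])
  also have "\<dots> = (1/2) *\<^sub>C (?Z (?Z f) - ?Y (?Y f))"
    by (simp only: scaleC_diff_right[symmetric] add_diff_cancel_left)
  also have "?Z (?Z f) - ?Y (?Y f) = ?Z (?Z f - ?Y f) + (?Z (?Y f) - ?Y (?Y f))"
    using half_iter_diff[OF Zm[OF f] Ym[OF f], of "Suc n"] by (simp only: diff_add_cancel diff_add_eq) simp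
  finally have eq: "half_iter B (Suc (Suc n)) f - ?Z f =
    (1/2) *\<^sub>C (?Z (?Z f - ?Y f) + (?Z (?Y f) - ?Y (?Y f)))" .
  have dY: "0 \<le> ?d" using half_seq_mono[of n] by linarith
  have "ip_norm H (?Z (?Z f - ?Y f)) \<le> half_seq (Suc n) * ip_norm H (?Z f - ?Y f)"
    by (intro half_iter_norm diff_mem Ym Zm f)
  also have "\<dots> \<le> half_seq (Suc n) * (?d * ip_norm H f)"
    using half_seq_bounds[of "Suc n"] by (intro mult_left_mono Suc.IH f) simp
  finally have n1: "ip_norm H (?Z (?Z f - ?Y f)) \<le> half_seq (Suc n) * (?d * ip_norm H f)" .
  have "ip_norm H (?Z (?Y f) - ?Y (?Y f)) \<le> ?d * ip_norm H (?Y f)"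
    by (intro Suc.IH Ym f)
  also have "\<dots> \<le> ?d * (half_seq n * ip_norm H f)"
    by (intro mult_left_mono half_iter_norm f dY)
  finally have n2: "ip_norm H (?Z (?Y f) - ?Y (?Y f)) \<le> ?d * (half_seq n * ip_norm H f)" .
  have "ip_norm H (half_iter B (Suc (Suc n)) f - ?Z f) =
      (1/2) * ip_norm H (?Z (?Z f - ?Y f) + (?Z (?Y f) - ?Y (?Y f)))"
    unfolding eq by (subst norm_scale) (auto simp: norm_divide intro!: mem Ym Zm f simp del: half_iter.simps)
  also have "\<dots> \<le> (1/2) * (half_seq (Suc n) * (?d * ip_norm H f) + ?d * (half_seq n * ip_norm H f))"
    using norm_triangle[of "?Z (?Z f - ?Y f)" "?Z (?Y f) - ?Y (?Y f)"] n1 n2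
    by (simp del: half_iter.simps half_seq.simps add: mem Ym Zm f)
  also have "\<dots> = (((half_seq (Suc n))\<^sup>2 - (half_seq n)\<^sup>2) / 2) * ip_norm H f"
    by (simp only: power2_eq_square) (simp add: field_simps del: half_seq.simps)
  also have "((half_seq (Suc n))\<^sup>2 - (half_seq n)\<^sup>2) / 2 = half_seq (Suc (Suc n)) - half_seq (Suc n)"
    by (simp only: half_seq.simps(2)[of "Suc n"]) (simp only: half_seq.simps(2)[of n], simp add: field_simps)
  finally show ?case .
qed

lemma half_iter_diff_norm:
  assumes "n \<le> m" "f \<in> carrier H"
  shows "ip_norm H (half_iter B m f - half_iter B n f) \<le> (half_seq m - half_seq n) * ip_norm H f"
  using assms(1)
proof (induction rule: dec_induct)
  case base
  show ?case by (simp add: norm_zero)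
next
  case (step k)
  show ?case
    using norm_triangle_sub[of "half_iter B (Suc k) f" "half_iter B k f" "half_iter B n f"]
      half_iter_step[OF assms(2), of k] step.IH half_iter_mem[OF assms(2)]
    by (simp del: half_iter.simps half_seq.simps add: left_diff_distrib)
qed

lemma half_iter_limit:
  obtains Y where "\<And>f. f \<in> carrier H \<Longrightarrow> ip_lim (\<lambda>n. half_iter B n f) (Y f)"
proof -
  have "incseq half_seq" by (rule incseq_SucI) (rule half_seq_mono)
  then obtain y where y: "half_seq \<longlonglongrightarrow> y" "\<forall>n. half_seq n \<le> y"
    using incseq_convergent[of half_seq 1] half_seq_bounds by blast
  have "\<exists>u. ip_lim (\<lambda>n. half_iter B n f) u" if f: "f \<in> carrier H" for f
  proof (rule complete, rule ip_cauchyI[where r="\<lambda>n. (y - half_seq n) * ip_norm H f"])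
    show "ip_norm H (half_iter B m f - half_iter B n f) \<le> (y - half_seq n) * ip_norm H f" if "n \<le> m" for m n
      using half_iter_diff_norm[OF that f] mult_right_mono[of "half_seq m" y "ip_norm H f"] y norm_nonneg[OF f]
      by (fastforce simp: left_diff_distrib)
    have "(\<lambda>n. (y - half_seq n) * ip_norm H f) \<longlonglongrightarrow> (y - y) * ip_norm H f"
      by (intro tendsto_intros y)
    then show "(\<lambda>n. (y - half_seq n) * ip_norm H f) \<longlonglongrightarrow> 0" by simp
  qed (rule half_iter_mem[OF f])
  then show ?thesis using that by metis
qed

lemma half_iter_commute:
  assumes X_mem: "\<And>f. f \<in> carrier H \<Longrightarrow> X f \<in> carrier H"
    and X_add: "\<And>f g. f \<in> carrier H \<Longrightarrow> g \<in> carrier H \<Longrightarrow> X (f + g) = X f + X g"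
    and X_scale: "\<And>c f. f \<in> carrier H \<Longrightarrow> X (c *\<^sub>C f) = c *\<^sub>C X f"
    and comm: "\<And>f. f \<in> carrier H \<Longrightarrow> X (B f) = B (X f)"
  shows "f \<in> carrier H \<Longrightarrow> X (half_iter B n f) = half_iter B n (X f)"
proof (induction n arbitrary: f)
  case 0
  show ?case using X_scale[OF 0, of 0] by simp
next
  case (Suc n)
  then show ?case by (simp add: X_scale X_add mem B_mem half_iter_mem comm X_mem)
qed

lemma half_iter_self_adjoint:
  assumes sa: "\<And>f g. f \<in> carrier H \<Longrightarrow> g \<in> carrier H \<Longrightarrow> ip H (B f) g = ip H f (B g)"
  shows "f \<in> carrier H \<Longrightarrow> g \<in> carrier H \<Longrightarrow> ip H (half_iter B n f) g = ip H f (half_iter B n g)"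
proof (induction n arbitrary: f g)
  case 0
  then show ?case by (simp add: ip_simps)
next
  case (Suc n)
  then show ?case by (simp add: ip_simps mem B_mem half_iter_mem sa)
qed

end

text \<open>
The root is \<open>1 - Y\<close> with \<open>Y\<close> the limit of the iteration for \<open>B = 1 - T\<close>. Every iterate is built from
\<open>B\<close> by sums and products, so an operator commuting with \<open>T\<close> commutes with the root; this is what
uniqueness depends on.
\<close>

lemma sqrt_exists_commuting:
  assumes T: "T \<in> positive_ops H"
    and contr: "\<And>f. f \<in> carrier H \<Longrightarrow> ip_norm H (T f) \<le> ip_norm H f"
  obtains S where "S \<in> positive_ops H" "compose (carrier H) S S = T"
    "\<And>X f. X \<in> bounded_ops H H \<Longrightarrow> (\<And>f. f \<in> carrier H \<Longrightarrow> X (T f) = T (X f)) \<Longrightarrow> f \<in> carrier H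
      \<Longrightarrow> X (S f) = S (X f)"
proof -
  have Tb: "T \<in> bounded_ops H H" using T by (auto simp: positive_ops_def)
  note TD = bounded_opsD[OF Tb]
  define B where "B f = f - T f" for f
  have Bm: "f \<in> carrier H \<Longrightarrow> B f \<in> carrier H"
    and Ba: "f \<in> carrier H \<Longrightarrow> g \<in> carrier H \<Longrightarrow> B (f + g) = B f + B g"
    and Bs: "f \<in> carrier H \<Longrightarrow> B (c *\<^sub>C f) = c *\<^sub>C B f"
    and Bn: "f \<in> carrier H \<Longrightarrow> ip_norm H (B f) \<le> ip_norm H f"
    and Bsa: "f \<in> carrier H \<Longrightarrow> g \<in> carrier H \<Longrightarrow> ip H (B f) g = ip H f (B g)" for f g c
    unfolding B_def using positive_contraction_complement[OF T contr] positive_self_adjoint[OF T]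
    by (auto simp: mem TD scaleC_diff_right ip_simps)
  note B = Bm Ba Bs Bn
  obtain Y where Y: "\<And>f. f \<in> carrier H \<Longrightarrow> ip_lim (\<lambda>n. half_iter B n f) (Y f)"
    using half_iter_limit[OF B] by blast
  have Ym: "f \<in> carrier H \<Longrightarrow> Y f \<in> carrier H" for f
    using Y by (auto simp: ip_lim_def)
  have hm: "f \<in> carrier H \<Longrightarrow> half_iter B n f \<in> carrier H" for n f
    by (rule half_iter_mem[OF B])
  have Ya: "Y (f + g) = Y f + Y g" if "f \<in> carrier H" "g \<in> carrier H" for f g
    using ip_lim_unique[OF Y[OF add_mem[OF that]]] ip_lim_add[OF Y Y] that
    by (simp add: half_iter_add[OF B])
  have Ys: "Y (c *\<^sub>C f) = c *\<^sub>C Y f" if "f \<in> carrier H" for f c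
    using ip_lim_unique[OF Y[OF scale_mem[OF that]]] ip_lim_scale[OF Y] that
    by (simp add: half_iter_scale[OF B])
  have hn: "ip_norm H (half_iter B n f) \<le> ip_norm H f" if "f \<in> carrier H" for n f
    using half_iter_norm[OF B that, of n] mult_right_mono[of "half_seq n" 1 "ip_norm H f"]
      half_seq_bounds[of n] norm_nonneg[OF that] by simp
  have Yn: "ip_norm H (Y f) \<le> ip_norm H f" if "f \<in> carrier H" for f
  proof (rule LIMSEQ_le_const2[OF ip_lim_norm[OF Y[OF that]]])
    show "\<exists>N. \<forall>n\<ge>N. ip_norm H (half_iter B n f) \<le> ip_norm H f" using hn[OF that] by simp
  qed
  have Ysa: "ip H (Y f) g = ip H f (Y g)" if "f \<in> carrier H" "g \<in> carrier H" for f g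
  proof (rule LIMSEQ_unique)
    show "(\<lambda>n. ip H (half_iter B n f) g) \<longlonglongrightarrow> ip H (Y f) g"
      by (rule ip_lim_ip_left[OF Y]) fact+
    show "(\<lambda>n. ip H (half_iter B n f) g) \<longlonglongrightarrow> ip H f (Y g)"
      using ip_lim_ip_right[OF Y that(1), of g] that by (simp add: half_iter_self_adjoint[OF B Bsa])
  qed
  have YY: "Y f = (1/2) *\<^sub>C (B f + Y (Y f))" if f: "f \<in> carrier H" for f
  proof (rule ip_lim_unique)
    show "ip_lim (\<lambda>n. half_iter B (Suc n) f) (Y f)"
      using Y[OF f] LIMSEQ_Suc unfolding ip_lim_def by blast
    have "ip_lim (\<lambda>n. half_iter B n (half_iter B n f)) (Y (Y f))"
    proof (rule ip_limI[where r="\<lambda>n. ip_norm H (half_iter B n f - Y f) + ip_norm H (half_iter B n (Y f) - Y (Y f))"])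
      fix n
      have "ip_norm H (half_iter B n (half_iter B n f) - Y (Y f))
        \<le> ip_norm H (half_iter B n (half_iter B n f) - half_iter B n (Y f)) + ip_norm H (half_iter B n (Y f) - Y (Y f))"
        by (intro norm_triangle_sub hm Ym f)
      also have "half_iter B n (half_iter B n f) - half_iter B n (Y f) = half_iter B n (half_iter B n f - Y f)"
        by (simp add: half_iter_diff[OF B] hm Ym f)
      finally show "ip_norm H (half_iter B n (half_iter B n f) - Y (Y f))
        \<le> ip_norm H (half_iter B n f - Y f) + ip_norm H (half_iter B n (Y f) - Y (Y f))"
        using hn[of "half_iter B n f - Y f" n] hm Ym f by (simp add: mem)
      show "half_iter B n (half_iter B n f) \<in> carrier H" by (intro hm f)
    next
      show "(\<lambda>n. ip_norm H (half_iter B n f - Y f) + ip_norm H (half_iter B n (Y f) - Y (Y f))) \<longlonglongrightarrow> 0"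
        using tendsto_add[of "\<lambda>n. ip_norm H (half_iter B n f - Y f)" 0 _ "\<lambda>n. ip_norm H (half_iter B n (Y f) - Y (Y f))" 0]
          Y[OF f] Y[OF Ym[OF f]] by (simp add: ip_lim_def)
    qed (intro Ym f)
    then show "ip_lim (\<lambda>n. half_iter B (Suc n) f) ((1/2) *\<^sub>C (B f + Y (Y f)))"
      using ip_lim_scale[OF ip_lim_add[OF ip_lim_const[OF Bm[OF f]]]] by simp
  qed
  define S where "S = (\<lambda>f\<in>carrier H. f - Y f)"
  have Sb: "S \<in> bounded_ops H H"
    unfolding S_def
  proof (rule bounded_ops_restrictI[OF semi_ip_axioms, where C=2])
    fix f assume f: "f \<in> carrier H"
    show "ip_norm H (f - Y f) \<le> 2 * ip_norm H f"
      using norm_triangle_diff[OF f Ym[OF f]] Yn[OF f] by simp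
  qed (auto simp: Ya Ys mem scaleC_diff_right Ym)
  have SS: "compose (carrier H) S S = T"
  proof (rule bounded_ops_eqI[OF bounded_ops_compose[OF Sb Sb] Tb])
    fix f assume f: "f \<in> carrier H"
    have Yd: "Y (f - Y f) = Y f - Y (Y f)"
      using Ya[of f "(-1) *\<^sub>C Y f"] Ys[of "Y f" "-1"] f by (simp add: mem Ym scaleC_minus_one)
    have "Y f + Y f = (1/2) *\<^sub>C (B f + Y (Y f)) + (1/2) *\<^sub>C (B f + Y (Y f))"
      using YY[OF f] by simp
    also have "\<dots> = B f + Y (Y f)"
      by (simp only: scaleC_add_left[symmetric]) (simp add: scaleC_one)
    finally have "Y f + Y f = f - T f + Y (Y f)" by (simp add: B_def)
    then have "f - Y f - (Y f - Y (Y f)) = T f" by (simp add: algebra_simps)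
    then show "compose (carrier H) S S f = T f"
      using f by (simp add: compose_def S_def Ym mem Yd)
  qed (rule semi_ip_axioms)+
  have Sp: "S \<in> positive_ops H"
    unfolding positive_ops_def
  proof (intro CollectI conjI ballI Sb)
    fix f assume f: "f \<in> carrier H"
    have "Im (ip H (Y f) f) = 0"
      using Ysa[OF f f] ip_commute[OF f Ym[OF f]] by (metis Reals_cnj_iff complex_is_Real_iff)
    then show "Im (ip H (S f) f) = 0" using f by (simp add: S_def ip_simps Ym ip_self_im)
    have "Re (ip H (Y f) f) \<le> ip_norm H (Y f) * ip_norm H f"
      using Cauchy_Schwarz[OF Ym[OF f] f] complex_Re_le_cmod order_trans by blast
    also have "\<dots> \<le> (ip_norm H f)\<^sup>2"
      unfolding power2_eq_square by (intro mult_right_mono Yn norm_nonneg f)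
    finally show "0 \<le> Re (ip H (S f) f)" using f by (simp add: S_def ip_simps Ym norm_sq)
  qed
  have comm: "X (S f) = S (X f)"
    if X: "X \<in> bounded_ops H H" and XT: "\<And>f. f \<in> carrier H \<Longrightarrow> X (T f) = T (X f)" and f: "f \<in> carrier H" for X f
  proof -
    note XD = bounded_opsD[OF X]
    \<comment> \<open>Commuting with \<open>T\<close> is commuting with \<open>B = 1 - T\<close>.\<close>
    have XB: "X (B g) = B (X g)" if "g \<in> carrier H" for g
      using that by (simp add: B_def bounded_ops_diff[OF X semi_ip_axioms] TD XT)
    have "ip_lim (\<lambda>n. X (half_iter B n f)) (X (Y f))"
      by (rule bounded_ops_lim[OF X semi_ip_axioms semi_ip_axioms Y[OF f]])
    then have "ip_lim (\<lambda>n. half_iter B n (X f)) (X (Y f))"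
      using half_iter_commute[OF B XD(1) XD(2) XD(3) XB f] by simp
    then have "X (Y f) = Y (X f)" using ip_lim_unique Y XD f by blast
    then show ?thesis using f by (simp add: S_def bounded_ops_diff[OF X semi_ip_axioms] Ym XD)
  qed
  show ?thesis by (rule that[OF Sp SS comm])
qed

text \<open>
Any other root \<open>R\<close> commutes with \<open>T = R R\<close>, hence with the constructed root \<open>S\<close>. For
\<open>g = R f - S f\<close> this gives $(R + S)g = R^2 f - S^2 f = 0$, so the forms of \<open>R\<close> and \<open>S\<close> both vanish at \<open>g\<close> and
\<open>R g = S g = 0\<close>. Then $\|g\|^2 = \langle f, Rg - Sg\rangle = 0$.
\<close>

theorem sqrt_unique_exists:
  assumes T: "T \<in> positive_ops H"
    and contr: "\<And>f. f \<in> carrier H \<Longrightarrow> ip_norm H (T f) \<le> ip_norm H f"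
  shows "\<exists>!S. S \<in> positive_ops H \<and> compose (carrier H) S S = T"
proof -
  obtain S where S: "S \<in> positive_ops H" "compose (carrier H) S S = T"
    and comm: "\<And>X f. X \<in> bounded_ops H H \<Longrightarrow> (\<And>f. f \<in> carrier H \<Longrightarrow> X (T f) = T (X f)) \<Longrightarrow> f \<in> carrier H
      \<Longrightarrow> X (S f) = S (X f)"
    using sqrt_exists_commuting[OF T contr] by blast
  have Sb: "S \<in> bounded_ops H H" using S by (auto simp: positive_ops_def)
  have "R = S" if R: "R \<in> positive_ops H" "compose (carrier H) R R = T" for R
  proof (rule bounded_ops_eqI[OF _ Sb])
    show Rb: "R \<in> bounded_ops H H" using R by (auto simp: positive_ops_def)
    fix f assume f: "f \<in> carrier H"
    have RR: "R (R g) = T g" and SS: "S (S g) = T g" if "g \<in> carrier H" for g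
      using compose_eq[OF that, of R R] compose_eq[OF that, of S S] R(2) S(2) by simp_all
    have Rm: "g \<in> carrier H \<Longrightarrow> R g \<in> carrier H" and Sm: "g \<in> carrier H \<Longrightarrow> S g \<in> carrier H" for g
      using bounded_opsD(1) Rb Sb by auto
    have "R (T g) = T (R g)" if "g \<in> carrier H" for g
      using RR[of g] RR[of "R g"] that Rm by simp
    then have RS: "R (S f) = S (R f)" by (rule comm[OF Rb _ f])
    define g where "g = R f - S f"
    have g: "g \<in> carrier H" unfolding g_def by (intro diff_mem Rm Sm f)
    have "R g + S g = 0"
      unfolding g_def using f RR SS RS
      by (simp add: bounded_ops_diff[OF Rb semi_ip_axioms] bounded_ops_diff[OF Sb semi_ip_axioms] Rm Sm)
    then have "ip H (R g) g + ip H (S g) g = 0"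
      using g Rm Sm ip_add_left[of "R g" "S g" g] by (simp add: ip_simps)
    moreover have "Im (ip H (R g) g) = 0" "Im (ip H (S g) g) = 0"
      "0 \<le> Re (ip H (R g) g)" "0 \<le> Re (ip H (S g) g)"
      using R S g by (auto simp: positive_ops_def)
    ultimately have "ip H (R g) g = 0" "ip H (S g) g = 0"
      by (auto simp: complex_eq_iff)
    then have "R g = 0" "S g = 0"
      using positive_kernel R(1) S(1) g by auto
    then have "ip H g g = 0"
      using positive_self_adjoint[OF R(1) f g] positive_self_adjoint[OF S(1) f g] f g Rm Sm
      by (simp add: ip_diff_left ip_zero_right g_def)
    then have "g = 0" by (rule ip_definite[OF g])
    then show "R f = S f" by (simp add: g_def)
  qed
  then show ?thesis using S by blast
qed

lemma sqrt_op_properties: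
  assumes "T \<in> positive_ops H"
    and "\<And>f. f \<in> carrier H \<Longrightarrow> ip_norm H (T f) \<le> ip_norm H f"
  shows "sqrt_op H T \<in> positive_ops H" "f \<in> carrier H \<Longrightarrow> sqrt_op H T (sqrt_op H T f) = T f"
    "S \<in> positive_ops H \<Longrightarrow> (\<And>f. f \<in> carrier H \<Longrightarrow> S (S f) = T f) \<Longrightarrow> sqrt_op H T = S"
proof -
  note ex1 = sqrt_unique_exists[OF assms]
  note * = theI'[OF ex1, folded sqrt_op_def]
  show "sqrt_op H T \<in> positive_ops H" using * by blast
  show "f \<in> carrier H \<Longrightarrow> sqrt_op H T (sqrt_op H T f) = T f"
    using * by (metis compose_eq)
  assume S: "S \<in> positive_ops H" "\<And>f. f \<in> carrier H \<Longrightarrow> S (S f) = T f"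
  have "compose (carrier H) S S = T"
    using S assms(1) semi_ip_axioms
    by (intro bounded_ops_eqI[of _ H H] bounded_ops_compose) (auto simp: compose_eq positive_ops_def)
  then show "sqrt_op H T = S" using * S(1) ex1 by blast
qed

end

section \<open>Uniform boundedness\<close>

text \<open>
Baire's argument with nested balls: if the bounds were not uniform, then inside each ball one could
pass to a smaller ball on which some functional of the family exceeds \<open>n\<close>. The common point of the
balls contradicts pointwise boundedness.
\<close>

lemma (in hilbert) uniform_boundedness:
  fixes \<Phi> :: "('a \<Rightarrow> complex) set"
  assumes add: "\<And>\<phi> x y. \<phi> \<in> \<Phi> \<Longrightarrow> x \<in> carrier H \<Longrightarrow> y \<in> carrier H \<Longrightarrow> \<phi> (x + y) = \<phi> x + \<phi> y"
    and scale: "\<And>\<phi> c x. \<phi> \<in> \<Phi> \<Longrightarrow> x \<in> carrier H \<Longrightarrow> \<phi> (c *\<^sub>C x) = c * \<phi> x"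
    and bdd: "\<And>\<phi>. \<phi> \<in> \<Phi> \<Longrightarrow> \<exists>D. \<forall>x\<in>carrier H. cmod (\<phi> x) \<le> D * ip_norm H x"
    and ptw: "\<And>x. x \<in> carrier H \<Longrightarrow> \<exists>M. \<forall>\<phi>\<in>\<Phi>. cmod (\<phi> x) \<le> M"
  shows "\<exists>C. \<forall>\<phi>\<in>\<Phi>. \<forall>x\<in>carrier H. cmod (\<phi> x) \<le> C * ip_norm H x"
proof (rule ccontr)
  assume "\<not> ?thesis"
  then have unb: "\<exists>\<phi>\<in>\<Phi>. \<exists>f\<in>carrier H. C * ip_norm H f < cmod (\<phi> f)" for C
    by (meson not_le)
  have diff: "\<phi> (x - y) = \<phi> x - \<phi> y" if "\<phi> \<in> \<Phi>" "x \<in> carrier H" "y \<in> carrier H" for \<phi> x y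
    using add[OF that(1,2) neg_mem[OF that(3)]] scale[OF that(1,3), of "-1"] by (simp add: scaleC_minus_one)
  define good where "good n p q \<longleftrightarrow> fst q \<in> carrier H \<and> 0 < snd q \<and> snd q \<le> snd p / 2 \<and>
      ip_norm H (fst q - fst p) \<le> snd p / 2 \<and>
      (\<exists>\<phi>\<in>\<Phi>. \<forall>y\<in>carrier H. ip_norm H (y - fst q) \<le> snd q \<longrightarrow> real n \<le> cmod (\<phi> y))"
    for n and p q :: "'a \<times> real"
  have step: "\<exists>q. good n (x, r) q" if x: "x \<in> carrier H" and r: "0 < r" for n x r
  proof -
    obtain \<phi> f where \<phi>: "\<phi> \<in> \<Phi>" and f: "f \<in> carrier H"
      and big: "(2 * (real n + 1) / r) * ip_norm H f < cmod (\<phi> f)"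
      using unb by blast
    have nf: "0 < ip_norm H f"
    proof (rule ccontr)
      assume "\<not> 0 < ip_norm H f"
      then have "f = 0" using norm_nonneg[OF f] norm_eq_zero[OF f] by simp
      then show False using big scale[OF \<phi> f, of 0] by (simp add: norm_zero)
    qed
    \<comment> \<open>Rescaled to norm \<open>r / 2\<close>; then \<open>\<phi>\<close> exceeds \<open>n + 1\<close> in modulus at \<open>e\<close>, hence at \<open>x + e\<close> or at \<open>x - e\<close>.\<close>
    define e where "e = complex_of_real (r / (2 * ip_norm H f)) *\<^sub>C f"
    have e: "e \<in> carrier H" unfolding e_def by (rule scale_mem[OF f])
    have ne: "ip_norm H e = r / 2"
      unfolding e_def using nf r by (simp add: norm_scale[OF f] norm_divide norm_mult)
    have "cmod (\<phi> e) = r / (2 * ip_norm H f) * cmod (\<phi> f)"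
      unfolding e_def using nf r by (simp add: scale[OF \<phi> f] norm_mult norm_divide)
    also have "\<dots> > r / (2 * ip_norm H f) * ((2 * (real n + 1) / r) * ip_norm H f)"
      using nf r by (intro mult_strict_left_mono big) simp
    also have "r / (2 * ip_norm H f) * ((2 * (real n + 1) / r) * ip_norm H f) = real n + 1"
      using nf r by (simp add: field_simps)
    finally have \<phi>e: "real n + 1 < cmod (\<phi> e)" .
    have "2 * \<phi> e = \<phi> (x + e) - \<phi> (x - e)"
      by (simp add: add[OF \<phi> x e] diff[OF \<phi> x e])
    then have "2 * cmod (\<phi> e) \<le> cmod (\<phi> (x + e)) + cmod (\<phi> (x - e))"
      by (metis norm_mult norm_numeral norm_triangle_ineq4)
    then have "\<exists>x'. x' \<in> carrier H \<and> ip_norm H (x' - x) = r / 2 \<and> real n + 1 < cmod (\<phi> x')"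
    proof (cases "real n + 1 < cmod (\<phi> (x + e))")
      case True
      then show ?thesis using x e ne by (intro exI[of _ "x + e"]) (simp add: mem)
    next
      case False
      then show ?thesis using \<phi>e \<open>2 * cmod (\<phi> e) \<le> _\<close> x e ne
        by (intro exI[of _ "x - e"]) (simp add: mem norm_minus)
    qed
    then obtain x' where x': "x' \<in> carrier H" "ip_norm H (x' - x) = r / 2" "real n + 1 < cmod (\<phi> x')"
      by blast
    obtain D where D: "\<And>y. y \<in> carrier H \<Longrightarrow> cmod (\<phi> y) \<le> D * ip_norm H y" using bdd[OF \<phi>] by blast
    \<comment> \<open>On the ball of radius \<open>s\<close> around \<open>x'\<close> the value of \<open>\<phi>\<close> changes by at most \<open>1\<close>.\<close>
    define s where "s = min (r / 2) (1 / (\<bar>D\<bar> + 1))"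
    have s: "0 < s" using r by (simp add: s_def add_nonneg_pos)
    have "real n \<le> cmod (\<phi> y)" if y: "y \<in> carrier H" and close: "ip_norm H (y - x') \<le> s" for y
    proof -
      have "cmod (\<phi> x' - \<phi> y) = cmod (\<phi> (y - x'))" by (simp add: diff[OF \<phi> y x'(1)] norm_minus_commute)
      also have "\<dots> \<le> D * ip_norm H (y - x')" by (rule D[OF diff_mem[OF y x'(1)]])
      also have "\<dots> \<le> (\<bar>D\<bar> + 1) * s"
        using close norm_nonneg[OF diff_mem[OF y x'(1)]] by (intro mult_mono) auto
      also have "\<dots> \<le> 1"
      proof -
        have "s * (\<bar>D\<bar> + 1) \<le> 1 / (\<bar>D\<bar> + 1) * (\<bar>D\<bar> + 1)" by (intro mult_right_mono) (auto simp: s_def)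
        then show ?thesis by (simp add: mult.commute split: if_splits)
      qed
      finally show ?thesis using x'(3) norm_triangle_ineq2[of "\<phi> x'" "\<phi> y"] by linarith
    qed
    then show ?thesis
      using x' s \<phi> by (intro exI[of _ "(x', s)"]) (auto simp: good_def s_def)
  qed
  have "\<exists>p. \<forall>n. (fst (p n) \<in> carrier H \<and> 0 < snd (p n)) \<and> good n (p n) (p (Suc n))"
  proof (rule dependent_nat_choice)
    show "\<exists>p :: 'a \<times> real. fst p \<in> carrier H \<and> 0 < snd p"
      by (intro exI[of _ "(0, 1)"]) (simp add: zero_mem)
  next
    fix p :: "'a \<times> real" and n
    assume "fst p \<in> carrier H \<and> 0 < snd p"
    then obtain q where "good n (fst p, snd p) q" using step by blast
    then show "\<exists>q. (fst q \<in> carrier H \<and> 0 < snd q) \<and> good n p q"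
      by (intro exI[of _ q]) (simp add: good_def)
  qed
  then obtain p where p: "\<And>n. fst (p n) \<in> carrier H" "\<And>n. 0 < snd (p n)" "\<And>n. good n (p n) (p (Suc n))"
    by blast
  define X r where "X n = fst (p n)" and "r n = snd (p n)" for n
  have X: "X n \<in> carrier H" and r0: "0 < r n" and rhalf: "r (Suc n) \<le> r n / 2"
    and Xclose: "ip_norm H (X (Suc n) - X n) \<le> r n / 2"
    and big: "\<exists>\<phi>\<in>\<Phi>. \<forall>y\<in>carrier H. ip_norm H (y - X (Suc n)) \<le> r (Suc n) \<longrightarrow> real n \<le> cmod (\<phi> y)" for n
    using p(1)[of n] p(2)[of n] p(3)[of n] by (auto simp: X_def r_def good_def)
  have nest: "ip_norm H (y - X n) \<le> r n" if y: "y \<in> carrier H" and "ip_norm H (y - X (Suc n)) \<le> r (Suc n)" for y n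
    using norm_triangle_sub[OF y X[of "Suc n"] X[of n]] Xclose[of n] rhalf[of n] that(2) by linarith
  have nest': "ip_norm H (X m - X n) \<le> r n" if "n \<le> m" for m n
  proof -
    have "ip_norm H (y - X m) \<le> r m \<Longrightarrow> y \<in> carrier H \<Longrightarrow> ip_norm H (y - X n) \<le> r n" for y
      using that by (induction rule: dec_induct) (auto intro: nest)
    from this[of "X m"] show ?thesis using X r0[of m] by (simp add: norm_zero)
  qed
  have rle: "r n \<le> r 0 * (1/2) ^ n" for n
  proof (induction n)
    case (Suc n)
    then show ?case using rhalf[of n] by simp
  qed simp
  have "(\<lambda>n. r 0 * (1/2) ^ n) \<longlonglongrightarrow> 0"
    by (intro tendsto_mult_right_zero LIMSEQ_power_zero) simp
  then have r_lim: "r \<longlonglongrightarrow> 0"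
    by (rule tendsto_sandwich[OF _ _ tendsto_const, rotated 2])
       (auto intro!: always_eventually less_imp_le[OF r0] rle)
  obtain x where x: "ip_lim X x"
    using complete[OF ip_cauchyI[OF X nest' r_lim]] by blast
  then have xH: "x \<in> carrier H" by (simp add: ip_lim_def)
  obtain M where M: "\<And>\<phi>. \<phi> \<in> \<Phi> \<Longrightarrow> cmod (\<phi> x) \<le> M" using ptw[OF xH] by blast
  obtain n where n: "M < real n" using reals_Archimedean2 by blast
  have "ip_norm H (x - X (Suc n)) \<le> r (Suc n)"
    by (rule ip_lim_bound[OF x X nest'])
  then show False using big[of n] xH M n by fastforce
qed

section \<open>Unitary operators\<close>

lemma unitary_opsD:
  assumes "U \<in> unitary_ops H K"
  shows "U \<in> bounded_ops H K" "U ` carrier H = carrier K"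
    "f \<in> carrier H \<Longrightarrow> g \<in> carrier H \<Longrightarrow> ip K (U f) (U g) = ip H f g"
    "f \<in> carrier H \<Longrightarrow> ip_norm K (U f) = ip_norm H f"
  using assms by (simp_all add: unitary_ops_def ip_norm_def)

lemma isometry_bounded:
  assumes "\<And>f. f \<in> carrier H \<Longrightarrow> T f \<in> carrier K"
    and "\<And>f g. f \<in> carrier H \<Longrightarrow> g \<in> carrier H \<Longrightarrow> T (f + g) = T f + T g"
    and "\<And>c f. f \<in> carrier H \<Longrightarrow> T (c *\<^sub>C f) = c *\<^sub>C T f"
    and "\<And>f g. f \<in> carrier H \<Longrightarrow> g \<in> carrier H \<Longrightarrow> ip K (T f) (T g) = ip H f g"
    and "\<And>f. f \<notin> carrier H \<Longrightarrow> T f = undefined"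
  shows "T \<in> bounded_ops H K"
  by (rule bounded_opsI[where C=1]) (use assms in \<open>simp_all add: ip_norm_def\<close>)

lemma unitary_inj:
  assumes U: "U \<in> unitary_ops H K" and H: "inner_space H"
  shows "inj_on U (carrier H)"
proof (rule inj_onI)
  interpret inner_space H by fact
  fix f g assume f: "f \<in> carrier H" and g: "g \<in> carrier H" and eq: "U f = U g"
  show "f = g"
    by (rule eq_if_ip_eq[OF f g]) (metis unitary_opsD(3)[OF U] eq f g)
qed

text \<open>
Outside the carrier the inverse is undefined, as the extensionality of operators requires.
\<close>

definition unitary_inverse :: "('v::complex_vector, 'm) ip_space_scheme \<Rightarrow>
    ('w::complex_vector, 'n) ip_space_scheme \<Rightarrow> ('v \<Rightarrow> 'w) \<Rightarrow> 'w \<Rightarrow> 'v" where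
  "unitary_inverse H K U = (\<lambda>f\<in>carrier K. inv_into (carrier H) U f)"

lemma unitary_inverse:
  assumes U: "U \<in> unitary_ops H K" and H: "inner_space H" and K: "semi_ip K"
  shows "unitary_inverse H K U \<in> unitary_ops K H"
    and "f \<in> carrier H \<Longrightarrow> unitary_inverse H K U (U f) = f"
    and "g \<in> carrier K \<Longrightarrow> U (unitary_inverse H K U g) = g"
proof -
  interpret H: inner_space H by fact
  interpret K: semi_ip K by fact
  let ?V = "unitary_inverse H K U"
  note UD = bounded_opsD[OF unitary_opsD(1)[OF U]]
  note inj = unitary_inj[OF U H]
  have img: "U ` carrier H = carrier K" using U by (simp add: unitary_ops_def)
  have VU: "?V (U f) = f" if "f \<in> carrier H" for f
    using that UD(1) inj by (simp add: unitary_inverse_def)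
  have UV: "U (?V g) = g" if "g \<in> carrier K" for g
    using that img by (simp add: unitary_inverse_def f_inv_into_f)
  have Vm: "?V g \<in> carrier H" if "g \<in> carrier K" for g
    using that img inv_into_into[of g U "carrier H"] by (simp add: unitary_inverse_def)
  show "f \<in> carrier H \<Longrightarrow> ?V (U f) = f" by (rule VU)
  show "g \<in> carrier K \<Longrightarrow> U (?V g) = g" by (rule UV)
  have ipV: "ip H (?V f) (?V g) = ip K f g" if "f \<in> carrier K" "g \<in> carrier K" for f g
    using unitary_opsD(3)[OF U Vm[OF that(1)] Vm[OF that(2)]] that by (simp add: UV)
  have "?V \<in> bounded_ops K H"
  proof (rule isometry_bounded)
    fix f g assume f: "f \<in> carrier K" and g: "g \<in> carrier K"
    have "U (?V f + ?V g) = f + g" using f g by (simp add: UD Vm UV)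
    then show "?V (f + g) = ?V f + ?V g"
      using VU[OF H.add_mem[OF Vm[OF f] Vm[OF g]]] by simp
  next
    fix c f assume f: "f \<in> carrier K"
    have "U (c *\<^sub>C ?V f) = c *\<^sub>C f" using f by (simp add: UD Vm UV)
    then show "?V (c *\<^sub>C f) = c *\<^sub>C ?V f"
      using VU[OF H.scale_mem[OF Vm[OF f]], of c] by simp
  next
    fix f assume "f \<notin> carrier K"
    then show "?V f = undefined" by (simp add: unitary_inverse_def)
  qed (intro Vm ipV; assumption)+
  moreover have "?V ` carrier K = carrier H"
  proof
    show "?V ` carrier K \<subseteq> carrier H" using Vm by auto
    show "carrier H \<subseteq> ?V ` carrier K"
    proof
      fix f assume "f \<in> carrier H"
      then show "f \<in> ?V ` carrier K" using VU[of f] UD(1)[of f] by (metis imageI)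
    qed
  qed
  ultimately show "?V \<in> unitary_ops K H" by (simp add: unitary_ops_def ipV)
qed

lemma unitary_compose:
  assumes U: "U \<in> unitary_ops H K" and W: "W \<in> unitary_ops K M" and H: "semi_ip H" and K: "semi_ip K"
  shows "compose (carrier H) W U \<in> unitary_ops H M"
proof -
  have "compose (carrier H) W U \<in> bounded_ops H M"
    using U W H K by (intro bounded_ops_compose) (auto simp: unitary_ops_def)
  moreover have "compose (carrier H) W U ` carrier H = carrier M"
  proof -
    have "compose (carrier H) W U ` carrier H = W ` (U ` carrier H)"
      by (auto simp: compose_def image_image)
    then show ?thesis using U W by (simp add: unitary_ops_def)
  qed
  ultimately show ?thesis
    using unitary_opsD(3)[OF U] unitary_opsD(3)[OF W] bounded_opsD(1)[OF unitary_opsD(1)[OF U]]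
    by (simp add: unitary_ops_def compose_def)
qed

lemma unitary_id: "semi_ip H \<Longrightarrow> (\<lambda>f\<in>carrier H. f) \<in> unitary_ops H H"
  by (simp add: unitary_ops_def bounded_ops_id)

lemma (in hilbert) adjoint_op_eqI:
  assumes "T \<in> bounded_ops H H" "S \<in> bounded_ops H H"
    and "\<And>f g. f \<in> carrier H \<Longrightarrow> g \<in> carrier H \<Longrightarrow> ip H (T f) g = ip H f (S g)"
  shows "adjoint_op H T = S"
  unfolding adjoint_op_def
  by (rule the1_equality[OF adjoint_exists[OF assms(1)]]) (use assms in blast)

lemma (in hilbert) adjoint_op:
  assumes "T \<in> bounded_ops H H"
  shows "adjoint_op H T \<in> bounded_ops H H"
    and "f \<in> carrier H \<Longrightarrow> g \<in> carrier H \<Longrightarrow> ip H (T f) g = ip H f (adjoint_op H T g)"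
  using theI'[OF adjoint_exists[OF assms], folded adjoint_op_def] by blast+

context
  fixes H :: "('v::complex_vector, 'm) ip_space_scheme" and K :: "('w::complex_vector, 'n) ip_space_scheme"
    and W :: "'v \<Rightarrow> 'w"
  assumes H: "hilbert H" and K: "hilbert K" and W: "W \<in> unitary_ops H K"
begin

interpretation H: hilbert H by (rule H)
interpretation K: hilbert K by (rule K)

lemma Ad_eq: "Ad H K W X = (\<lambda>f\<in>carrier K. W (X (unitary_inverse H K W f)))"
  by (auto simp: Ad_def unitary_inverse_def restrict_def)

lemma Ad_bounded:
  assumes X: "X \<in> bounded_ops H H"
  shows "Ad H K W X \<in> bounded_ops K K"
proof -
  note V = unitary_inverse[OF W H.inner_space_axioms K.semi_ip_axioms]
  have "compose (carrier K) W (compose (carrier K) X (unitary_inverse H K W)) \<in> bounded_ops K K"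
    by (intro bounded_ops_compose[where K=H] X unitary_opsD(1)[OF W] unitary_opsD(1)[OF V(1)] H.semi_ip_axioms K.semi_ip_axioms)
  then show ?thesis by (simp add: Ad_eq compose_def cong: restrict_cong)
qed

lemma Ad_inverse:
  assumes X: "X \<in> bounded_ops H H"
  shows "Ad K H (unitary_inverse H K W) (Ad H K W X) = X"
proof (rule bounded_ops_eqI[OF _ X])
  note V = unitary_inverse[OF W H.inner_space_axioms K.semi_ip_axioms]
  have inv: "inv_into (carrier K) (unitary_inverse H K W) f = W f" if "f \<in> carrier H" for f
    using that V(2)[OF that] unitary_inj[OF V(1) K.inner_space_axioms] bounded_opsD(1)[OF unitary_opsD(1)[OF W]]
    by (intro inv_into_f_eq) auto
  have eq: "Ad K H (unitary_inverse H K W) (Ad H K W X) = (\<lambda>f\<in>carrier H. X f)"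
    unfolding Ad_def[of K H] Ad_eq
    by (rule restrict_ext)
       (simp add: inv V(2) bounded_opsD(1)[OF X] bounded_opsD(1)[OF unitary_opsD(1)[OF W]])
  show "Ad K H (unitary_inverse H K W) (Ad H K W X) f = X f" if "f \<in> carrier H" for f
    using that by (simp add: eq)
  show "Ad K H (unitary_inverse H K W) (Ad H K W X) \<in> bounded_ops H H"
    unfolding eq using X bounded_opsD[OF X]
    by (metis (mono_tags, lifting) bounded_ops_def mem_Collect_eq PiE_restrict)
qed

end

context
  fixes H :: "('v::complex_vector, 'm) ip_space_scheme" and K :: "('w::complex_vector, 'n) ip_space_scheme"
    and W :: "'v \<Rightarrow> 'w"
  assumes H: "hilbert H" and K: "hilbert K" and W: "W \<in> unitary_ops H K"
begin

interpretation H: hilbert H by (rule H)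
interpretation K: hilbert K by (rule K)

text \<open>
With this, \<open>Ad_inverse\<close> applied to the inverse of \<open>W\<close> supplies the other half of the bijection.
\<close>

lemma unitary_inverse_inverse: "unitary_inverse K H (unitary_inverse H K W) = W"
proof (rule bounded_ops_eqI)
  note V = unitary_inverse[OF W H.inner_space_axioms K.semi_ip_axioms]
  note V' = unitary_inverse[OF V(1) K.inner_space_axioms H.semi_ip_axioms]
  show "unitary_inverse K H (unitary_inverse H K W) \<in> bounded_ops H K" by (rule unitary_opsD(1)[OF V'(1)])
  show "W \<in> bounded_ops H K" by (rule unitary_opsD(1)[OF W])
  fix f assume f: "f \<in> carrier H"
  show "unitary_inverse K H (unitary_inverse H K W) f = W f"
    using V'(2)[of "W f"] V(2)[OF f] bounded_opsD(1)[OF unitary_opsD(1)[OF W] f] by simp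
qed

text \<open>
Conjugation by \<open>W\<close> respects all the operations, and conjugation by the inverse of \<open>W\<close> undoes it.
For the adjoint, \<open>W\<close> moves across the inner product because it is isometric and onto.
\<close>

theorem Ad_cstar_iso: "cstar_iso H K (Ad H K W)"
  unfolding cstar_iso_def
proof (intro conjI ballI allI)
  note V = unitary_inverse[OF W H.inner_space_axioms K.semi_ip_axioms]
  let ?V = "unitary_inverse H K W"
  note WD = bounded_opsD[OF unitary_opsD(1)[OF W]]
  note VD = bounded_opsD[OF unitary_opsD(1)[OF V(1)]]
  show "bij_betw (Ad H K W) (bounded_ops H H) (bounded_ops K K)"
  proof (rule bij_betw_byWitness[where f'="Ad K H ?V"])
    show "\<forall>X\<in>bounded_ops H H. Ad K H ?V (Ad H K W X) = X"
      using Ad_inverse[OF H K W] by blast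
    show "\<forall>Y\<in>bounded_ops K K. Ad H K W (Ad K H ?V Y) = Y"
      using Ad_inverse[OF K H V(1)] by (simp add: unitary_inverse_inverse)
    show "Ad H K W ` bounded_ops H H \<subseteq> bounded_ops K K"
      using Ad_bounded[OF H K W] by blast
    show "Ad K H ?V ` bounded_ops K K \<subseteq> bounded_ops H H"
      using Ad_bounded[OF K H V(1)] by blast
  qed
  fix X assume X: "X \<in> bounded_ops H H"
  note XD = bounded_opsD[OF X]
  show "Ad H K W (\<lambda>f\<in>carrier H. c *\<^sub>C X f) = (\<lambda>f\<in>carrier K. c *\<^sub>C Ad H K W X f)" for c
    unfolding Ad_eq[OF H K W] by (rule restrict_ext) (simp add: VD(1) XD(1) WD(3))
  show "Ad H K W (adjoint_op H X) = adjoint_op K (Ad H K W X)"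
  proof (rule K.adjoint_op_eqI[symmetric])
    note adj = H.adjoint_op[OF X]
    show "Ad H K W X \<in> bounded_ops K K" "Ad H K W (adjoint_op H X) \<in> bounded_ops K K"
      using Ad_bounded[OF H K W] X adj(1) by blast+
    fix f g assume f: "f \<in> carrier K" and g: "g \<in> carrier K"
    have "ip K (W (X (?V f))) g = ip K (W (X (?V f))) (W (?V g))" using g by (simp add: V(3))
    also have "\<dots> = ip H (X (?V f)) (?V g)" using f g by (intro unitary_opsD(3)[OF W] XD VD)
    also have "\<dots> = ip H (?V f) (adjoint_op H X (?V g))" using f g by (intro adj(2) VD)
    also have "\<dots> = ip K (W (?V f)) (W (adjoint_op H X (?V g)))"
      using f g by (intro unitary_opsD(3)[OF W, symmetric] bounded_opsD(1)[OF adj(1)] VD(1))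
    also have "\<dots> = ip K f (W (adjoint_op H X (?V g)))" using f by (simp add: V(3))
    finally show "ip K (Ad H K W X f) g = ip K f (Ad H K W (adjoint_op H X) g)"
      using f g by (simp add: Ad_eq[OF H K W])
  qed
  fix Y assume Y: "Y \<in> bounded_ops H H"
  note YD = bounded_opsD[OF Y]
  show "Ad H K W (\<lambda>f\<in>carrier H. X f + Y f) = (\<lambda>f\<in>carrier K. Ad H K W X f + Ad H K W Y f)"
    unfolding Ad_eq[OF H K W] by (rule restrict_ext) (simp add: VD(1) XD(1) YD(1) WD(2))
  show "Ad H K W (compose (carrier H) X Y) = compose (carrier K) (Ad H K W X) (Ad H K W Y)"
    unfolding Ad_eq[OF H K W] compose_def
    by (rule restrict_ext) (simp add: VD(1) XD(1) YD(1) WD(1) V(2))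
qed

end

text \<open>
The extension \<open>U\<close> is defined by duality, $\langle v, Uf\rangle = \langle T^{-1}v, f\rangle$ for \<open>v\<close> in \<open>V\<close>,
which avoids extending along limits. The same construction extends the inverse of \<open>T\<close>, and the
composite is the identity on the total subspace \<open>V\<close>, hence everywhere.
\<close>

lemma (in hilbert) isometry_extends_to_unitary:
  assumes V: "total_in V" and onto: "T ` V = V"
    and T_add: "\<And>x y. x \<in> V \<Longrightarrow> y \<in> V \<Longrightarrow> T (x + y) = T x + T y"
    and T_scale: "\<And>c x. x \<in> V \<Longrightarrow> T (c *\<^sub>C x) = c *\<^sub>C T x"
    and T_ip: "\<And>x y. x \<in> V \<Longrightarrow> y \<in> V \<Longrightarrow> ip H (T x) (T y) = ip H x y"
  obtains U where "U \<in> unitary_ops H H" "\<And>v. v \<in> V \<Longrightarrow> U v = T v"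
proof -
  have VH: "v \<in> V \<Longrightarrow> v \<in> carrier H" and Vadd: "v \<in> V \<Longrightarrow> w \<in> V \<Longrightarrow> v + w \<in> V"
    and Vscale: "v \<in> V \<Longrightarrow> c *\<^sub>C v \<in> V" and V0: "0 \<in> V" for v w c
    using V by (auto simp: total_in_def subspace_of_def)
  \<comment> \<open>\<open>V\<close> is an inner product space of its own, and \<open>T\<close> is unitary on it.\<close>
  define P where "P = \<lparr>carrier = V, ip = ip H\<rparr>"
  have P: "inner_space P"
    by unfold_locales
       (simp_all add: P_def V0 Vadd Vscale VH ip_add_left ip_scale_left ip_nonneg ip_definite ip_commute[symmetric])
  have Tm: "v \<in> V \<Longrightarrow> T v \<in> V" for v using onto by blast
  define T0 where "T0 = restrict T V"
  have T0: "T0 \<in> unitary_ops P P"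
  proof -
    have "T0 \<in> bounded_ops P P"
      by (rule isometry_bounded) (simp_all add: P_def T0_def Tm T_add T_scale T_ip Vadd Vscale)
    then show ?thesis by (simp add: unitary_ops_def) (simp add: P_def T0_def onto T_ip)
  qed
  have extend: "\<exists>U \<in> bounded_ops H H. (\<forall>v\<in>V. U v = R v)" if R: "R \<in> unitary_ops P P" for R
  proof -
    interpret P: inner_space P by (rule P)
    note Q = unitary_inverse[OF R P P.semi_ip_axioms]
    let ?Q = "unitary_inverse P P R"
    have Qm: "v \<in> V \<Longrightarrow> ?Q v \<in> V" and Rm: "v \<in> V \<Longrightarrow> R v \<in> V" for v
      using bounded_opsD(1)[OF unitary_opsD(1)[OF Q(1)], of v] bounded_opsD(1)[OF unitary_opsD(1)[OF R], of v]
      by (simp_all add: P_def)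
    have Qadd: "v \<in> V \<Longrightarrow> w \<in> V \<Longrightarrow> ?Q (v + w) = ?Q v + ?Q w" and Qscale: "v \<in> V \<Longrightarrow> ?Q (c *\<^sub>C v) = c *\<^sub>C ?Q v" for v w c
      using bounded_opsD(2,3)[OF unitary_opsD(1)[OF Q(1)], of v] by (simp_all add: P_def)
    have Qn: "v \<in> V \<Longrightarrow> ip_norm H (?Q v) = ip_norm H v" for v
      using unitary_opsD(4)[OF Q(1), of v] by (simp add: P_def ip_norm_def)
    obtain U where U: "U \<in> bounded_ops H H" "\<And>f v. f \<in> carrier H \<Longrightarrow> v \<in> V \<Longrightarrow> ip H v (U f) = ip H (?Q v) f"
    proof (rule operator_from_form[OF semi_ip_axioms V, of 1 "\<lambda>f v. ip H (?Q v) f"])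
      fix f v assume "f \<in> carrier H" "v \<in> V"
      then show "cmod (ip H (?Q v) f) \<le> 1 * ip_norm H f * ip_norm H v"
        using Cauchy_Schwarz[OF VH[OF Qm] , of v f] by (simp add: Qn mult.commute)
    qed (simp_all add: Qadd Qscale Qm VH ip_simps)
    have "U v = R v" if v: "v \<in> V" for v
    proof (rule total_in_eq[OF V])
      show "U v \<in> carrier H" using bounded_opsD(1)[OF U(1)] v VH by blast
      show "R v \<in> carrier H" using v Rm VH by blast
      fix w assume w: "w \<in> V"
      have "ip H w (R v) = ip H (R (?Q w)) (R v)" using Q(3)[of w] w by (simp add: P_def)
      also have "\<dots> = ip H (?Q w) v"
        using unitary_opsD(3)[OF R, of "?Q w" v] w v Qm by (simp add: P_def)
      finally show "ip H w (U v) = ip H w (R v)" using U(2)[of v w] v w VH by simp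
    qed
    then show ?thesis using U(1) by blast
  qed
  interpret P: inner_space P by (rule P)
  note Q = unitary_inverse[OF T0 P P.semi_ip_axioms]
  let ?Q = "unitary_inverse P P T0"
  have Qm: "v \<in> V \<Longrightarrow> ?Q v \<in> V" for v
    using bounded_opsD(1)[OF unitary_opsD(1)[OF Q(1)], of v] by (simp add: P_def)
  obtain U where U: "U \<in> bounded_ops H H" "\<And>v. v \<in> V \<Longrightarrow> U v = T v"
    using extend[OF T0] by (auto simp: T0_def)
  obtain U' where U': "U' \<in> bounded_ops H H" "\<And>v. v \<in> V \<Longrightarrow> U' v = ?Q v"
    using extend[OF Q(1)] by auto
  note UD = bounded_opsD[OF U(1)] and U'D = bounded_opsD[OF U'(1)]
  have "compose (carrier H) U U' = (\<lambda>f\<in>carrier H. f)"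
  proof (rule bounded_ops_eq_on_total[OF hilbert_axioms inner_space_axioms V])
    fix v assume v: "v \<in> V"
    have "T (?Q v) = v" using Q(3)[of v] v Qm by (simp add: P_def T0_def)
    then show "compose (carrier H) U U' v = (\<lambda>f\<in>carrier H. f) v"
      using v VH Qm by (simp add: compose_def U(2) U'(2))
  qed (rule bounded_ops_compose[OF U(1) U'(1) semi_ip_axioms semi_ip_axioms],
      rule bounded_ops_id[OF semi_ip_axioms])
  then have UU': "U (U' f) = f" if "f \<in> carrier H" for f
    using compose_eq[OF that, of U U'] that by simp
  have ip1: "ip H (U v) (U g) = ip H v g" if v: "v \<in> V" and g: "g \<in> carrier H" for v g
  proof -
    obtain X where X: "\<And>n. X n \<in> V" "ip_lim X g" using total_in_approx[OF V g] by blast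
    have "(\<lambda>n. ip H (U v) (U (X n))) \<longlonglongrightarrow> ip H (U v) (U g)"
      by (intro ip_lim_ip_right bounded_ops_lim[OF U(1)] semi_ip_axioms X UD(1) VH v)
    moreover have "(\<lambda>n. ip H v (X n)) \<longlonglongrightarrow> ip H v g"
      by (intro ip_lim_ip_right X VH v)
    ultimately show ?thesis
      using LIMSEQ_unique v X(1) by (simp add: U(2) T_ip) blast
  qed
  have ip2: "ip H (U f) (U g) = ip H f g" if f: "f \<in> carrier H" and g: "g \<in> carrier H" for f g
  proof -
    obtain X where X: "\<And>n. X n \<in> V" "ip_lim X f" using total_in_approx[OF V f] by blast
    have "(\<lambda>n. ip H (U (X n)) (U g)) \<longlonglongrightarrow> ip H (U f) (U g)"
      by (intro ip_lim_ip_left bounded_ops_lim[OF U(1)] semi_ip_axioms X UD(1) g)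
    then have "(\<lambda>n. ip H (X n) g) \<longlonglongrightarrow> ip H (U f) (U g)" using ip1[OF X(1) g] by simp
    moreover have "(\<lambda>n. ip H (X n) g) \<longlonglongrightarrow> ip H f g"
      by (intro ip_lim_ip_left X g)
    ultimately show ?thesis using LIMSEQ_unique by blast
  qed
  have "U ` carrier H = carrier H"
  proof
    show "U ` carrier H \<subseteq> carrier H" using UD(1) by blast
    show "carrier H \<subseteq> U ` carrier H"
    proof
      fix f assume f: "f \<in> carrier H"
      then show "f \<in> U ` carrier H" using UU'[OF f] U'D(1)[OF f] by (metis imageI)
    qed
  qed
  then have "U \<in> unitary_ops H H" using U(1) ip2 by (simp add: unitary_ops_def)
  then show ?thesis using that U(2) by blast
qed

section \<open>Groups of operators\<close>

lemma op_group_group: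
  assumes sub: "\<G> \<subseteq> carrier H \<rightarrow>\<^sub>E carrier H"
    and one: "(\<lambda>f\<in>carrier H. f) \<in> \<G>"
    and mult: "\<And>S T. S \<in> \<G> \<Longrightarrow> T \<in> \<G> \<Longrightarrow> compose (carrier H) S T \<in> \<G>"
    and inv: "\<And>T. T \<in> \<G> \<Longrightarrow> \<exists>S\<in>\<G>. compose (carrier H) S T = (\<lambda>f\<in>carrier H. f)"
  shows "group (op_group H \<G>)"
proof (rule groupI)
  fix x y z
  assume "x \<in> carrier (op_group H \<G>)" "y \<in> carrier (op_group H \<G>)" "z \<in> carrier (op_group H \<G>)"
  then have "z \<in> carrier H \<rightarrow> carrier H" using sub by (auto simp: op_group_def)
  then show "x \<otimes>\<^bsub>op_group H \<G>\<^esub> y \<otimes>\<^bsub>op_group H \<G>\<^esub> z = x \<otimes>\<^bsub>op_group H \<G>\<^esub> (y \<otimes>\<^bsub>op_group H \<G>\<^esub> z)"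
    by (simp add: op_group_def compose_assoc)
next
  fix x assume x: "x \<in> carrier (op_group H \<G>)"
  then have xE: "x \<in> carrier H \<rightarrow>\<^sub>E carrier H" using sub by (auto simp: op_group_def)
  then have "compose (carrier H) (\<lambda>f\<in>carrier H. f) x = x"
    by (intro Id_compose) (auto simp: PiE_iff)
  then show "\<one>\<^bsub>op_group H \<G>\<^esub> \<otimes>\<^bsub>op_group H \<G>\<^esub> x = x" by (simp add: op_group_def)
  show "\<exists>y\<in>carrier (op_group H \<G>). y \<otimes>\<^bsub>op_group H \<G>\<^esub> x = \<one>\<^bsub>op_group H \<G>\<^esub>"
    using inv x by (simp add: op_group_def)
qed (use one mult in \<open>simp_all add: op_group_def\<close>)

lemma bounded_ops_PiE: "bounded_ops H K \<subseteq> carrier H \<rightarrow>\<^sub>E carrier K"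
  unfolding bounded_ops_def by blast

lemma invertible_ops_bounded: "T \<in> invertible_ops H \<Longrightarrow> T \<in> bounded_ops H H"
  unfolding invertible_ops_def by blast

lemma invertible_ops_inverse:
  assumes "T \<in> invertible_ops H"
  shows "\<exists>S. S \<in> invertible_ops H \<and> (\<forall>f\<in>carrier H. S (T f) = f) \<and> (\<forall>f\<in>carrier H. T (S f) = f) \<and>
    compose (carrier H) S T = (\<lambda>f\<in>carrier H. f)"
proof -
  obtain S where S: "T \<in> bounded_ops H H" "S \<in> bounded_ops H H"
    and eq: "compose (carrier H) S T = (\<lambda>f\<in>carrier H. f)" "compose (carrier H) T S = (\<lambda>f\<in>carrier H. f)"
    using assms unfolding invertible_ops_def by blast
  have "S \<in> invertible_ops H" using S eq unfolding invertible_ops_def by blast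
  moreover have "S (T f) = f" "T (S f) = f" if "f \<in> carrier H" for f
    using fun_cong[OF eq(1), of f] fun_cong[OF eq(2), of f] that by (simp_all add: compose_eq)
  ultimately show ?thesis using eq(1) by blast
qed

lemma invertible_opsI:
  assumes H: "semi_ip H" and T: "T \<in> bounded_ops H H" and S: "S \<in> bounded_ops H H"
    and "\<And>f. f \<in> carrier H \<Longrightarrow> S (T f) = f" "\<And>f. f \<in> carrier H \<Longrightarrow> T (S f) = f"
  shows "T \<in> invertible_ops H"
proof -
  have "compose (carrier H) S T = (\<lambda>f\<in>carrier H. f)" "compose (carrier H) T S = (\<lambda>f\<in>carrier H. f)"
    unfolding compose_def using assms(4,5) by (auto intro: restrict_ext)
  then show ?thesis using T S unfolding invertible_ops_def by blast
qed

section \<open>A Hilbert space densely embedded in another\<close>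

locale dense_embedding = L: hilbert L + H: hilbert H
  for L :: "('v::complex_vector, 'm) ip_space_scheme" and H :: "('v, 'n) ip_space_scheme" +
  assumes H_total: "L.total_in (carrier H)"
    and norm_le: "f \<in> carrier H \<Longrightarrow> ip_norm L f \<le> ip_norm H f"
begin

lemma HL: "f \<in> carrier H \<Longrightarrow> f \<in> carrier L"
  using H_total by (auto simp: L.total_in_def L.subspace_of_def)

lemma riesz_map_exists:
  "\<exists>J. J \<in> bounded_ops L H \<and> (\<forall>f\<in>carrier L. \<forall>v\<in>carrier H. ip H v (J f) = ip L v f) \<and>
    (\<forall>f\<in>carrier L. ip_norm H (J f) \<le> ip_norm L f)"
proof -
  have "cmod (ip L v f) \<le> 1 * ip_norm L f * ip_norm H v" if "f \<in> carrier L" "v \<in> carrier H" for f v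
    using L.Cauchy_Schwarz[OF HL[OF that(2)] that(1)] mult_right_mono[OF norm_le[OF that(2)] L.norm_nonneg[OF that(1)]]
    by (simp add: mult.commute)
  then show ?thesis
    by (rule_tac H.operator_from_form[OF L.semi_ip_axioms H.total_in_carrier, of 1 "\<lambda>f v. ip L v f"])
       (auto simp: L.ip_simps HL)
qed

definition J where
  "J = (SOME J. J \<in> bounded_ops L H \<and> (\<forall>f\<in>carrier L. \<forall>v\<in>carrier H. ip H v (J f) = ip L v f) \<and>
    (\<forall>f\<in>carrier L. ip_norm H (J f) \<le> ip_norm L f))"

lemma J: "J \<in> bounded_ops L H" "f \<in> carrier L \<Longrightarrow> v \<in> carrier H \<Longrightarrow> ip H v (J f) = ip L v f"
  "f \<in> carrier L \<Longrightarrow> ip_norm H (J f) \<le> ip_norm L f"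
  using someI_ex[OF riesz_map_exists, folded J_def] by blast+

lemmas JD = bounded_opsD[OF J(1)]

lemma ip_J_left: "f \<in> carrier L \<Longrightarrow> v \<in> carrier H \<Longrightarrow> ip H (J f) v = ip L f v"
  using J(2)[of f v] H.ip_commute[of v "J f"] L.ip_commute[of v f] JD(1)[of f] HL[of v] by simp

lemma J_L: "J \<in> bounded_ops L L"
proof (rule bounded_opsI[where C=1])
  fix f assume f: "f \<in> carrier L"
  show "ip_norm L (J f) \<le> 1 * ip_norm L f"
    using norm_le[OF JD(1)[OF f]] J(3)[OF f] by simp
qed (auto intro: HL JD)

text \<open>
$\langle Jf, f\rangle = [Jf, Jf]$.
\<close>

lemma J_positive: "J \<in> positive_ops L"
  unfolding positive_ops_def
proof (intro CollectI conjI ballI J_L)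
  fix f assume f: "f \<in> carrier L"
  have "ip L (J f) f = ip H (J f) (J f)" using J(2)[OF f JD(1)[OF f]] by simp
  then show "Im (ip L (J f) f) = 0" "0 \<le> Re (ip L (J f) f)"
    using H.ip_self_im H.ip_nonneg JD(1)[OF f] by simp_all
qed

lemma J_contraction: "f \<in> carrier L \<Longrightarrow> ip_norm L (J f) \<le> ip_norm L f"
  using norm_le[OF JD(1), of f] J(3)[of f] by simp

definition A where
  "A = (THE T. T \<in> bounded_ops H H \<and>
     (\<forall>f\<in>carrier H. \<forall>g\<in>carrier H. ip H (T f) g = ip L f g))"

text \<open>
Here and in \<open>A_extension_eq\<close> both operators are identified with \<open>J\<close>: on \<open>H\<close> the defining equation of
\<open>A\<close> is that of \<open>J\<close>, and an operator on \<open>L\<close> is determined by its values on the dense subspace \<open>H\<close>.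
\<close>

lemma A_eq: "A = (\<lambda>f\<in>carrier H. J f)"
  unfolding A_def
proof (rule the_equality)
  have b: "(\<lambda>f\<in>carrier H. J f) \<in> bounded_ops H H"
  proof (rule bounded_ops_restrictI[OF H.semi_ip_axioms, where C=1])
    fix f assume f: "f \<in> carrier H"
    show "ip_norm H (J f) \<le> 1 * ip_norm H f" using J(3)[OF HL[OF f]] norm_le[OF f] by simp
  qed (simp_all add: HL JD)
  then show *: "(\<lambda>f\<in>carrier H. J f) \<in> bounded_ops H H \<and>
      (\<forall>f\<in>carrier H. \<forall>g\<in>carrier H. ip H ((\<lambda>f\<in>carrier H. J f) f) g = ip L f g)"
    by (simp add: ip_J_left HL)
  fix T assume T: "T \<in> bounded_ops H H \<and> (\<forall>f\<in>carrier H. \<forall>g\<in>carrier H. ip H (T f) g = ip L f g)"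
  show "T = (\<lambda>f\<in>carrier H. J f)"
  proof (rule bounded_ops_eqI[OF _ b])
    show Tb: "T \<in> bounded_ops H H" using T by blast
    fix f assume f: "f \<in> carrier H"
    have m: "T f \<in> carrier H" "J f \<in> carrier H" using bounded_opsD(1)[OF Tb f] JD(1)[OF HL[OF f]] .
    have "ip H z (T f) = ip H z (J f)" if z: "z \<in> carrier H" for z
      using T f z ip_J_left[OF HL[OF f] z] H.ip_commute[OF m(1) z] H.ip_commute[OF m(2) z] by simp
    then have "T f = J f" by (rule H.eq_if_ip_eq[OF m])
    then show "T f = (\<lambda>f\<in>carrier H. J f) f" using f by simp
  qed
qed

definition A_extension where
  "A_extension = (THE T. T \<in> bounded_ops L L \<and> (\<forall>f\<in>carrier H. T f = A f))"

lemma A_extension_eq: "A_extension = J"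
  unfolding A_extension_def
proof (rule the_equality)
  show "J \<in> bounded_ops L L \<and> (\<forall>f\<in>carrier H. J f = A f)" using J_L by (simp add: A_eq)
  fix T assume T: "T \<in> bounded_ops L L \<and> (\<forall>f\<in>carrier H. T f = A f)"
  show "T = J"
    by (rule bounded_ops_eq_on_total[OF L.hilbert_axioms L.inner_space_axioms H_total _ J_L])
       (use T in \<open>auto simp: A_eq\<close>)
qed

definition S where "S = sqrt_op L A_extension"

lemma S_positive: "S \<in> positive_ops L" and S_S: "f \<in> carrier L \<Longrightarrow> S (S f) = J f"
  unfolding S_def A_extension_eq
  using L.sqrt_op_properties[OF J_positive J_contraction] by blast+

lemma S_L: "S \<in> bounded_ops L L" using S_positive by (simp add: positive_ops_def)

lemmas SLD = bounded_opsD[OF S_L]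

lemma S_self_adjoint: "f \<in> carrier L \<Longrightarrow> g \<in> carrier L \<Longrightarrow> ip L (S f) g = ip L f (S g)"
  by (rule L.positive_self_adjoint[OF S_positive])

lemma J_inj: "g \<in> carrier L \<Longrightarrow> J g = 0 \<Longrightarrow> g = 0"
  using H_total J(2)[of g] by (auto simp: L.total_in_def H.ip_zero_right)

text \<open>
If \<open>g\<close> is orthogonal to the range of the self-adjoint operator \<open>S\<close>, then \<open>S g = 0\<close> and thus
\<open>J g = 0\<close>, so \<open>g\<close> is orthogonal to \<open>H\<close> in \<open>L\<close>.
\<close>

lemma range_S_total: "L.total_in (S ` carrier L)"
  unfolding L.total_in_def
proof (intro conjI ballI impI)
  show "L.subspace_of (S ` carrier L)"
    by (rule bounded_ops_subspace_image[OF S_L L.semi_ip_axioms L.semi_ip_axioms L.subspace_of_carrier])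
  fix g assume g: "g \<in> carrier L" and "\<forall>v\<in>S ` carrier L. ip L v g = 0"
  then have "ip L (S (S g)) g = 0" using SLD(1) by blast
  then have "ip L (S g) (S g) = 0" using S_self_adjoint[OF SLD(1)[OF g] g] by simp
  then have "S g = 0" using L.ip_definite SLD(1)[OF g] by blast
  then have "J g = 0" using S_S[OF g] bounded_ops_zero[OF S_L L.semi_ip_axioms] by simp
  then show "g = 0" by (rule J_inj[OF g])
qed

text \<open>
This identity makes \<open>S\<close> an isometry from its range in \<open>L\<close> into \<open>H\<close>, since \<open>J f = S (S f)\<close>.
\<close>

lemma J_ip: "f \<in> carrier L \<Longrightarrow> g \<in> carrier L \<Longrightarrow> ip H (J f) (J g) = ip L (S f) (S g)"
  using J(2)[OF _ JD(1), of g f] S_S[of f] S_self_adjoint[of "S f" g] SLD(1) by simp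

lemma J_norm_diff: "f \<in> carrier L \<Longrightarrow> g \<in> carrier L \<Longrightarrow> ip_norm H (J f - J g) = ip_norm L (S f - S g)"
  using J_ip[of "f - g" "f - g"] L.diff_mem[of f g]
    bounded_ops_diff[OF J(1) L.semi_ip_axioms, of f g] bounded_ops_diff[OF S_L L.semi_ip_axioms, of f g]
  by (simp add: ip_norm_def)

lemma H_lim_imp_L_lim: "H.ip_lim X x \<Longrightarrow> L.ip_lim X x"
  by (rule L.ip_limI[where r="\<lambda>n. ip_norm H (X n - x)"])
     (auto simp: H.ip_lim_def HL intro!: norm_le H.diff_mem)

text \<open>
Choose \<open>S (h n)\<close> converging to \<open>f\<close> in \<open>L\<close>. By the isometry just noted \<open>J (h n)\<close> is a Cauchy
sequence in \<open>H\<close>. Its limit in \<open>H\<close> is also its limit in \<open>L\<close>, which is \<open>S f\<close>.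
\<close>

lemma S_approx:
  assumes f: "f \<in> carrier L"
  obtains h where "\<And>n. h n \<in> carrier L" "L.ip_lim (\<lambda>n. S (h n)) f" "H.ip_lim (\<lambda>n. J (h n)) (S f)"
proof -
  obtain X where X: "\<And>n. X n \<in> S ` carrier L" "L.ip_lim X f"
    using L.total_in_approx[OF range_S_total f] by blast
  have "\<forall>n. \<exists>g. g \<in> carrier L \<and> X n = S g" using X(1) by blast
  then obtain h where h: "\<And>n. h n \<in> carrier L" "\<And>n. X n = S (h n)" by metis
  have "X = (\<lambda>n. S (h n))" using h(2) by auto
  with X(2) have lim1: "L.ip_lim (\<lambda>n. S (h n)) f" by simp
  have "H.ip_cauchy (\<lambda>n. J (h n))"
    using L.ip_lim_imp_cauchy[OF lim1] h(1) JD(1) by (simp add: H.ip_cauchy_def L.ip_cauchy_def J_norm_diff)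
  then obtain u where u: "H.ip_lim (\<lambda>n. J (h n)) u" using H.complete by blast
  have "L.ip_lim (\<lambda>n. S (S (h n))) (S f)"
    by (rule bounded_ops_lim[OF S_L L.semi_ip_axioms L.semi_ip_axioms lim1])
  then have "L.ip_lim (\<lambda>n. J (h n)) (S f)" using S_S h(1) by simp
  then have "u = S f" by (rule L.ip_lim_unique[OF H_lim_imp_L_lim[OF u]])
  then show ?thesis using that h(1) lim1 u by blast
qed

lemma S_mem_H: "f \<in> carrier L \<Longrightarrow> S f \<in> carrier H"
  by (rule S_approx[of f]) (auto simp: H.ip_lim_def)

lemma S_ip: 
  assumes f: "f \<in> carrier L" and g: "g \<in> carrier L"
  shows "ip H (S f) (S g) = ip L f g"
proof -
  obtain h where h: "\<And>n. h n \<in> carrier L" "L.ip_lim (\<lambda>n. S (h n)) g" "H.ip_lim (\<lambda>n. J (h n)) (S g)"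
    using S_approx[OF g] by blast
  have "ip H (S f) (J (h n)) = ip L f (S (h n))" for n
    using J(2)[OF h(1) S_mem_H[OF f]] S_self_adjoint[OF f h(1)] by simp
  then have "(\<lambda>n. ip L f (S (h n))) \<longlonglongrightarrow> ip H (S f) (S g)"
    using H.ip_lim_ip_right[OF h(3) S_mem_H[OF f]] by simp
  then show ?thesis
    by (rule LIMSEQ_unique) (rule L.ip_lim_ip_right[OF h(2) f])
qed

lemma S_bounded: "S \<in> bounded_ops L H"
proof (rule isometry_bounded)
qed (fact S_mem_H SLD S_ip)+

lemma range_S_total_H: "H.total_in (S ` carrier L)"
  unfolding H.total_in_def
proof (intro conjI ballI impI)
  show "H.subspace_of (S ` carrier L)"
    by (rule bounded_ops_subspace_image[OF S_bounded L.semi_ip_axioms H.semi_ip_axioms L.subspace_of_carrier])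
  fix v assume v: "v \<in> carrier H" and "\<forall>x\<in>S ` carrier L. ip H x v = 0"
  then have "ip H (S (S v)) v = 0" using SLD(1) HL by blast
  then have "ip L v v = 0" using ip_J_left[OF HL[OF v] v] S_S[OF HL[OF v]] by simp
  then show "v = 0" by (rule L.ip_definite[OF HL[OF v]])
qed

text \<open>
The range of \<open>S\<close> is total in \<open>H\<close>, and it is closed because \<open>S\<close> is isometric and \<open>L\<close> is complete.
\<close>

theorem S_unitary: "S \<in> unitary_ops L H"
proof -
  have "v \<in> S ` carrier L" if v: "v \<in> carrier H" for v
  proof -
    obtain X where X: "\<And>n. X n \<in> S ` carrier L" "H.ip_lim X v"
      using H.total_in_approx[OF range_S_total_H v] by blast
    have "\<forall>n. \<exists>g. g \<in> carrier L \<and> X n = S g" using X(1) by blast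
    then obtain h where h: "\<And>n. h n \<in> carrier L" "\<And>n. X n = S (h n)" by metis
    have "ip_norm H (S (h m) - S (h n)) = ip_norm L (h m - h n)" for m n
      using S_ip[of "h m - h n" "h m - h n"] h(1) L.diff_mem
        bounded_ops_diff[OF S_L L.semi_ip_axioms, of "h m" "h n"] by (simp add: ip_norm_def)
    then have "L.ip_cauchy h"
      using H.ip_lim_imp_cauchy[OF X(2)] h by (simp add: H.ip_cauchy_def L.ip_cauchy_def)
    then obtain u where u: "L.ip_lim h u" using L.complete by blast
    have "X = (\<lambda>n. S (h n))" using h(2) by auto
    then have "H.ip_lim X (S u)"
      using bounded_ops_lim[OF S_bounded L.semi_ip_axioms H.semi_ip_axioms u] by simp
    then have "v = S u" by (rule H.ip_lim_unique[OF X(2)])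
    then show ?thesis using u by (auto simp: L.ip_lim_def)
  qed
  then have "S ` carrier L = carrier H" using S_mem_H by blast
  then show ?thesis using S_bounded S_ip by (simp add: unitary_ops_def)
qed

definition R where "R = sqrt_op H A"

text \<open>
The restriction of \<open>S\<close> to \<open>H\<close> is positive for the inner product of \<open>H\<close>: with \<open>f = S h\<close> one has
$[Sf, f] = \langle f, h\rangle = \langle Sh, h\rangle$. Its square is \<open>A\<close>, so uniqueness of the positive square
root applies.
\<close>

lemma R_eq: "R = (\<lambda>f\<in>carrier H. S f)"
  unfolding R_def
proof (rule H.sqrt_op_properties(3))
  have Ab: "A \<in> bounded_ops H H"
    unfolding A_eq
  proof (rule bounded_ops_restrictI[OF H.semi_ip_axioms, where C=1])
    fix f assume f: "f \<in> carrier H"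
    show "ip_norm H (J f) \<le> 1 * ip_norm H f" using J(3)[OF HL[OF f]] norm_le[OF f] by simp
  qed (simp_all add: HL JD)
  show "A \<in> positive_ops H"
    unfolding positive_ops_def
    using Ab by (auto simp: A_eq ip_J_left HL L.ip_self_im L.ip_nonneg)
  show "ip_norm H (A f) \<le> ip_norm H f" if "f \<in> carrier H" for f
    using that J(3)[OF HL[OF that]] norm_le[OF that] by (simp add: A_eq)
  have Rb: "(\<lambda>f\<in>carrier H. S f) \<in> bounded_ops H H"
  proof (rule bounded_ops_restrictI[OF H.semi_ip_axioms, where C=1])
    fix f assume f: "f \<in> carrier H"
    show "ip_norm H (S f) \<le> 1 * ip_norm H f"
      using norm_le[OF f] unitary_opsD(4)[OF S_unitary HL[OF f]] by simp
  qed (simp_all add: HL S_mem_H SLD)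
  show "(\<lambda>f\<in>carrier H. S f) \<in> positive_ops H"
    unfolding positive_ops_def
  proof (intro CollectI conjI ballI Rb)
    fix f assume f: "f \<in> carrier H"
    then obtain h where h: "h \<in> carrier L" "f = S h" using unitary_opsD(2)[OF S_unitary] by blast
    have "ip H (S f) f = ip L (S h) h"
      using S_ip[OF HL[OF f] h(1)] h(2) by simp
    then show "Im (ip H ((\<lambda>f\<in>carrier H. S f) f) f) = 0" "0 \<le> Re (ip H ((\<lambda>f\<in>carrier H. S f) f) f)"
      using S_positive h(1) f by (simp_all add: positive_ops_def)
  qed
  show "(\<lambda>f\<in>carrier H. S f) ((\<lambda>f\<in>carrier H. S f) f) = A f" if "f \<in> carrier H" for f
    using that by (simp add: A_eq S_mem_H HL S_S)
qed

lemma R_apply: "f \<in> carrier H \<Longrightarrow> R f = S f" by (simp add: R_eq)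

lemma range_R: "R ` carrier H = S ` carrier H" by (simp add: R_eq)

lemma range_R_total: "H.total_in (S ` carrier H)"
  unfolding H.total_in_def
proof (intro conjI ballI impI)
  show "H.subspace_of (S ` carrier H)"
    using H_total
    by (intro bounded_ops_subspace_image[OF S_bounded L.semi_ip_axioms H.semi_ip_axioms])
       (simp add: L.total_in_def)
  fix v assume v: "v \<in> carrier H" and z: "\<forall>x\<in>S ` carrier H. ip H x v = 0"
  obtain h where h: "h \<in> carrier L" "v = S h" using v unitary_opsD(2)[OF S_unitary] by blast
  have "ip L f h = 0" if "f \<in> carrier H" for f
    using z that S_ip[OF HL[OF that] h(1)] h(2) by simp
  then have "h = 0" using H_total h(1) by (simp add: L.total_in_def)
  then show "v = 0" using h(2) bounded_ops_zero[OF S_L L.semi_ip_axioms] by simp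
qed

abbreviation S_inv where "S_inv \<equiv> unitary_inverse L H S"

lemmas S_inv = unitary_inverse[OF S_unitary L.inner_space_axioms H.semi_ip_axioms]

lemma S_inj: "f \<in> carrier L \<Longrightarrow> g \<in> carrier L \<Longrightarrow> S f = S g \<Longrightarrow> f = g"
  by (metis S_inv(2))

definition isometric_ops where
  "isometric_ops = {G \<in> invertible_ops H. \<forall>f\<in>carrier H. \<forall>g\<in>carrier H. ip L (G f) (G g) = ip L f g}"

definition intertw where
  "intertw G U \<longleftrightarrow> U \<in> unitary_ops H H \<and> compose (carrier H) U R = compose (carrier H) R G"

definition range_unitaries where
  "range_unitaries = {U \<in> unitary_ops H H. U ` (R ` carrier H) = R ` carrier H}"

definition U_map where "U_map G = (THE U. intertw G U)"

text \<open>
The intertwining relation in terms of the unitary \<open>S\<close>, which agrees with the square root \<open>R\<close> of \<open>A\<close> on \<open>H\<close>.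
\<close>

lemma intertw_iff:
  assumes G: "G \<in> bounded_ops H H"
  shows "intertw G U \<longleftrightarrow> U \<in> unitary_ops H H \<and> (\<forall>f\<in>carrier H. U (S f) = S (G f))"
proof -
  have "compose (carrier H) U R = compose (carrier H) R G \<longleftrightarrow> (\<forall>f\<in>carrier H. U (S f) = S (G f))"
  proof
    assume eq: "compose (carrier H) U R = compose (carrier H) R G"
    show "\<forall>f\<in>carrier H. U (S f) = S (G f)"
      using fun_cong[OF eq] bounded_opsD(1)[OF G] by (metis compose_eq R_apply)
  next
    assume "\<forall>f\<in>carrier H. U (S f) = S (G f)"
    then show "compose (carrier H) U R = compose (carrier H) R G"
      unfolding compose_def using bounded_opsD(1)[OF G] by (intro restrict_ext) (simp add: R_apply)
  qed
  then show ?thesis by (simp add: intertw_def)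
qed

lemma intertw_unique:
  assumes G: "G \<in> bounded_ops H H" and U: "intertw G U" and U': "intertw G U'"
  shows "U = U'"
  by (rule bounded_ops_eq_on_total[OF H.hilbert_axioms H.inner_space_axioms range_R_total])
     (use U U' in \<open>auto simp: intertw_iff[OF G] unitary_opsD(1)\<close>)

lemma intertw_imp_isometric:
  assumes G: "G \<in> invertible_ops H" and U: "intertw G U"
  shows "G \<in> isometric_ops"
proof -
  have Gb: "G \<in> bounded_ops H H" using G by (rule invertible_ops_bounded)
  have U': "U \<in> unitary_ops H H" and US: "\<And>f. f \<in> carrier H \<Longrightarrow> U (S f) = S (G f)"
    using U by (auto simp: intertw_iff[OF Gb])
  have "ip L (G f) (G g) = ip L f g" if f: "f \<in> carrier H" and g: "g \<in> carrier H" for f g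
  proof -
    have "ip L (G f) (G g) = ip H (S (G f)) (S (G g))"
      using f g by (intro S_ip[symmetric] HL bounded_opsD(1)[OF Gb])
    also have "\<dots> = ip H (U (S f)) (U (S g))" using f g US by simp
    also have "\<dots> = ip H (S f) (S g)" using f g by (intro unitary_opsD(3)[OF U'] S_mem_H HL)
    also have "\<dots> = ip L f g" using f g by (intro S_ip HL)
    finally show ?thesis .
  qed
  then show ?thesis using G by (simp add: isometric_ops_def)
qed

text \<open>
On \<open>S(H)\<close>, which is total in \<open>H\<close>, the map \<open>T\<close> sending \<open>S f\<close> to \<open>S (G f)\<close> is a linear isometry onto
\<open>S(H)\<close> exactly because \<open>G\<close> is a bijection of \<open>H\<close> preserving the inner product of \<open>L\<close>.
\<close>

lemma intertw_exists:
  assumes G: "G \<in> isometric_ops"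
  shows "\<exists>U. intertw G U"
proof -
  have Gi: "G \<in> invertible_ops H"
    and Gip: "\<And>f g. f \<in> carrier H \<Longrightarrow> g \<in> carrier H \<Longrightarrow> ip L (G f) (G g) = ip L f g"
    using G by (auto simp: isometric_ops_def)
  obtain G' where G': "G' \<in> invertible_ops H" "\<forall>f\<in>carrier H. G (G' f) = f"
    using invertible_ops_inverse[OF Gi] by metis
  have Gb: "G \<in> bounded_ops H H" and G'b: "G' \<in> bounded_ops H H"
    by (intro invertible_ops_bounded Gi G')+
  have GG': "f \<in> carrier H \<Longrightarrow> G (G' f) = f" for f using G'(2) by blast
  note GD = bounded_opsD[OF Gb]
  let ?V = "S ` carrier H"
  define T where "T v = S (G (S_inv v))" for v
  have TS: "T (S f) = S (G f)" if "f \<in> carrier H" for f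
    using that by (simp add: T_def S_inv(2) HL)
  obtain U where "U \<in> unitary_ops H H" "\<And>v. v \<in> ?V \<Longrightarrow> U v = T v"
  proof (rule H.isometry_extends_to_unitary[OF range_R_total, of T])
    show "T ` ?V = ?V"
    proof
      show "T ` ?V \<subseteq> ?V"
      proof (rule image_subsetI)
        fix v assume "v \<in> ?V"
        then obtain f where "f \<in> carrier H" "v = S f" by blast
        then show "T v \<in> ?V" using TS GD(1) by simp
      qed
      show "?V \<subseteq> T ` ?V"
      proof
        fix v assume "v \<in> ?V"
        then obtain f where f: "f \<in> carrier H" "v = S f" by blast
        have G'f: "G' f \<in> carrier H" by (rule bounded_opsD(1)[OF G'b f(1)])
        have "v = T (S (G' f))" using TS[OF G'f] GG'[OF f(1)] f(2) by simp
        then show "v \<in> T ` ?V" using G'f by blast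
      qed
    qed
  next
    fix x y assume "x \<in> ?V" "y \<in> ?V"
    then obtain f g where fg: "f \<in> carrier H" "x = S f" "g \<in> carrier H" "y = S g" by blast
    have "x + y = S (f + g)" using fg SLD(2) HL by simp
    then show "T (x + y) = T x + T y"
      using fg TS[OF H.add_mem[OF fg(1,3)]] TS[OF fg(1)] TS[OF fg(3)] GD(2)[OF fg(1,3)]
        SLD(2)[OF HL[OF GD(1)[OF fg(1)]] HL[OF GD(1)[OF fg(3)]]] by simp
    show "ip H (T x) (T y) = ip H x y"
      using fg TS S_ip HL GD(1) Gip by simp
  next
    fix c x assume "x \<in> ?V"
    then obtain f where f: "f \<in> carrier H" "x = S f" by blast
    have "c *\<^sub>C x = S (c *\<^sub>C f)" using f SLD(3) HL by simp
    then show "T (c *\<^sub>C x) = c *\<^sub>C T x"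
      using f TS[OF H.scale_mem[OF f(1)]] TS[OF f(1)] GD(3)[OF f(1)] SLD(3)[OF HL[OF GD(1)[OF f(1)]]] by simp
  qed blast
  then have "intertw G U" using TS by (simp add: intertw_iff[OF Gb])
  then show ?thesis by blast
qed

theorem ex1_intertw_iff:
  assumes G: "G \<in> invertible_ops H"
  shows "(\<exists>!U. intertw G U) \<longleftrightarrow> G \<in> isometric_ops"
proof -
  have Gb: "G \<in> bounded_ops H H" using G by (rule invertible_ops_bounded)
  show ?thesis
  proof
    assume "\<exists>!U. intertw G U"
    then obtain U where "intertw G U" by blast
    then show "G \<in> isometric_ops" by (rule intertw_imp_isometric[OF G])
  next
    assume "G \<in> isometric_ops"
    then obtain U where U: "intertw G U" using intertw_exists by blast
    show "\<exists>!U. intertw G U" by (rule ex1I, rule U) (rule intertw_unique[OF Gb _ U])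
  qed
qed

lemma isometric_ops_bounded: "G \<in> isometric_ops \<Longrightarrow> G \<in> bounded_ops H H"
  unfolding isometric_ops_def by (blast intro: invertible_ops_bounded)

lemma isometric_ops_inverse:
  assumes "G \<in> isometric_ops"
  shows "\<exists>G'. G' \<in> isometric_ops \<and> (\<forall>f\<in>carrier H. G' (G f) = f) \<and> (\<forall>f\<in>carrier H. G (G' f) = f) \<and>
    compose (carrier H) G' G = (\<lambda>f\<in>carrier H. f)"
proof -
  have Gi: "G \<in> invertible_ops H"
    and Gip: "\<And>f g. f \<in> carrier H \<Longrightarrow> g \<in> carrier H \<Longrightarrow> ip L (G f) (G g) = ip L f g"
    using assms by (auto simp: isometric_ops_def)
  obtain G' where G': "G' \<in> invertible_ops H"
    "\<forall>f\<in>carrier H. G' (G f) = f" "\<forall>f\<in>carrier H. G (G' f) = f"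
    "compose (carrier H) G' G = (\<lambda>f\<in>carrier H. f)"
    using invertible_ops_inverse[OF Gi] by metis
  have "ip L (G' f) (G' g) = ip L f g" if f: "f \<in> carrier H" and g: "g \<in> carrier H" for f g
    using Gip[of "G' f" "G' g"] bounded_opsD(1)[OF invertible_ops_bounded[OF G'(1)]] f g G'(3) by simp
  then have "G' \<in> isometric_ops" using G'(1) by (simp add: isometric_ops_def)
  then show ?thesis using G' by blast
qed

lemma isometric_ops_group: "group (op_group H isometric_ops)"
proof (rule op_group_group)
  show "isometric_ops \<subseteq> carrier H \<rightarrow>\<^sub>E carrier H"
    using isometric_ops_bounded bounded_ops_PiE[of H H] by blast
  have "(\<lambda>f\<in>carrier H. f) \<in> invertible_ops H"
    using bounded_ops_id[OF H.semi_ip_axioms] by (intro invertible_opsI[OF H.semi_ip_axioms]) (assumption | simp)+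
  then show "(\<lambda>f\<in>carrier H. f) \<in> isometric_ops" by (simp add: isometric_ops_def)
next
  fix G1 G2 assume G1: "G1 \<in> isometric_ops" and G2: "G2 \<in> isometric_ops"
  obtain G1' where G1': "G1' \<in> isometric_ops"
    "\<forall>f\<in>carrier H. G1' (G1 f) = f" "\<forall>f\<in>carrier H. G1 (G1' f) = f"
    using isometric_ops_inverse[OF G1] by metis
  note 1 = isometric_ops_bounded[OF G1] isometric_ops_bounded[OF G1'(1)] G1'(2,3)[rule_format]
  obtain G2' where G2': "G2' \<in> isometric_ops"
    "\<forall>f\<in>carrier H. G2' (G2 f) = f" "\<forall>f\<in>carrier H. G2 (G2' f) = f"
    using isometric_ops_inverse[OF G2] by metis
  note 2 = isometric_ops_bounded[OF G2] isometric_ops_bounded[OF G2'(1)] G2'(2,3)[rule_format]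
  note m = bounded_opsD(1)[OF 1(1)] bounded_opsD(1)[OF 1(2)] bounded_opsD(1)[OF 2(1)] bounded_opsD(1)[OF 2(2)]
  have "compose (carrier H) G1 G2 \<in> invertible_ops H"
    by (rule invertible_opsI[OF H.semi_ip_axioms, where S="compose (carrier H) G2' G1'"])
       (simp_all add: bounded_ops_compose[OF _ _ H.semi_ip_axioms H.semi_ip_axioms] 1 2 compose_eq m)
  then show "compose (carrier H) G1 G2 \<in> isometric_ops"
    using G1 G2 m by (simp add: isometric_ops_def compose_eq)
next
  fix T assume "T \<in> isometric_ops"
  then show "\<exists>S\<in>isometric_ops. compose (carrier H) S T = (\<lambda>f\<in>carrier H. f)"
    using isometric_ops_inverse by metis
qed

lemma range_unitaries_iff:
  "U \<in> range_unitaries \<longleftrightarrow> U \<in> unitary_ops H H \<and> U ` (S ` carrier H) = S ` carrier H"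
  by (simp add: range_unitaries_def range_R)

lemma range_unitaries_inverse:
  assumes U: "U \<in> range_unitaries"
  shows "unitary_inverse H H U \<in> range_unitaries"
proof -
  have U': "U \<in> unitary_ops H H" and img: "U ` (S ` carrier H) = S ` carrier H"
    using U by (auto simp: range_unitaries_iff)
  note V = unitary_inverse[OF U' H.inner_space_axioms H.semi_ip_axioms]
  have sub: "x \<in> S ` carrier H \<Longrightarrow> x \<in> carrier H" for x using S_mem_H HL by blast
  have "unitary_inverse H H U ` (S ` carrier H) = unitary_inverse H H U ` (U ` (S ` carrier H))"
    by (simp only: img)
  also have "\<dots> = (\<lambda>x. unitary_inverse H H U (U x)) ` (S ` carrier H)" by (simp only: image_image)
  also have "\<dots> = S ` carrier H" using V(2) sub by simp
  finally show ?thesis using V(1) by (simp add: range_unitaries_iff)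
qed

lemma range_unitaries_group: "group (op_group H range_unitaries)"
proof (rule op_group_group)
  show "range_unitaries \<subseteq> carrier H \<rightarrow>\<^sub>E carrier H"
    using unitary_opsD(1) bounded_ops_PiE[of H H] unfolding range_unitaries_def by blast
  have sub: "x \<in> S ` carrier H \<Longrightarrow> x \<in> carrier H" for x using S_mem_H HL by blast
  have "(\<lambda>f\<in>carrier H. f) ` (S ` carrier H) = S ` carrier H" using sub by force
  then show "(\<lambda>f\<in>carrier H. f) \<in> range_unitaries"
    by (simp add: range_unitaries_iff unitary_id H.semi_ip_axioms)
  fix U assume U: "U \<in> range_unitaries"
  then have U': "U \<in> unitary_ops H H" by (simp add: range_unitaries_iff)
  have "compose (carrier H) (unitary_inverse H H U) U = (\<lambda>f\<in>carrier H. f)"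
    unfolding compose_def
    by (rule restrict_ext) (rule unitary_inverse(2)[OF U' H.inner_space_axioms H.semi_ip_axioms])
  then show "\<exists>V\<in>range_unitaries. compose (carrier H) V U = (\<lambda>f\<in>carrier H. f)"
    using range_unitaries_inverse[OF U] by blast
  fix W assume W: "W \<in> range_unitaries"
  have "compose (carrier H) U W ` (S ` carrier H) = U ` (W ` (S ` carrier H))"
    using sub by (auto simp: compose_eq image_image)
  moreover have "compose (carrier H) U W \<in> unitary_ops H H"
    using U W by (intro unitary_compose[OF _ _ H.semi_ip_axioms H.semi_ip_axioms]) (simp_all add: range_unitaries_iff)
  ultimately show "compose (carrier H) U W \<in> range_unitaries"
    using U W by (simp add: range_unitaries_iff)
qed

text \<open>
A closed graph theorem. For \<open>g\<close> in \<open>L\<close> the functional $f \mapsto [Gf, Jg] = \langle Gf, g\rangle$ is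
bounded on \<open>H\<close>, since \<open>G\<close> is bounded for the norm of \<open>L\<close>. When \<open>J g\<close> runs through the unit ball of
\<open>H\<close>, these functionals are pointwise bounded by the norm of \<open>G f\<close>, hence uniformly bounded.
The vectors \<open>J g\<close> are dense in \<open>H\<close>, so the norm of \<open>G f\<close> is controlled.
\<close>

lemma bounded_if_L_contraction:
  assumes G_mem: "\<And>f. f \<in> carrier H \<Longrightarrow> G f \<in> carrier H"
    and G_add: "\<And>f g. f \<in> carrier H \<Longrightarrow> g \<in> carrier H \<Longrightarrow> G (f + g) = G f + G g"
    and G_scale: "\<And>c f. f \<in> carrier H \<Longrightarrow> G (c *\<^sub>C f) = c *\<^sub>C G f"
    and G_norm: "\<And>f. f \<in> carrier H \<Longrightarrow> ip_norm L (G f) \<le> ip_norm L f"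
  shows "\<exists>C. \<forall>f\<in>carrier H. ip_norm H (G f) \<le> C * ip_norm H f"
proof -
  define B where "B = {w \<in> J ` carrier L. ip_norm H w \<le> 1}"
  have B: "w \<in> B \<longleftrightarrow> (\<exists>g\<in>carrier L. w = J g) \<and> ip_norm H w \<le> 1" for w
    unfolding B_def by blast
  have "\<exists>C. \<forall>\<phi>\<in>(\<lambda>w f. ip H (G f) w) ` B. \<forall>x\<in>carrier H. cmod (\<phi> x) \<le> C * ip_norm H x"
  proof (rule H.uniform_boundedness)
    fix \<phi> assume "\<phi> \<in> (\<lambda>w f. ip H (G f) w) ` B"
    then obtain g where g: "g \<in> carrier L" "\<phi> = (\<lambda>f. ip H (G f) (J g))" by (auto simp: B)
    show "\<phi> (x + y) = \<phi> x + \<phi> y" if "x \<in> carrier H" "y \<in> carrier H" for x y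
      using that g by (simp add: G_add G_mem JD(1) H.ip_simps)
    show "\<phi> (c *\<^sub>C x) = c * \<phi> x" if "x \<in> carrier H" for c x
      using that g by (simp add: G_scale G_mem JD(1) H.ip_simps)
    have "cmod (\<phi> x) \<le> ip_norm L g * ip_norm H x" if x: "x \<in> carrier H" for x
    proof -
      have "cmod (\<phi> x) = cmod (ip L (G x) g)" using g x by (simp add: J(2) G_mem)
      also have "\<dots> \<le> ip_norm L (G x) * ip_norm L g" by (intro L.Cauchy_Schwarz HL G_mem x g)
      also have "\<dots> \<le> ip_norm H x * ip_norm L g"
        using G_norm[OF x] norm_le[OF x] by (intro mult_right_mono L.norm_nonneg g) simp
      finally show ?thesis by (simp add: mult.commute)
    qed
    then show "\<exists>D. \<forall>x\<in>carrier H. cmod (\<phi> x) \<le> D * ip_norm H x" by blast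
  next
    fix x assume x: "x \<in> carrier H"
    have "cmod (ip H (G x) w) \<le> ip_norm H (G x)" if w: "w \<in> B" for w
    proof -
      have wH: "w \<in> carrier H" and w1: "ip_norm H w \<le> 1" using w JD(1) by (auto simp: B)
      have "cmod (ip H (G x) w) \<le> ip_norm H (G x) * ip_norm H w" by (rule H.Cauchy_Schwarz[OF G_mem[OF x] wH])
      also have "\<dots> \<le> ip_norm H (G x)" using w1 H.norm_nonneg[OF G_mem[OF x]] by (simp add: mult_left_le)
      finally show ?thesis .
    qed
    then show "\<exists>M. \<forall>\<phi>\<in>(\<lambda>w f. ip H (G f) w) ` B. cmod (\<phi> x) \<le> M" by blast
  qed
  then obtain C where C0: "\<forall>\<phi>\<in>(\<lambda>w f. ip H (G f) w) ` B. \<forall>x\<in>carrier H. cmod (\<phi> x) \<le> C * ip_norm H x"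
    by blast
  then have C: "cmod (ip H (G f) w) \<le> C * ip_norm H f" if "w \<in> B" "f \<in> carrier H" for w f
    using that by simp
  have C': "cmod (ip H (G f) (J g)) \<le> C * ip_norm H f * ip_norm H (J g)"
    if f: "f \<in> carrier H" and g: "g \<in> carrier L" for f g
  proof (cases "ip_norm H (J g) = 0")
    case True
    then have "J g = 0" by (rule H.norm_eq_zero[OF JD(1)[OF g]])
    then show ?thesis using f by (simp add: H.ip_zero_right G_mem H.norm_zero)
  next
    case False
    then have pos: "0 < ip_norm H (J g)" using H.norm_nonneg[OF JD(1)[OF g]] by simp
    define t where "t = complex_of_real (1 / ip_norm H (J g))"
    have "t *\<^sub>C J g = J (t *\<^sub>C g)" using JD(3)[OF g] by simp
    then have "t *\<^sub>C J g \<in> B"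
      using pos H.norm_scale[OF JD(1)[OF g], of t] L.scale_mem[OF g]
      unfolding B by (auto simp: t_def norm_divide)
    then have "cmod (ip H (G f) (t *\<^sub>C J g)) \<le> C * ip_norm H f" by (rule C[OF _ f])
    then show ?thesis
      using pos f g by (simp add: H.ip_scale_right G_mem JD(1) t_def norm_mult norm_divide field_simps)
  qed
  have "ip_norm H (G f) \<le> max C 0 * ip_norm H f" if f: "f \<in> carrier H" for f
  proof -
    obtain h where h: "h \<in> carrier L" "G f = S h"
      using G_mem[OF f] unitary_opsD(2)[OF S_unitary] by blast
    obtain k where k: "\<And>n. k n \<in> carrier L" "H.ip_lim (\<lambda>n. J (k n)) (S h)"
      using S_approx[OF h(1)] by blast
    have lim: "H.ip_lim (\<lambda>n. J (k n)) (G f)" using k(2) h(2) by simp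
    have "cmod (ip H (G f) (G f)) \<le> C * ip_norm H f * ip_norm H (G f)"
    proof (rule LIMSEQ_le)
      show "(\<lambda>n. cmod (ip H (G f) (J (k n)))) \<longlonglongrightarrow> cmod (ip H (G f) (G f))"
        by (intro tendsto_norm H.ip_lim_ip_right lim G_mem f)
      show "(\<lambda>n. C * ip_norm H f * ip_norm H (J (k n))) \<longlonglongrightarrow> C * ip_norm H f * ip_norm H (G f)"
        by (intro tendsto_intros H.ip_lim_norm lim)
      show "\<exists>N. \<forall>n\<ge>N. cmod (ip H (G f) (J (k n))) \<le> C * ip_norm H f * ip_norm H (J (k n))"
        using C'[OF f k(1)] by blast
    qed
    then have "ip_norm H (G f) * ip_norm H (G f) \<le> C * ip_norm H f * ip_norm H (G f)"
      by (simp add: H.ip_self G_mem f power2_eq_square norm_mult)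
    then have "ip_norm H (G f) = 0 \<or> ip_norm H (G f) \<le> C * ip_norm H f"
      using H.norm_nonneg[OF G_mem[OF f]] by (cases "ip_norm H (G f) = 0") auto
    moreover have "C * ip_norm H f \<le> max C 0 * ip_norm H f" "0 \<le> max C 0 * ip_norm H f"
      using H.norm_nonneg[OF f] by (auto intro: mult_right_mono)
    ultimately show ?thesis by linarith
  qed
  then show ?thesis by blast
qed

text \<open>
Boundedness for the norm of \<open>H\<close> comes from \<open>bounded_if_L_contraction\<close>: the conjugate of a unitary
of \<open>H\<close> by \<open>S\<close> preserves the norm of \<open>L\<close>.
\<close>

lemma range_unitary_pullback:
  assumes U: "U \<in> range_unitaries"
  defines "G \<equiv> (\<lambda>f\<in>carrier H. S_inv (U (S f)))"
  shows "G \<in> bounded_ops H H" "f \<in> carrier H \<Longrightarrow> S (G f) = U (S f)"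
proof -
  have U': "U \<in> unitary_ops H H" and img: "U ` (S ` carrier H) = S ` carrier H"
    using U by (auto simp: range_unitaries_iff)
  note UD = bounded_opsD[OF unitary_opsD(1)[OF U']]
  note SID = bounded_opsD[OF unitary_opsD(1)[OF S_inv(1)]]
  have USm: "U (S f) \<in> carrier H" if "f \<in> carrier H" for f
    by (intro UD(1) S_mem_H HL that)
  show "f \<in> carrier H \<Longrightarrow> S (G f) = U (S f)" for f
    by (simp add: G_def S_inv(3) USm)
  have mem: "S_inv (U (S f)) \<in> carrier H" if f: "f \<in> carrier H" for f
  proof -
    have "U (S f) \<in> S ` carrier H" using img f by blast
    then obtain g where "g \<in> carrier H" "U (S f) = S g" by blast
    then show ?thesis using S_inv(2) HL by simp
  qed
  have add: "S_inv (U (S (f + g))) = S_inv (U (S f)) + S_inv (U (S g))"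
    if "f \<in> carrier H" "g \<in> carrier H" for f g
    using that by (simp add: SLD(2) HL UD(2) S_mem_H SID(2) USm)
  have scale: "S_inv (U (S (c *\<^sub>C f))) = c *\<^sub>C S_inv (U (S f))" if "f \<in> carrier H" for c f
    using that by (simp add: SLD(3) HL UD(3) S_mem_H SID(3) USm)
  have nrm: "ip_norm L (S_inv (U (S f))) = ip_norm L f" if "f \<in> carrier H" for f
    using that by (simp add: unitary_opsD(4)[OF S_inv(1)] USm unitary_opsD(4)[OF U'] S_mem_H HL
      unitary_opsD(4)[OF S_unitary])
  obtain C where "\<forall>f\<in>carrier H. ip_norm H (S_inv (U (S f))) \<le> C * ip_norm H f"
    using bounded_if_L_contraction[of "\<lambda>f. S_inv (U (S f))", OF mem add scale] nrm by auto
  then show "G \<in> bounded_ops H H"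
    unfolding G_def
    by (intro bounded_ops_restrictI[OF H.semi_ip_axioms, where C=C] mem add scale) auto
qed

lemma U_map:
  assumes G: "G \<in> isometric_ops"
  shows "U_map G \<in> unitary_ops H H" "f \<in> carrier H \<Longrightarrow> U_map G (S f) = S (G f)"
    and "V \<in> unitary_ops H H \<Longrightarrow> (\<And>f. f \<in> carrier H \<Longrightarrow> V (S f) = S (G f)) \<Longrightarrow> U_map G = V"
proof -
  have Gi: "G \<in> invertible_ops H" using G by (simp add: isometric_ops_def)
  then have Gb: "G \<in> bounded_ops H H" by (rule invertible_ops_bounded)
  have ex1: "\<exists>!U. intertw G U" using ex1_intertw_iff[OF Gi] G by simp
  have *: "intertw G (U_map G)" unfolding U_map_def by (rule theI'[OF ex1])
  show "U_map G \<in> unitary_ops H H" "f \<in> carrier H \<Longrightarrow> U_map G (S f) = S (G f)"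
    using * by (auto simp: intertw_iff[OF Gb])
  assume "V \<in> unitary_ops H H" "\<And>f. f \<in> carrier H \<Longrightarrow> V (S f) = S (G f)"
  then have "intertw G V" by (simp add: intertw_iff[OF Gb])
  then show "U_map G = V" using ex1 * by blast
qed

text \<open>
Multiplicativity and injectivity follow from \<open>U_map G (S f) = S (G f)\<close>. Surjectivity pulls a given
unitary and its inverse back to \<open>H\<close>.
\<close>

theorem U_map_iso: "U_map \<in> iso (op_group H isometric_ops) (op_group H range_unitaries)"
proof -
  have Gb: "G \<in> bounded_ops H H" if "G \<in> isometric_ops" for G
    using that by (rule isometric_ops_bounded)
  have mem: "U_map G \<in> range_unitaries" if G: "G \<in> isometric_ops" for G
  proof -
    obtain G' where G': "G' \<in> isometric_ops" "\<forall>f\<in>carrier H. G (G' f) = f"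
      using isometric_ops_inverse[OF G] by metis
    have "G ` carrier H = carrier H"
    proof
      show "G ` carrier H \<subseteq> carrier H" using bounded_opsD(1)[OF Gb[OF G]] by (rule image_subsetI)
      show "carrier H \<subseteq> G ` carrier H"
      proof
        fix f assume "f \<in> carrier H"
        then show "f \<in> G ` carrier H"
          using G'(2) bounded_opsD(1)[OF Gb[OF G'(1)], of f] by (metis imageI)
      qed
    qed
    moreover have "U_map G ` (S ` carrier H) = S ` (G ` carrier H)"
      using U_map(2)[OF G] by (simp add: image_image)
    ultimately show ?thesis using U_map(1)[OF G] by (simp add: range_unitaries_iff)
  qed
  have hom: "U_map (compose (carrier H) G1 G2) = compose (carrier H) (U_map G1) (U_map G2)"
    if G1: "G1 \<in> isometric_ops" and G2: "G2 \<in> isometric_ops" for G1 G2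
  proof (rule U_map(3))
    show "compose (carrier H) G1 G2 \<in> isometric_ops"
      using group.is_monoid[OF isometric_ops_group, THEN monoid.m_closed, of G1 G2] G1 G2 by (simp add: op_group_def)
    show "compose (carrier H) (U_map G1) (U_map G2) \<in> unitary_ops H H"
      by (intro unitary_compose[where K=H] U_map(1) G1 G2 H.semi_ip_axioms)
    fix f assume f: "f \<in> carrier H"
    have G2f: "G2 f \<in> carrier H" by (rule bounded_opsD(1)[OF Gb[OF G2] f])
    show "compose (carrier H) (U_map G1) (U_map G2) (S f) = S (compose (carrier H) G1 G2 f)"
      using f G2f S_mem_H[OF HL[OF f]] by (simp add: compose_eq U_map(2)[OF G2] U_map(2)[OF G1])
  qed
  have inj: "inj_on U_map isometric_ops"
  proof (rule inj_onI)
    fix G1 G2 assume G1: "G1 \<in> isometric_ops" and G2: "G2 \<in> isometric_ops" and eq: "U_map G1 = U_map G2"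
    show "G1 = G2"
    proof (rule bounded_ops_eqI[OF Gb[OF G1] Gb[OF G2]])
      fix f assume f: "f \<in> carrier H"
      have "S (G1 f) = S (G2 f)" using U_map(2)[OF G1 f] U_map(2)[OF G2 f] eq by simp
      then show "G1 f = G2 f"
        by (rule S_inj[OF HL[OF bounded_opsD(1)[OF Gb[OF G1] f]] HL[OF bounded_opsD(1)[OF Gb[OF G2] f]]])
    qed
  qed
  have surj: "U \<in> U_map ` isometric_ops" if U: "U \<in> range_unitaries" for U
  proof -
    have U': "U \<in> unitary_ops H H" using U by (simp add: range_unitaries_iff)
    note V = unitary_inverse[OF U' H.inner_space_axioms H.semi_ip_axioms]
    let ?V = "unitary_inverse H H U"
    define G where "G = (\<lambda>f\<in>carrier H. S_inv (U (S f)))"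
    define G' where "G' = (\<lambda>f\<in>carrier H. S_inv (?V (S f)))"
    note G = range_unitary_pullback[OF U, folded G_def]
    note G' = range_unitary_pullback[OF range_unitaries_inverse[OF U], folded G'_def]
    have Gm: "f \<in> carrier H \<Longrightarrow> G f \<in> carrier H" and G'm: "f \<in> carrier H \<Longrightarrow> G' f \<in> carrier H" for f
      by (rule bounded_opsD(1)[OF G(1)], assumption) (rule bounded_opsD(1)[OF G'(1)], assumption)
    have "G \<in> invertible_ops H"
    proof (rule invertible_opsI[OF H.semi_ip_axioms G(1) G'(1)])
      fix f assume f: "f \<in> carrier H"
      have "S (G' (G f)) = S f"
        using f by (simp add: G'(2) Gm G(2) V(2) S_mem_H HL)
      then show "G' (G f) = f" by (rule S_inj[OF HL[OF G'm[OF Gm[OF f]]] HL[OF f]])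
      have "S (G (G' f)) = S f"
        using f by (simp add: G'(2) G'm G(2) V(3) S_mem_H HL)
      then show "G (G' f) = f" by (rule S_inj[OF HL[OF Gm[OF G'm[OF f]]] HL[OF f]])
    qed
    moreover have "intertw G U" using U' G(2) by (simp add: intertw_iff[OF G(1)])
    ultimately have Giso: "G \<in> isometric_ops" by (rule intertw_imp_isometric)
    have "U_map G = U" by (rule U_map(3)[OF Giso U']) (simp add: G(2))
    then show ?thesis using Giso by blast
  qed
  have "U_map ` isometric_ops = range_unitaries" using mem surj by blast
  then show ?thesis
    using mem hom inj by (auto simp: iso_def hom_def op_group_def bij_betw_def)
qed

theorem Ad_image:
  "Ad L H S ` {U \<in> unitary_ops L L. U ` carrier H = carrier H} = range_unitaries"
proof
  show "Ad L H S ` {U \<in> unitary_ops L L. U ` carrier H = carrier H} \<subseteq> range_unitaries"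
  proof (rule image_subsetI)
    fix U assume "U \<in> {U \<in> unitary_ops L L. U ` carrier H = carrier H}"
    then have U: "U \<in> unitary_ops L L" and UH: "U ` carrier H = carrier H" by auto
    have eq: "Ad L H S U = compose (carrier H) S (compose (carrier H) U S_inv)"
      by (simp add: Ad_eq[OF L.hilbert_axioms H.hilbert_axioms S_unitary] compose_def cong: restrict_cong)
    have "Ad L H S U \<in> unitary_ops H H"
      unfolding eq
      by (intro unitary_compose[where K=L] U S_unitary S_inv(1) L.semi_ip_axioms H.semi_ip_axioms)
    moreover have "Ad L H S U (S f) = S (U f)" if "f \<in> carrier H" for f
      using that by (simp add: eq compose_eq S_mem_H HL S_inv(2))
    then have "Ad L H S U ` (S ` carrier H) = S ` (U ` carrier H)" by (simp add: image_image)
    ultimately show "Ad L H S U \<in> range_unitaries" using UH by (simp add: range_unitaries_iff)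
  qed
next
  show "range_unitaries \<subseteq> Ad L H S ` {U \<in> unitary_ops L L. U ` carrier H = carrier H}"
  proof
    fix U assume "U \<in> range_unitaries"
    then have U: "U \<in> unitary_ops H H" and img: "U ` (S ` carrier H) = S ` carrier H"
      by (auto simp: range_unitaries_iff)
    define W where "W = Ad H L S_inv U"
    have eq: "W = compose (carrier L) S_inv (compose (carrier L) U S)"
      by (simp add: W_def Ad_eq[OF H.hilbert_axioms L.hilbert_axioms S_inv(1)]
        unitary_inverse_inverse[OF L.hilbert_axioms H.hilbert_axioms S_unitary] compose_def cong: restrict_cong)
    have "W \<in> unitary_ops L L"
      unfolding eq
      by (intro unitary_compose[where K=H] U S_unitary S_inv(1) L.semi_ip_axioms H.semi_ip_axioms)
    moreover have "W ` carrier H = carrier H"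
    proof -
      have "W ` carrier H = S_inv ` (U ` (S ` carrier H))"
        using HL by (auto simp: eq compose_eq image_image)
      also have "\<dots> = S_inv ` (S ` carrier H)" by (simp only: img)
      also have "\<dots> = carrier H" using S_inv(2) HL by (simp add: image_image)
      finally show ?thesis .
    qed
    moreover have "Ad L H S W = U"
      using Ad_inverse[OF H.hilbert_axioms L.hilbert_axioms S_inv(1) unitary_opsD(1)[OF U]]
      by (simp add: W_def unitary_inverse_inverse[OF L.hilbert_axioms H.hilbert_axioms S_unitary])
    ultimately show "U \<in> Ad L H S ` {U \<in> unitary_ops L L. U ` carrier H = carrier H}" by blast
  qed
qed

end

section \<open>Smooth functions\<close>

lemma times_cont_diff_continuous: "times_cont_diff k \<phi> \<Longrightarrow> continuous_on UNIV \<phi>"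
proof (cases k)
  case (Suc n)
  assume "times_cont_diff k \<phi>"
  then have "\<forall>x. \<phi> differentiable at x" by (simp add: Suc)
  then show ?thesis
    by (intro continuous_at_imp_continuous_on ballI differentiable_imp_continuous_within) simp
qed simp

lemma times_cont_diff_Suc: "times_cont_diff (Suc k) \<phi> \<Longrightarrow> times_cont_diff k \<phi>"
proof (induction k arbitrary: \<phi>)
  case 0
  then show ?case using times_cont_diff_continuous[of "Suc 0" \<phi>] by simp
next
  case (Suc k)
  show ?case unfolding times_cont_diff.simps(2)[of k]
  proof (intro conjI ballI)
    show "\<forall>x. \<phi> differentiable at x" using Suc.prems by simp
    fix b :: 'a assume b: "b \<in> Basis"
    show "times_cont_diff k (\<lambda>x. frechet_derivative \<phi> (at x) b)"
      by (rule Suc.IH) (use Suc.prems b in \<open>simp only: times_cont_diff.simps(2)[of "Suc k"]\<close>)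
  qed
qed

lemma times_cont_diff_SucI:
  assumes "\<And>x. (\<phi> has_derivative \<phi>' x) (at x)" and "\<And>b. b \<in> Basis \<Longrightarrow> times_cont_diff k (\<lambda>x. \<phi>' x b)"
  shows "times_cont_diff (Suc k) \<phi>"
proof -
  have "frechet_derivative \<phi> (at x) = \<phi>' x" for x
    using frechet_derivative_at[OF assms(1)] by simp
  then show ?thesis using assms by (auto simp: differentiable_def)
qed

lemma times_cont_diff_const: "times_cont_diff k (\<lambda>x::'a::euclidean_space. c)"
proof (induction k arbitrary: c)
  case (Suc k)
  show ?case
    by (rule times_cont_diff_SucI[where \<phi>'="\<lambda>x h. 0"]) (auto simp: Suc)
qed simp

lemma times_cont_diff_derivs:
  assumes "times_cont_diff (Suc k) \<phi>"
  shows "(\<phi> has_derivative frechet_derivative \<phi> (at x)) (at x)"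
    and "b \<in> Basis \<Longrightarrow> times_cont_diff k (\<lambda>x. frechet_derivative \<phi> (at x) b)"
  using assms frechet_derivative_works by auto

lemma times_cont_diff_add:
  "times_cont_diff k \<phi> \<Longrightarrow> times_cont_diff k \<psi> \<Longrightarrow> times_cont_diff k (\<lambda>x. \<phi> x + \<psi> x)"
proof (induction k arbitrary: \<phi> \<psi>)
  case 0
  then show ?case by (auto intro: continuous_on_add)
next
  case (Suc k)
  show ?case
  proof (rule times_cont_diff_SucI)
    show "((\<lambda>x. \<phi> x + \<psi> x) has_derivative (\<lambda>h. frechet_derivative \<phi> (at x) h + frechet_derivative \<psi> (at x) h)) (at x)" for x
      by (intro has_derivative_add times_cont_diff_derivs(1)[OF Suc.prems(1)] times_cont_diff_derivs(1)[OF Suc.prems(2)])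
  qed (intro Suc.IH times_cont_diff_derivs(2)[OF Suc.prems(1)] times_cont_diff_derivs(2)[OF Suc.prems(2)])
qed

lemma times_cont_diff_mult:
  "times_cont_diff k \<phi> \<Longrightarrow> times_cont_diff k \<psi> \<Longrightarrow> times_cont_diff k (\<lambda>x. \<phi> x * \<psi> x)"
proof (induction k arbitrary: \<phi> \<psi>)
  case 0
  then show ?case by (auto intro: continuous_on_mult)
next
  case (Suc k)
  show ?case
  proof (rule times_cont_diff_SucI)
    show "((\<lambda>x. \<phi> x * \<psi> x) has_derivative
        (\<lambda>h. \<phi> x * frechet_derivative \<psi> (at x) h + frechet_derivative \<phi> (at x) h * \<psi> x)) (at x)" for x
      by (intro has_derivative_mult times_cont_diff_derivs(1)[OF Suc.prems(1)] times_cont_diff_derivs(1)[OF Suc.prems(2)])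
  next
    fix b :: 'a assume b: "b \<in> Basis"
    show "times_cont_diff k (\<lambda>x. \<phi> x * frechet_derivative \<psi> (at x) b + frechet_derivative \<phi> (at x) b * \<psi> x)"
      by (intro times_cont_diff_add
          Suc.IH[OF times_cont_diff_Suc[OF Suc.prems(1)] times_cont_diff_derivs(2)[OF Suc.prems(2) b]]
          Suc.IH[OF times_cont_diff_derivs(2)[OF Suc.prems(1) b] times_cont_diff_Suc[OF Suc.prems(2)]])
  qed
qed

lemma times_cont_diff_prod:
  "finite I \<Longrightarrow> (\<And>i. i \<in> I \<Longrightarrow> times_cont_diff k (\<phi> i)) \<Longrightarrow> times_cont_diff k (\<lambda>x. \<Prod>i\<in>I. \<phi> i x)"
  by (induction I rule: finite_induct) (auto intro: times_cont_diff_mult times_cont_diff_const)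

section \<open>Smooth approximations of boxes\<close>

text \<open>
The functions $e^{-1/t}t^{-n}$ on the positive half line, extended by \<open>0\<close>. They are closed under
differentiation up to linear combinations, so treating all \<open>n\<close> at once makes smoothness an induction.
\<close>

definition flat :: "nat \<Rightarrow> real \<Rightarrow> real" where
  "flat n t = (if t \<le> 0 then 0 else exp (- (1 / t)) / t ^ n)"

lemma flat_tendsto_0: "(flat n \<longlongrightarrow> 0) (at 0)"
proof -
  have "((\<lambda>t. inverse t ^ n / exp (inverse t)) \<longlongrightarrow> 0) (at_right (0::real))"
    by (rule filterlim_compose[OF tendsto_power_div_exp_0 filterlim_inverse_at_top_right])
  moreover have "\<forall>\<^sub>F t in at_right 0. inverse t ^ n / exp (inverse t) = flat n t"
    by (auto simp: eventually_at_filter flat_def exp_minus field_simps)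
  ultimately have right: "(flat n \<longlongrightarrow> 0) (at_right 0)"
    by (rule Lim_transform_eventually)
  have "\<forall>\<^sub>F t in at_left 0. (0::real) = flat n t"
    by (auto simp: eventually_at_filter flat_def)
  then have left: "(flat n \<longlongrightarrow> 0) (at_left 0)"
    by (rule Lim_transform_eventually[OF tendsto_const])
  show ?thesis using left right by (simp add: filterlim_split_at)
qed

lemma flat_deriv:
  "(flat n has_real_derivative flat (n + 2) t - real n * flat (n + 1) t) (at t)"
proof -
  consider "t < 0" | "t = 0" | "0 < t" by linarith
  then show ?thesis
  proof cases
    case 1
    have "((\<lambda>_. 0::real) has_real_derivative 0) (at t)" by simp
    then have "(flat n has_real_derivative 0) (at t)"
      by (rule DERIV_cong_ev[THEN iffD1, rotated -1])
         (use 1 in \<open>auto simp: flat_def eventually_nhds intro!: exI[of _ "{..<0}"]\<close>)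
    then show ?thesis using 1 by (simp add: flat_def)
  next
    case 2
    have "((\<lambda>h. flat (Suc n) h) \<longlongrightarrow> 0) (at 0)" by (rule flat_tendsto_0)
    moreover have "\<forall>\<^sub>F h in at 0. flat (Suc n) h = (flat n (0 + h) - flat n 0) / h"
      by (auto simp: eventually_at_filter flat_def)
    ultimately have "((\<lambda>h. (flat n (0 + h) - flat n 0) / h) \<longlongrightarrow> 0) (at 0)"
      by (rule Lim_transform_eventually)
    then have "(flat n has_real_derivative 0) (at 0)" by (simp add: DERIV_def)
    then show ?thesis using 2 by (simp add: flat_def)
  next
    case 3
    have "((\<lambda>t. exp (- (1 / t)) * inverse t ^ n) has_real_derivative
        flat (n + 2) t - real n * flat (n + 1) t) (at t)"
      using 3
      by (auto intro!: derivative_eq_intros simp: flat_def field_simps power2_eq_square)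
         (cases n; simp add: field_simps)
    then show ?thesis
      by (rule DERIV_cong_ev[THEN iffD1, rotated -1])
         (use 3 in \<open>auto simp: flat_def eventually_nhds field_simps intro!: exI[of _ "{0<..}"]\<close>)
  qed
qed

lemma times_cont_diff_flat:
  "times_cont_diff k (\<lambda>x::'a::euclidean_space. complex_of_real (flat n (x \<bullet> v + d)))"
proof (induction k arbitrary: n)
  case 0
  have "continuous_on UNIV (flat n)"
    by (rule DERIV_continuous_on) (rule has_field_derivative_at_within[OF flat_deriv])
  then show ?case
    by (simp, intro continuous_on_of_real continuous_on_compose2[of UNIV "flat n" UNIV "\<lambda>x. x \<bullet> v + d"])
       (auto intro!: continuous_intros)
next
  case (Suc k)
  show ?case
  proof (rule times_cont_diff_SucI)
    fix x :: 'a
    have "((\<lambda>x. flat n (x \<bullet> v + d)) has_derivative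
        (\<lambda>h. (flat (n + 2) (x \<bullet> v + d) - real n * flat (n + 1) (x \<bullet> v + d)) * (h \<bullet> v))) (at x)"
      by (rule DERIV_compose_FDERIV[OF flat_deriv, THEN has_derivative_eq_rhs])
         (auto intro!: derivative_eq_intros simp: mult.commute)
    then show "((\<lambda>x. complex_of_real (flat n (x \<bullet> v + d))) has_derivative
        (\<lambda>h. complex_of_real ((flat (n + 2) (x \<bullet> v + d) - real n * flat (n + 1) (x \<bullet> v + d)) * (h \<bullet> v)))) (at x)"
      by (rule has_derivative_of_real)
  next
    fix b :: 'a
    have "times_cont_diff k (\<lambda>x::'a. (complex_of_real (flat (n + 2) (x \<bullet> v + d)) +
        (- of_nat n) * complex_of_real (flat (n + 1) (x \<bullet> v + d))) * complex_of_real (b \<bullet> v))"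
      by (intro times_cont_diff_mult times_cont_diff_add times_cont_diff_const Suc)
    then show "times_cont_diff k (\<lambda>x. complex_of_real ((flat (n + 2) (x \<bullet> v + d) - real n * flat (n + 1) (x \<bullet> v + d)) * (b \<bullet> v)))"
      by (simp add: algebra_simps)
  qed
qed

text \<open>
Since $e^{-1/(mt)}$ tends to \<open>1\<close> for positive \<open>t\<close> as \<open>m\<close> grows, these products tend to the indicator
of the open box. Multiplying by \<open>Suc m\<close> in place of \<open>m\<close> keeps the scaling factor positive.
\<close>

definition box_bump :: "'a::euclidean_space \<Rightarrow> 'a \<Rightarrow> nat \<Rightarrow> 'a \<Rightarrow> real" where
  "box_bump a c m x = (\<Prod>b\<in>Basis. flat 0 (real (Suc m) * ((x - a) \<bullet> b)) * flat 0 (real (Suc m) * ((c - x) \<bullet> b)))"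

lemma flat_0_bounds: "0 \<le> flat 0 t" "flat 0 t \<le> 1"
  by (auto simp: flat_def)

lemma flat_0_eq_0: "flat 0 t = 0 \<longleftrightarrow> t \<le> 0"
  by (auto simp: flat_def)

lemma box_bump_bounds: "0 \<le> box_bump a c m x" "box_bump a c m x \<le> 1"
  unfolding box_bump_def
  by (auto intro!: prod_nonneg prod_le_1 mult_nonneg_nonneg mult_le_one simp: flat_0_bounds)

lemma box_bump_eq_0: "box_bump a c m x = 0 \<longleftrightarrow> x \<notin> box a c"
  unfolding box_bump_def
  by (auto simp: flat_0_eq_0 mem_box inner_diff_left mult_le_0_iff not_less)

lemma flat_0_lim: "(\<lambda>m. flat 0 (real (Suc m) * t)) \<longlonglongrightarrow> (if t \<le> 0 then 0 else 1)"
proof (cases "t \<le> 0")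
  case True
  then show ?thesis by (simp add: flat_def mult_le_0_iff)
next
  case False
  have "(\<lambda>m. exp (- (1 / t * (1 / real (Suc m))))) \<longlonglongrightarrow> exp (- (1 / t * 0))"
    using LIMSEQ_inverse_real_of_nat by (intro tendsto_intros) (simp add: inverse_eq_divide)
  then show ?thesis using False by (simp add: flat_def mult_le_0_iff mult.commute)
qed

lemma box_bump_lim: "(\<lambda>m. box_bump a c m x) \<longlonglongrightarrow> indicator (box a c) x"
proof -
  have "(\<lambda>m. box_bump a c m x) \<longlonglongrightarrow>
      (\<Prod>b\<in>Basis. (if (x - a) \<bullet> b \<le> 0 then 0 else 1) * (if (c - x) \<bullet> b \<le> 0 then 0 else 1))"
    unfolding box_bump_def by (intro tendsto_intros flat_0_lim)
  also have "(\<Prod>b\<in>Basis. (if (x - a) \<bullet> b \<le> 0 then 0 else 1) * (if (c - x) \<bullet> b \<le> 0 then 0 else 1)) =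
      (indicator (box a c) x :: real)"
  proof (cases "x \<in> box a c")
    case True
    then have "(x - a) \<bullet> b > 0 \<and> (c - x) \<bullet> b > 0" if "b \<in> Basis" for b
      using that by (auto simp: mem_box inner_diff_left)
    then have "\<not> (x - a) \<bullet> b \<le> 0" "\<not> (c - x) \<bullet> b \<le> 0" if "b \<in> Basis" for b
      using that by (auto simp: not_le)
    then show ?thesis using True by simp
  next
    case False
    then have "\<exists>b\<in>Basis. (x - a) \<bullet> b \<le> 0 \<or> (c - x) \<bullet> b \<le> 0"
      by (auto simp: mem_box inner_diff_left not_less)
    then show ?thesis using False by (subst prod_zero) auto
  qed
  finally show ?thesis .
qed

lemma box_bump_test_function:
  assumes "cbox a c \<subseteq> \<Omega>"
  shows "(\<lambda>x. complex_of_real (box_bump a c m x)) \<in> test_functions \<Omega>"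
proof -
  have sub: "{x. complex_of_real (box_bump a c m x) \<noteq> 0} \<subseteq> cbox a c"
    using box_subset_cbox by (auto simp: box_bump_eq_0)
  then have cl: "closure {x. complex_of_real (box_bump a c m x) \<noteq> 0} \<subseteq> cbox a c"
    by (rule closure_minimal) (rule closed_cbox)
  have "times_cont_diff k (\<lambda>x. complex_of_real (box_bump a c m x))" for k
  proof -
    have "times_cont_diff k (\<lambda>x. \<Prod>b\<in>Basis.
        complex_of_real (flat 0 (x \<bullet> (real (Suc m) *\<^sub>R b) + - (real (Suc m) * (a \<bullet> b)))) *
        complex_of_real (flat 0 (x \<bullet> (- real (Suc m) *\<^sub>R b) + real (Suc m) * (c \<bullet> b))))"
      by (intro times_cont_diff_prod times_cont_diff_mult times_cont_diff_flat) simp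
    then show ?thesis by (simp add: box_bump_def inner_diff_left algebra_simps)
  qed
  moreover have "compact (closure {x. complex_of_real (box_bump a c m x) \<noteq> 0})"
    using bounded_subset[OF bounded_cbox cl] by (simp add: compact_eq_bounded_closed)
  ultimately show ?thesis using cl assms by (auto simp: test_functions_def)
qed

section \<open>Test functions\<close>

lemma test_functions_smooth: "\<phi> \<in> test_functions \<Omega> \<Longrightarrow> times_cont_diff k \<phi>"
  by (simp add: test_functions_def)

lemma test_functions_continuous: "\<phi> \<in> test_functions \<Omega> \<Longrightarrow> continuous_on UNIV \<phi>"
  using test_functions_smooth times_cont_diff_continuous by blast

lemma test_functions_vanish: "\<phi> \<in> test_functions \<Omega> \<Longrightarrow> x \<notin> \<Omega> \<Longrightarrow> \<phi> x = 0"
  using closure_subset[of "{x. \<phi> x \<noteq> 0}"] by (auto simp: test_functions_def)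

lemma test_functions_deriv:
  assumes \<phi>: "\<phi> \<in> test_functions \<Omega>"
  shows "(\<phi> has_derivative frechet_derivative \<phi> (at x)) (at x)"
    and "b \<in> Basis \<Longrightarrow> (\<lambda>x. frechet_derivative \<phi> (at x) b) \<in> test_functions \<Omega>"
proof -
  show "(\<phi> has_derivative frechet_derivative \<phi> (at x)) (at x)"
    by (rule times_cont_diff_derivs(1)[OF test_functions_smooth[OF \<phi>, of "Suc 0"]])
  assume b: "b \<in> Basis"
  let ?K = "closure {x. \<phi> x \<noteq> 0}"
  have "{x. frechet_derivative \<phi> (at x) b \<noteq> 0} \<subseteq> ?K"
  proof (rule ccontr)
    assume "\<not> ?thesis"
    then obtain x where x: "frechet_derivative \<phi> (at x) b \<noteq> 0" "x \<in> - ?K" by blast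
    have "((\<lambda>_. 0) has_derivative (\<lambda>_. 0)) (at x)" by simp
    then have "(\<phi> has_derivative (\<lambda>_. 0)) (at x)"
      by (rule has_derivative_transform_within_open[of _ _ x UNIV "- ?K"])
         (use x closure_subset[of "{x. \<phi> x \<noteq> 0}"] in auto)
    then show False using frechet_derivative_at x(1) by metis
  qed
  then have sub: "closure {x. frechet_derivative \<phi> (at x) b \<noteq> 0} \<subseteq> ?K"
    by (rule closure_minimal) simp
  have K: "compact ?K" "?K \<subseteq> \<Omega>" using \<phi> by (auto simp: test_functions_def)
  have "compact (closure {x. frechet_derivative \<phi> (at x) b \<noteq> 0})"
    using bounded_subset[OF compact_imp_bounded[OF K(1)] sub] by (simp add: compact_eq_bounded_closed)
  moreover have "times_cont_diff k (\<lambda>x. frechet_derivative \<phi> (at x) b)" for k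
    by (rule times_cont_diff_derivs(2)[OF test_functions_smooth[OF \<phi>] b])
  ultimately show "(\<lambda>x. frechet_derivative \<phi> (at x) b) \<in> test_functions \<Omega>"
    using sub K(2) by (auto simp: test_functions_def)
qed

lemma test_functions_bounded:
  assumes \<phi>: "\<phi> \<in> test_functions \<Omega>"
  shows "\<exists>M r. 0 \<le> M \<and> (\<forall>x. cmod (\<phi> x) \<le> M) \<and> (\<forall>x. x \<notin> cball 0 r \<longrightarrow> \<phi> x = 0)"
proof -
  let ?K = "closure {x. \<phi> x \<noteq> 0}"
  have K: "compact ?K" using \<phi> by (simp add: test_functions_def)
  have off: "x \<notin> ?K \<Longrightarrow> \<phi> x = 0" for x using closure_subset[of "{x. \<phi> x \<noteq> 0}"] by auto
  have "bounded (\<phi> ` ?K)"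
    using test_functions_continuous[OF \<phi>] K
    by (intro compact_imp_bounded compact_continuous_image) (auto intro: continuous_on_subset)
  then obtain M where M: "\<And>x. x \<in> ?K \<Longrightarrow> cmod (\<phi> x) \<le> M" by (auto simp: bounded_iff)
  have "cmod (\<phi> x) \<le> max M 0" for x using M[of x] off[of x] by (cases "x \<in> ?K") auto
  moreover obtain r where r: "?K \<subseteq> cball 0 r"
    using compact_imp_bounded[OF K] unfolding bounded_iff by (metis mem_cball_0 subsetI)
  moreover have "\<phi> x = 0" if "x \<notin> cball 0 r" for x
    using that r by (intro off) blast
  ultimately show ?thesis by (intro exI[of _ "max M 0"] exI[of _ r]) simp
qed

lemma continuous_compact_support_integrable:
  fixes f :: "'a::euclidean_space \<Rightarrow> 'b::{banach, second_countable_topology}"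
  assumes c: "continuous_on UNIV f" and b: "\<And>x. norm (f x) \<le> M" and z: "\<And>x. x \<notin> cball 0 r \<Longrightarrow> f x = 0"
  shows "integrable lborel f" "integrable lebesgue f"
proof -
  have m: "f \<in> borel_measurable lborel" using borel_measurable_continuous_onI[OF c] by simp
  show "integrable lborel f"
  proof (rule Bochner_Integration.integrable_bound[where f="\<lambda>x. M * indicator (cball 0 r) x"])
    show "integrable lborel (\<lambda>x. M * indicator (cball (0::'a) r) x)"
      by (intro integrable_mult_right integrable_real_indicator) (auto simp: emeasure_bounded_finite[OF bounded_cball, simplified])
    show "AE x in lborel. norm (f x) \<le> norm (M * indicator (cball 0 r) x)"
      by (intro AE_I2) (auto simp: indicator_def z intro: order_trans[OF b abs_ge_self])
  qed (rule m)
  then show "integrable lebesgue f" using m by (simp add: integrable_completion)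
qed

lemma test_function_square_integrable:
  assumes \<phi>: "\<phi> \<in> test_functions \<Omega>"
  shows "square_integrable \<phi>"
proof -
  obtain M r where M: "\<And>x. cmod (\<phi> x) \<le> M" "\<And>x. x \<notin> cball 0 r \<Longrightarrow> \<phi> x = 0"
    using test_functions_bounded[OF \<phi>] by metis
  have c: "continuous_on UNIV \<phi>" by (rule test_functions_continuous[OF \<phi>])
  have "integrable lebesgue (\<lambda>x. (cmod (\<phi> x))\<^sup>2)"
    by (rule continuous_compact_support_integrable(2)[where M="M\<^sup>2" and r=r])
       (auto intro!: continuous_intros c power_mono M(1) simp: M(2))
  moreover have "\<phi> \<in> borel_measurable lebesgue"
    by (intro measurable_completion) (simp add: borel_measurable_continuous_onI[OF c])
  ultimately show ?thesis by (simp add: square_integrable_def)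
qed

text \<open>
The difference quotients of \<open>F\<close> in direction \<open>b\<close> have integral \<open>0\<close> by translation invariance of
Lebesgue measure. They converge to the derivative and, by the mean value inequality, are
dominated by a multiple of the indicator of a ball.
\<close>

lemma integral_directional_derivative_zero:
  fixes F :: "'a::euclidean_space \<Rightarrow> complex"
  assumes der: "\<And>x. (F has_derivative F' x) (at x)"
    and cont: "continuous_on UNIV (\<lambda>x. F' x b)"
    and zero: "\<And>x. x \<notin> cball 0 r \<Longrightarrow> F x = 0"
    and bound: "\<And>x. cmod (F x) \<le> K" "\<And>x. cmod (F' x b) \<le> M"
  shows "(LINT x|lebesgue. F' x b) = 0"
proof -
  have Fcont: "continuous_on UNIV F"
    by (intro continuous_at_imp_continuous_on ballI has_derivative_continuous[OF der])
  define e where "e n = 1 / real (Suc n)" for n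
  have e: "0 < e n" "e n \<le> 1" for n by (auto simp: e_def)
  define q where "q n x = complex_of_real (1 / e n) * (F (x + e n *\<^sub>R b) - F x)" for n x
  have meas: "F \<in> borel_measurable borel" using borel_measurable_continuous_onI[OF Fcont] .
  have qmeas: "q n \<in> borel_measurable borel" for n
  proof -
    have "continuous_on UNIV (q n)"
      unfolding q_def by (intro continuous_intros continuous_on_compose2[OF Fcont]) auto
    then show ?thesis using borel_measurable_continuous_onI by simp
  qed
  have Fint: "integrable lborel F"
    by (rule continuous_compact_support_integrable(1)[OF Fcont bound(1) zero])
  have q0: "integral\<^sup>L lborel (q n) = 0" for n
  proof -
    have shift: "integrable lborel (\<lambda>x. F (x + e n *\<^sub>R b))"
      "(LINT x|lborel. F (x + e n *\<^sub>R b)) = integral\<^sup>L lborel F"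
    proof -
      have "integrable (distr lborel borel ((+) (e n *\<^sub>R b))) F" using Fint by (simp add: lborel_distr_plus)
      then show "integrable lborel (\<lambda>x. F (x + e n *\<^sub>R b))"
        using meas by (subst (asm) integrable_distr_eq) (auto simp: add.commute)
      have "integral\<^sup>L lborel F = integral\<^sup>L (distr lborel borel ((+) (e n *\<^sub>R b))) F"
        by (simp add: lborel_distr_plus)
      also have "\<dots> = (LINT x|lborel. F (x + e n *\<^sub>R b))"
        using meas by (subst integral_distr) (auto simp: add.commute)
      finally show "(LINT x|lborel. F (x + e n *\<^sub>R b)) = integral\<^sup>L lborel F" by simp
    qed
    show ?thesis
      unfolding q_def using shift Fint by (simp add: Bochner_Integration.integral_diff)
  qed
  have diff_le: "cmod (F (x + t *\<^sub>R b) - F x) \<le> M * t" if t: "0 \<le> t" for x t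
  proof -
    let ?g = "\<lambda>s. F (x + s *\<^sub>R b)"
    have "norm (?g t - ?g 0) \<le> M * norm (t - 0)"
    proof (rule differentiable_bound[of UNIV ?g "\<lambda>s h. h *\<^sub>R F' (x + s *\<^sub>R b) b"])
      fix s :: real
      have "(?g has_derivative (\<lambda>h. F' (x + s *\<^sub>R b) (h *\<^sub>R b))) (at s)"
        by (rule has_derivative_compose[OF _ der]) (auto intro!: derivative_eq_intros)
      moreover have "F' (x + s *\<^sub>R b) (h *\<^sub>R b) = h *\<^sub>R F' (x + s *\<^sub>R b) b" for h
        using linear_simps(5)[OF has_derivative_bounded_linear[OF der]] .
      ultimately show "(?g has_derivative (\<lambda>h. h *\<^sub>R F' (x + s *\<^sub>R b) b)) (at s within UNIV)" by simp
      show "onorm (\<lambda>h. h *\<^sub>R F' (x + s *\<^sub>R b) b) \<le> M"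
      proof (rule onorm_le)
        fix h :: real
        show "norm (h *\<^sub>R F' (x + s *\<^sub>R b) b) \<le> M * norm h"
          using mult_right_mono[OF bound(2)[of "x + s *\<^sub>R b"], of "\<bar>h\<bar>"]
          by (simp add: mult.commute[of "\<bar>h\<bar>"])
      qed
    qed auto
    then show ?thesis using t by simp
  qed
  have M0: "0 \<le> M" using norm_ge_zero[of "F' 0 b"] bound(2)[of 0] by linarith
  define R where "R = r + norm b"
  have q_bound: "cmod (q n x) \<le> M * indicator (cball 0 R) x" for n x
  proof (cases "x \<in> cball 0 R")
    case True
    have "cmod (q n x) = (1 / e n) * cmod (F (x + e n *\<^sub>R b) - F x)"
      using e(1)[of n] by (simp add: q_def norm_mult norm_divide)
    also have "\<dots> \<le> (1 / e n) * (M * e n)"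
      using e(1)[of n] by (intro mult_left_mono diff_le) auto
    finally show ?thesis using e(1)[of n] True by simp
  next
    case False
    then have big: "r + norm b < norm x" by (simp add: R_def)
    have "norm (e n *\<^sub>R b) \<le> norm b" using e[of n] by (simp add: mult_left_le_one_le)
    then have "r < norm (x + e n *\<^sub>R b)" using big norm_diff_ineq[of x "e n *\<^sub>R b"] by linarith
    then have "F (x + e n *\<^sub>R b) = 0" by (intro zero) simp
    moreover have "F x = 0" using big by (intro zero) (use norm_ge_zero[of b] in \<open>simp, linarith\<close>)
    ultimately show ?thesis by (simp add: q_def M0)
  qed
  have q_lim: "(\<lambda>n. q n x) \<longlonglongrightarrow> F' x b" for x
  proof -
    have "((\<lambda>s. F (x + s *\<^sub>R b)) has_derivative (\<lambda>h. F' (x + 0 *\<^sub>R b) (h *\<^sub>R b))) (at 0)"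
      by (rule has_derivative_compose[OF _ der]) (auto intro!: derivative_eq_intros)
    moreover have "F' x (h *\<^sub>R b) = h *\<^sub>R F' x b" for h
      using linear_simps(5)[OF has_derivative_bounded_linear[OF der]] .
    ultimately have "((\<lambda>h. norm (F (x + h *\<^sub>R b) - F x - h *\<^sub>R F' x b) / norm h) \<longlongrightarrow> 0) (at 0)"
      by (simp add: has_derivative_at)
    moreover have "filterlim e (at 0) sequentially"
      unfolding filterlim_at
    proof
      show "\<forall>\<^sub>F n in sequentially. e n \<in> UNIV \<and> e n \<noteq> 0"
        using e(1) by (simp add: less_imp_neq[symmetric])
      show "e \<longlonglongrightarrow> 0"
        unfolding e_def using LIMSEQ_inverse_real_of_nat by (simp add: inverse_eq_divide)
    qed
    ultimately have "(\<lambda>n. norm (F (x + e n *\<^sub>R b) - F x - e n *\<^sub>R F' x b) / norm (e n)) \<longlonglongrightarrow> 0"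
      by (rule filterlim_compose)
    moreover have "norm (F (x + e n *\<^sub>R b) - F x - e n *\<^sub>R F' x b) / norm (e n) = norm (q n x - F' x b)" for n
    proof -
      have "q n x - F' x b = complex_of_real (1 / e n) * (F (x + e n *\<^sub>R b) - F x - e n *\<^sub>R F' x b)"
        using e(1)[of n] by (simp add: q_def scaleR_conv_of_real right_diff_distrib)
      then show ?thesis using e(1)[of n] by (simp add: norm_mult norm_divide)
    qed
    ultimately have "(\<lambda>n. norm (q n x - F' x b)) \<longlonglongrightarrow> 0" by simp
    then show ?thesis using LIM_zero_cancel tendsto_norm_zero_iff by blast
  qed
  have dmeas: "(\<lambda>x. F' x b) \<in> borel_measurable borel"
    using borel_measurable_continuous_onI[OF cont] by simp
  have "(\<lambda>n. integral\<^sup>L lborel (q n)) \<longlonglongrightarrow> (LINT x|lborel. F' x b)"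
    by (rule integral_dominated_convergence[where w="\<lambda>x. M * indicator (cball 0 R) x"])
       (auto intro!: qmeas dmeas q_lim q_bound integrable_mult_right integrable_real_indicator
         simp: emeasure_bounded_finite[OF bounded_cball, simplified])
  then have "(LINT x|lborel. F' x b) = 0" by (simp add: q0 LIMSEQ_const_iff)
  then show ?thesis using dmeas by (simp add: integral_completion)
qed

text \<open>
The product rule and the vanishing integral of the derivative of \<open>\<phi> x * cnj (\<psi> x)\<close>.
\<close>

lemma test_functions_integration_by_parts:
  fixes \<phi> \<psi> :: "'a::euclidean_space \<Rightarrow> complex"
  assumes \<phi>: "\<phi> \<in> test_functions \<Omega>" and \<psi>: "\<psi> \<in> test_functions \<Omega>" and b: "b \<in> Basis"
  shows "(LINT x|lebesgue. \<phi> x * cnj (frechet_derivative \<psi> (at x) b)) =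
    - (LINT x|lebesgue. frechet_derivative \<phi> (at x) b * cnj (\<psi> x))"
proof -
  let ?d = "\<lambda>x. frechet_derivative \<phi> (at x) b" and ?e = "\<lambda>x. frechet_derivative \<psi> (at x) b"
  note d = test_functions_deriv(2)[OF \<phi> b] and e = test_functions_deriv(2)[OF \<psi> b]
  note cont = test_functions_continuous[OF \<phi>] test_functions_continuous[OF \<psi>]
    test_functions_continuous[OF d] test_functions_continuous[OF e]
  obtain M1 r1 where 1: "0 \<le> M1" "\<And>x. cmod (\<phi> x) \<le> M1" "\<And>x. x \<notin> cball 0 r1 \<Longrightarrow> \<phi> x = 0"
    using test_functions_bounded[OF \<phi>] by metis
  obtain M2 where 2: "0 \<le> M2" "\<And>x. cmod (\<psi> x) \<le> M2" using test_functions_bounded[OF \<psi>] by metis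
  obtain M3 r3 where 3: "0 \<le> M3" "\<And>x. cmod (?d x) \<le> M3" "\<And>x. x \<notin> cball 0 r3 \<Longrightarrow> ?d x = 0"
    using test_functions_bounded[OF d] by metis
  obtain M4 where 4: "0 \<le> M4" "\<And>x. cmod (?e x) \<le> M4" using test_functions_bounded[OF e] by metis
  have i1: "integrable lebesgue (\<lambda>x. \<phi> x * cnj (?e x))"
    by (rule continuous_compact_support_integrable(2)[where M="M1 * M4" and r=r1])
       (auto intro!: continuous_intros cont mult_mono 1 4 simp: norm_mult 1(3))
  have i2: "integrable lebesgue (\<lambda>x. ?d x * cnj (\<psi> x))"
    by (rule continuous_compact_support_integrable(2)[where M="M3 * M2" and r=r3])
       (auto intro!: continuous_intros cont mult_mono 2 3 simp: norm_mult 3(3))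
  have "(LINT x|lebesgue. \<phi> x * cnj (?e x) + ?d x * cnj (\<psi> x)) = 0"
  proof (rule integral_directional_derivative_zero
      [where F="\<lambda>x. \<phi> x * cnj (\<psi> x)" and r=r1 and K="M1 * M2" and M="M1 * M4 + M3 * M2"
        and F'="\<lambda>x h. \<phi> x * cnj (frechet_derivative \<psi> (at x) h) + frechet_derivative \<phi> (at x) h * cnj (\<psi> x)"])
    show "((\<lambda>x. \<phi> x * cnj (\<psi> x)) has_derivative
       (\<lambda>h. \<phi> x * cnj (frechet_derivative \<psi> (at x) h) + frechet_derivative \<phi> (at x) h * cnj (\<psi> x))) (at x)" for x
      by (intro has_derivative_mult test_functions_deriv(1)[OF \<phi>]
        bounded_linear.has_derivative[OF bounded_linear_cnj] test_functions_deriv(1)[OF \<psi>])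
    show "continuous_on UNIV (\<lambda>x. \<phi> x * cnj (?e x) + ?d x * cnj (\<psi> x))"
      by (intro continuous_intros cont)
    show "cmod (\<phi> x * cnj (\<psi> x)) \<le> M1 * M2" for x
      using mult_mono[OF 1(2)[of x] 2(2)[of x] 1(1)] by (simp add: norm_mult)
    show "cmod (\<phi> x * cnj (?e x) + ?d x * cnj (\<psi> x)) \<le> M1 * M4 + M3 * M2" for x
      using norm_triangle_ineq[of "\<phi> x * cnj (?e x)" "?d x * cnj (\<psi> x)"]
        mult_mono[OF 1(2)[of x] 4(2)[of x] 1(1)] mult_mono[OF 3(2)[of x] 2(2)[of x] 3(1)]
      by (simp add: norm_mult)
  qed (simp add: 1(3))
  then show ?thesis using i1 i2 by (simp add: add_eq_0_iff)
qed


section \<open>The fundamental lemma of the calculus of variations\<close>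

text \<open>
Open boxes are stable under intersection and generate the Borel sets, so the integral of \<open>g\<close> over
every Borel set vanishes. A Lebesgue set differs from a Borel set by a null set.
\<close>

lemma AE_zero_if_box_integrals_zero:
  fixes g :: "'a::euclidean_space \<Rightarrow> complex"
  assumes g: "integrable lebesgue g" and total: "integral\<^sup>L lebesgue g = 0"
    and boxes: "\<And>u v. (LINT x|lebesgue. indicator (box u v) x *\<^sub>R g x) = 0"
  shows "AE x in lebesgue. g x = 0"
proof -
  let ?I = "\<lambda>A. (LINT x|lebesgue. indicat_real A x *\<^sub>R g x)"
  let ?G = "range (\<lambda>(a, b). box a b :: 'a set)"
  have sets_eq: "sets (borel :: 'a measure) = sigma_sets UNIV ?G"
    by (subst borel_eq_box) simp
  have leb: "A \<in> sets borel \<Longrightarrow> A \<in> sets lebesgue" for A :: "'a set"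
    by (rule sets_completionI_sets) simp
  have borel: "?I A = 0" if "A \<in> sigma_sets UNIV ?G" for A
  proof (rule sigma_sets_induct_disjoint[of ?G UNIV, where P="\<lambda>A. ?I A = 0"])
    show "Int_stable ?G"
      by (auto simp: Int_stable_def box_Int_box)
    show "?I A = 0" if "A \<in> ?G" for A using that boxes by auto
    show "?I (UNIV - A) = 0" if A: "A \<in> sigma_sets UNIV ?G" and I: "?I A = 0" for A
    proof -
      have int: "integrable lebesgue (\<lambda>x. indicat_real A x *\<^sub>R g x)"
        by (rule integrable_mult_indicator[OF leb g]) (simp add: sets_eq A)
      have "?I (UNIV - A) = (LINT x|lebesgue. g x - indicat_real A x *\<^sub>R g x)"
        by (intro Bochner_Integration.integral_cong) (auto simp: indicator_def)
      also have "\<dots> = 0" using g int total I by simp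
      finally show ?thesis .
    qed
    show "?I (\<Union>i. A i) = 0"
      if disj: "disjoint_family A" and A: "range A \<subseteq> sigma_sets UNIV ?G" and I: "\<And>i. ?I (A i) = 0"
      for A :: "nat \<Rightarrow> 'a set"
    proof -
      have m: "A i \<in> sets lebesgue" for i using A by (intro leb) (auto simp: sets_eq)
      have "set_integrable lebesgue (\<Union>i. A i) g"
        unfolding set_integrable_def by (intro integrable_mult_indicator g sets.countable_UN) (use m in auto)
      then have "(LINT x:(\<Union>i. A i)|lebesgue. g x) = (\<Sum>i. (LINT x:(A i)|lebesgue. g x))"
        using disj by (intro lebesgue_integral_countable_add m) (auto simp: disjoint_family_on_def)
      then show ?thesis using I by (simp add: set_lebesgue_integral_def)
    qed
  qed (use that in auto)
  have all: "?I A = 0" if A: "A \<in> sets lebesgue" for A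
  proof -
    let ?B = "main_part lborel A"
    have B: "?B \<in> sets borel" using main_part_sets[OF A] by simp
    obtain N where N: "N \<in> null_sets lborel" "null_part lborel A \<subseteq> N" using null_part[OF A] by blast
    have "AE x in lebesgue. x \<notin> N"
      using N(1) by (intro AE_not_in null_sets_completionI)
    then have "AE x in lebesgue. indicat_real A x *\<^sub>R g x = indicat_real ?B x *\<^sub>R g x"
    proof (rule AE_mp, intro AE_I2 impI)
      fix x assume "x \<notin> N"
      then have "x \<in> A \<longleftrightarrow> x \<in> ?B" using N(2) main_part_null_part_Un[OF A] by blast
      then show "indicat_real A x *\<^sub>R g x = indicat_real ?B x *\<^sub>R g x" by (simp add: indicator_def)
    qed
    then have "?I A = ?I ?B"
      by (intro integral_cong_AE borel_measurable_integrable integrable_mult_indicator g A leb B)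
    then show ?thesis using borel B by (simp add: sets_eq)
  qed
  have part: "AE x in lebesgue. h (g x) = 0" if h: "h = Re \<or> h = Im" for h
  proof -
    have lin: "bounded_linear h" using h bounded_linear_Re bounded_linear_Im by blast
    have "AE x in lebesgue. h (g x) = (\<lambda>x. 0) x"
    proof (rule density_unique_real)
      show "integrable lebesgue (\<lambda>x. h (g x))" by (rule integrable_bounded_linear[OF lin g])
      fix A :: "'a set" assume A: "A \<in> sets lebesgue"
      have "(LINT x:A|lebesgue. h (g x)) = (LINT x|lebesgue. h (indicat_real A x *\<^sub>R g x))"
        unfolding set_lebesgue_integral_def using linear_simps(5)[OF lin] by simp
      also have "\<dots> = h (?I A)"
        by (rule integral_bounded_linear[OF lin integrable_mult_indicator[OF A g]])
      also have "\<dots> = 0" using all[OF A] linear_simps(3)[OF lin] by simp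
      finally show "(LINT x:A|lebesgue. h (g x)) = (LINT x:A|lebesgue. 0)"
        by (simp add: set_lebesgue_integral_def)
    qed simp
    then show ?thesis by simp
  qed
  show ?thesis using part[of Re] part[of Im] by (auto simp: complex_eq_iff elim: eventually_elim2)
qed

text \<open>
Testing against bumps that tend to the indicator of an open box shows that \<open>f\<close> has integral \<open>0\<close> over
every open box whose closure lies in \<open>\<Omega>\<close>. So \<open>f\<close> vanishes almost everywhere on each
closed box in \<open>\<Omega>\<close>, and countably many of them cover \<open>\<Omega>\<close>.
\<close>

lemma orthogonal_to_test_functions:
  fixes f :: "'a::euclidean_space \<Rightarrow> complex"
  assumes \<Omega>: "open \<Omega>" and f: "square_integrable f"
    and orth: "\<And>\<phi>. \<phi> \<in> test_functions \<Omega> \<Longrightarrow> (LINT x|lebesgue. f x * cnj (\<phi> x)) = 0"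
  shows "AE x in lebesgue. x \<in> \<Omega> \<longrightarrow> f x = 0"
proof -
  have fm: "f \<in> borel_measurable lebesgue" and f2: "integrable lebesgue (\<lambda>x. (cmod (f x))\<^sup>2)"
    using f by (auto simp: square_integrable_def)
  have le: "cmod (f x) \<le> 1 + (cmod (f x))\<^sup>2" for x
  proof -
    have "2 * cmod (f x) \<le> (cmod (f x))\<^sup>2 + 1"
      using zero_le_power2[of "cmod (f x) - 1"] unfolding power2_diff by simp
    then show ?thesis using zero_le_power2[of "cmod (f x)"] norm_ge_zero[of "f x"] by linarith
  qed
  have box_sets: "box u v \<in> sets lebesgue" "cbox u v \<in> sets lebesgue" for u v :: 'a by auto
  have dom: "integrable lebesgue (\<lambda>x. indicat_real (cbox u v) x + (cmod (f x))\<^sup>2)" for u v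
    by (intro Bochner_Integration.integrable_add f2 integrable_real_indicator)
       (auto simp: emeasure_bounded_finite[OF bounded_cbox, simplified])
  have open_box: "(LINT x|lebesgue. indicat_real (box u v) x *\<^sub>R f x) = 0" if sub: "cbox u v \<subseteq> \<Omega>" for u v
  proof -
    let ?\<phi> = "\<lambda>m x. complex_of_real (box_bump u v m x)"
    have cont: "continuous_on UNIV (?\<phi> m)" for m
      by (rule test_functions_continuous[OF box_bump_test_function[OF sub]])
    have bm: "?\<phi> m \<in> borel_measurable lebesgue" for m
      by (intro measurable_completion) (simp add: borel_measurable_continuous_onI[OF cont])
    have "(\<lambda>m. LINT x|lebesgue. f x * ?\<phi> m x) \<longlonglongrightarrow> (LINT x|lebesgue. indicat_real (box u v) x *\<^sub>R f x)"
    proof (rule integral_dominated_convergence[where w="\<lambda>x. indicat_real (cbox u v) x + (cmod (f x))\<^sup>2"])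
      show "(\<lambda>x. indicat_real (box u v) x *\<^sub>R f x) \<in> borel_measurable lebesgue"
        by (intro borel_measurable_scaleR borel_measurable_indicator box_sets fm)
      show "(\<lambda>x. f x * ?\<phi> m x) \<in> borel_measurable lebesgue" for m
        by (intro borel_measurable_times fm bm)
      show "AE x in lebesgue. (\<lambda>m. f x * ?\<phi> m x) \<longlonglongrightarrow> indicat_real (box u v) x *\<^sub>R f x"
      proof (intro AE_I2)
        fix x
        have "(\<lambda>m. f x * ?\<phi> m x) \<longlonglongrightarrow> f x * complex_of_real (indicat_real (box u v) x)"
          by (intro tendsto_intros box_bump_lim)
        then show "(\<lambda>m. f x * ?\<phi> m x) \<longlonglongrightarrow> indicat_real (box u v) x *\<^sub>R f x"
          by (simp add: scaleR_conv_of_real mult.commute)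
      qed
      show "AE x in lebesgue. norm (f x * ?\<phi> m x) \<le> indicat_real (cbox u v) x + (cmod (f x))\<^sup>2" for m
      proof (intro AE_I2)
        fix x
        show "norm (f x * ?\<phi> m x) \<le> indicat_real (cbox u v) x + (cmod (f x))\<^sup>2"
        proof (cases "x \<in> box u v")
          case True
          have "norm (f x * ?\<phi> m x) \<le> cmod (f x)"
            using box_bump_bounds[of u v m x] by (simp add: norm_mult mult_left_le)
          then show ?thesis using le[of x] True box_subset_cbox[of u v] by (auto simp: indicator_def)
        next
          case False
          then have "box_bump u v m x = 0" by (simp add: box_bump_eq_0)
          then show ?thesis by simp
        qed
      qed
    qed (rule dom)
    moreover have "(LINT x|lebesgue. f x * ?\<phi> m x) = 0" for m
      using orth[OF box_bump_test_function[OF sub]] by simp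
    ultimately show ?thesis by (simp add: LIMSEQ_const_iff)
  qed
  have local: "AE x in lebesgue. x \<in> cbox a c \<longrightarrow> f x = 0" if sub: "cbox a c \<subseteq> \<Omega>" for a c
  proof -
    define g where "g x = indicat_real (box a c) x *\<^sub>R f x" for x
    have gi: "integrable lebesgue g"
    proof (rule Bochner_Integration.integrable_bound[OF dom[of a c]])
      show "g \<in> borel_measurable lebesgue"
        unfolding g_def by (intro borel_measurable_scaleR borel_measurable_indicator box_sets fm)
      show "AE x in lebesgue. norm (g x) \<le> norm (indicat_real (cbox a c) x + (cmod (f x))\<^sup>2)"
        using le box_subset_cbox[of a c] by (intro AE_I2) (auto simp: g_def indicator_def)
    qed
    have "AE x in lebesgue. g x = 0"
    proof (rule AE_zero_if_box_integrals_zero[OF gi])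
      show "integral\<^sup>L lebesgue g = 0" unfolding g_def by (rule open_box[OF sub])
      fix u v
      obtain u' v' where inter: "box u v \<inter> box a c = box u' v'" using box_Int_box by blast
      have "(LINT x|lebesgue. indicat_real (box u v) x *\<^sub>R g x) = (LINT x|lebesgue. indicat_real (box u' v') x *\<^sub>R f x)"
        unfolding g_def inter[symmetric] by (intro Bochner_Integration.integral_cong) (auto simp: indicator_def)
      also have "\<dots> = 0"
      proof (cases "box u' v' = {}")
        case False
        have "cbox u' v' = closure (box u' v')" using closure_box[OF False] by simp
        also have "\<dots> \<subseteq> cbox a c"
          unfolding inter[symmetric] using box_subset_cbox[of a c] by (intro closure_minimal) auto
        finally show ?thesis using sub by (intro open_box) blast
      qed simp
      finally show "(LINT x|lebesgue. indicat_real (box u v) x *\<^sub>R g x) = 0" .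
    qed
    moreover have "AE x in lebesgue. x \<notin> cbox a c - box a c"
      by (rule AE_not_in) (simp add: negligible_iff_null_sets[symmetric] negligible_frontier_interval)
    ultimately show ?thesis
      by eventually_elim (auto simp: g_def indicator_def split: if_splits)
  qed
  obtain D where D: "countable D" "D \<subseteq> Pow \<Omega>" "\<And>X. X \<in> D \<Longrightarrow> \<exists>a b. X = cbox a b" "\<Union>D = \<Omega>"
    using open_countable_Union_open_cbox[OF \<Omega>] by metis
  have "AE x in lebesgue. \<forall>X\<in>D. x \<in> X \<longrightarrow> f x = 0"
  proof (rule AE_ball_countable'[OF _ D(1)])
    fix X assume X: "X \<in> D"
    obtain a b where "X = cbox a b" using D(3)[OF X] by blast
    moreover have "X \<subseteq> \<Omega>" using X D(2) by blast
    ultimately show "AE x in lebesgue. x \<in> X \<longrightarrow> f x = 0" using local by blast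
  qed
  then show ?thesis by eventually_elim (use D(4) in blast)
qed

section \<open>Completeness of $L^2$\<close>

lemma square_integrable_meas: "square_integrable f \<Longrightarrow> f \<in> borel_measurable lebesgue"
  by (simp add: square_integrable_def)

lemma fast_subsequence:
  fixes d :: "nat \<Rightarrow> nat \<Rightarrow> real" and c :: "nat \<Rightarrow> real"
  assumes "\<And>e. 0 < e \<Longrightarrow> \<exists>N. \<forall>m\<ge>N. \<forall>n\<ge>N. d m n < e" and "\<And>k. 0 < c k"
  shows "\<exists>r. strict_mono r \<and> (\<forall>k m n. r k \<le> m \<longrightarrow> r k \<le> n \<longrightarrow> d m n < c k)"
proof -
  have "\<exists>r. \<forall>k. (\<forall>m\<ge>r k. \<forall>n\<ge>r k. d m n < c k) \<and> r k < r (Suc k)"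
  proof (rule dependent_nat_choice)
    show "\<exists>x. \<forall>m\<ge>x. \<forall>n\<ge>x. d m n < c 0" using assms by blast
    fix x k
    obtain N where N: "\<forall>m\<ge>N. \<forall>n\<ge>N. d m n < c (Suc k)" using assms by blast
    then show "\<exists>y. (\<forall>m\<ge>y. \<forall>n\<ge>y. d m n < c (Suc k)) \<and> x < y"
      by (intro exI[of _ "max N (Suc x)"]) auto
  qed
  then obtain r where r: "\<And>k. \<forall>m\<ge>r k. \<forall>n\<ge>r k. d m n < c k" "\<And>k. r k < r (Suc k)" by blast
  have "strict_mono r" using r(2) by (simp add: strict_mono_Suc_iff)
  then show ?thesis using r(1) by blast
qed

lemma nn_integral_sq:
  assumes "square_integrable f"
  shows "(\<integral>\<^sup>+x. ennreal ((cmod (f x))\<^sup>2) \<partial>lebesgue) = ennreal (LINT x|lebesgue. (cmod (f x))\<^sup>2)"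
  by (rule nn_integral_eq_integral) (use assms in \<open>auto simp: square_integrable_def\<close>)

text \<open>
Let $a_k$ be the modulus of the \<open>k\<close>-th increment. Then $\sum_k 2^k a_k^2$ has finite integral, so it
is finite almost everywhere, and $a_k \le 2^k a_k^2 + 2^{-k}$ makes the increments summable
there.
\<close>

lemma AE_summable_increments:
  fixes F :: "nat \<Rightarrow> 'a::euclidean_space \<Rightarrow> complex"
  assumes F: "\<And>k. square_integrable (F k)"
    and small: "\<And>k. (LINT x|lebesgue. (cmod (F (Suc k) x - F k x))\<^sup>2) \<le> (1/4) ^ k"
  shows "AE x in lebesgue. convergent (\<lambda>k. F k x)"
proof -
  let ?a = "\<lambda>k x. cmod (F (Suc k) x - F k x)"
  have sq: "square_integrable (\<lambda>x. F (Suc k) x - F k x)" for k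
    by (rule square_integrable_diff[OF F F])
  have meas: "(\<lambda>x. ennreal (2 ^ k * (?a k x)\<^sup>2)) \<in> borel_measurable lebesgue" for k
    using square_integrable_meas[OF sq[of k]] by measurable
  have "(\<integral>\<^sup>+x. (\<Sum>k. ennreal (2 ^ k * (?a k x)\<^sup>2)) \<partial>lebesgue) = (\<Sum>k. \<integral>\<^sup>+x. ennreal (2 ^ k * (?a k x)\<^sup>2) \<partial>lebesgue)"
    by (rule nn_integral_suminf[OF meas])
  also have "\<dots> \<le> (\<Sum>k. ennreal ((1/2) ^ k))"
  proof (rule suminf_le)
    fix k
    have m2: "(\<lambda>x. ennreal ((?a k x)\<^sup>2)) \<in> borel_measurable lebesgue"
      using square_integrable_meas[OF sq[of k]] by measurable
    have "(\<integral>\<^sup>+x. ennreal (2 ^ k * (?a k x)\<^sup>2) \<partial>lebesgue) = (\<integral>\<^sup>+x. ennreal (2 ^ k) * ennreal ((?a k x)\<^sup>2) \<partial>lebesgue)"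
      by (simp add: ennreal_mult)
    also have "\<dots> = ennreal (2 ^ k) * (\<integral>\<^sup>+x. ennreal ((?a k x)\<^sup>2) \<partial>lebesgue)"
      by (rule nn_integral_cmult[OF m2])
    also have "\<dots> = ennreal (2 ^ k * (LINT x|lebesgue. (?a k x)\<^sup>2))"
      by (simp add: nn_integral_sq[OF sq] ennreal_mult)
    also have "\<dots> \<le> ennreal (2 ^ k * (1/4) ^ k)"
      by (intro ennreal_leI mult_left_mono small) simp
    also have "(2::real) ^ k * (1/4) ^ k = (1/2) ^ k"
      by (simp add: power_mult_distrib[symmetric])
    finally show "(\<integral>\<^sup>+x. ennreal (2 ^ k * (?a k x)\<^sup>2) \<partial>lebesgue) \<le> ennreal ((1/2) ^ k)" .
  qed auto
  also have "\<dots> = ennreal (\<Sum>k. (1/2) ^ k)"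
    by (rule suminf_ennreal_eq) (auto intro!: summable_sums summable_geometric)
  also have "\<dots> < \<infinity>" by simp
  finally have "AE x in lebesgue. (\<Sum>k. ennreal (2 ^ k * (?a k x)\<^sup>2)) \<noteq> \<infinity>"
    by (intro nn_integral_noteq_infinite borel_measurable_suminf_order meas) simp
  then show ?thesis
  proof eventually_elim
    case (elim x)
    have "summable (\<lambda>k. 2 ^ k * (?a k x)\<^sup>2)"
      by (rule summable_suminf_not_top) (use elim in \<open>auto simp: top_ennreal_def\<close>)
    then have s: "summable (\<lambda>k. 2 ^ k * (?a k x)\<^sup>2 + (1/2) ^ k)"
      by (intro summable_add summable_geometric) auto
    have le: "?a k x \<le> 2 ^ k * (?a k x)\<^sup>2 + (1/2) ^ k" for k
    proof -
      let ?t = "(2::real) ^ k"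
      have pos: "0 < ?t" by simp
      have "0 \<le> (?t * ?a k x - 1)\<^sup>2" by simp
      then have "2 * (?t * ?a k x) \<le> ?t * (?t * (?a k x)\<^sup>2) + 1"
        by (simp add: power2_eq_square algebra_simps)
      also have "\<dots> = ?t * (?t * (?a k x)\<^sup>2 + (1/2) ^ k)"
        using pos by (simp add: distrib_left power_one_over)
      finally have "?t * (2 * ?a k x) \<le> ?t * (?t * (?a k x)\<^sup>2 + (1/2) ^ k)" by (simp add: mult.left_commute)
      then have "2 * ?a k x \<le> ?t * (?a k x)\<^sup>2 + (1/2) ^ k" using pos by (simp only: mult_le_cancel_left_pos)
      then show ?thesis using norm_ge_zero[of "F (Suc k) x - F k x"] by linarith
    qed
    have "summable (\<lambda>k. F (Suc k) x - F k x)"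
      by (rule summable_norm_cancel, rule summable_comparison_test'[OF s, of 0]) (use le in simp)
    then have "convergent (\<lambda>n. \<Sum>k<n. F (Suc k) x - F k x)"
      by (simp add: summable_iff_convergent)
    moreover have "(\<Sum>k<n. F (Suc k) x - F k x) = F n x - F 0 x" for n
      by (rule sum_lessThan_telescope[of "\<lambda>k. F k x" n])
    ultimately have "convergent (\<lambda>n. F n x - F 0 x)" by (simp only:)
    then have "convergent (\<lambda>n. (F n x - F 0 x) + F 0 x)" by (intro convergent_add convergent_const)
    then show ?case by simp
  qed
qed

text \<open>
A subsequence converges almost everywhere, and Fatou's lemma turns the Cauchy property into convergence
in the mean of the whole sequence. The almost everywhere convergence is part of the conclusion
because it shows that the limit vanishes wherever all members of the sequence do.
\<close>

lemma riesz_fischer: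
  fixes F :: "nat \<Rightarrow> 'a::euclidean_space \<Rightarrow> complex"
  assumes F: "\<And>n. square_integrable (F n)"
    and cauchy: "\<And>e. 0 < e \<Longrightarrow> \<exists>N. \<forall>m\<ge>N. \<forall>n\<ge>N. (LINT x|lebesgue. (cmod (F m x - F n x))\<^sup>2) < e"
  shows "\<exists>f r. square_integrable f \<and> (\<lambda>n. LINT x|lebesgue. (cmod (F n x - f x))\<^sup>2) \<longlonglongrightarrow> 0 \<and>
    (AE x in lebesgue. (\<lambda>k::nat. F (r k) x) \<longlonglongrightarrow> f x)"
proof -
  let ?d = "\<lambda>m n. LINT x|lebesgue. (cmod (F m x - F n x))\<^sup>2"
  have "\<exists>r. strict_mono r \<and> (\<forall>k m n. r k \<le> m \<longrightarrow> r k \<le> n \<longrightarrow> ?d m n < (1/4) ^ k)"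
    by (rule fast_subsequence[OF cauchy]) simp_all
  then obtain r where r: "strict_mono r" and rd0: "\<forall>k m n. r k \<le> m \<longrightarrow> r k \<le> n \<longrightarrow> ?d m n < (1/4) ^ k"
    by blast
  have rd: "?d m n < (1/4) ^ k" if "r k \<le> m" "r k \<le> n" for k m n using rd0 that by blast
  have "?d (r (Suc k)) (r k) \<le> (1/4) ^ k" for k
    using rd[of k "r (Suc k)" "r k"] strict_mono_mono[OF r] by (simp add: mono_def less_imp_le)
  then have conv: "AE x in lebesgue. convergent (\<lambda>k. F (r k) x)"
    using AE_summable_increments[of "\<lambda>k. F (r k)"] F by blast
  define f where "f x = lim (\<lambda>k. F (r k) x)" for x
  have fm: "f \<in> borel_measurable lebesgue"
    unfolding f_def by (rule borel_measurable_lim_metric) (rule square_integrable_meas[OF F])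
  have lim: "AE x in lebesgue. (\<lambda>k. F (r k) x) \<longlonglongrightarrow> f x"
    using conv by eventually_elim (simp add: f_def convergent_LIMSEQ_iff)
  have sqd: "square_integrable (\<lambda>x. F m x - F n x)" for m n
    by (rule square_integrable_diff[OF F F])
  have fatou: "(\<integral>\<^sup>+x. ennreal ((cmod (F n x - f x))\<^sup>2) \<partial>lebesgue) \<le> ennreal ((1/4) ^ k)" if n: "r k \<le> n" for n k
  proof -
    have "AE x in lebesgue. ennreal ((cmod (F n x - f x))\<^sup>2) = liminf (\<lambda>j. ennreal ((cmod (F n x - F (r j) x))\<^sup>2))"
      using lim
    proof eventually_elim
      case (elim x)
      have "(\<lambda>j. ennreal ((cmod (F n x - F (r j) x))\<^sup>2)) \<longlonglongrightarrow> ennreal ((cmod (F n x - f x))\<^sup>2)"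
        by (intro tendsto_intros elim)
      then show ?case by (rule lim_imp_Liminf[symmetric, OF trivial_limit_sequentially])
    qed
    then have "(\<integral>\<^sup>+x. ennreal ((cmod (F n x - f x))\<^sup>2) \<partial>lebesgue)
        = (\<integral>\<^sup>+x. liminf (\<lambda>j. ennreal ((cmod (F n x - F (r j) x))\<^sup>2)) \<partial>lebesgue)"
      by (rule nn_integral_cong_AE)
    also have "\<dots> \<le> liminf (\<lambda>j. \<integral>\<^sup>+x. ennreal ((cmod (F n x - F (r j) x))\<^sup>2) \<partial>lebesgue)"
      using square_integrable_meas[OF F] by (intro nn_integral_liminf) measurable
    also have "\<dots> = liminf (\<lambda>j. ennreal (?d n (r j)))" by (simp add: nn_integral_sq[OF sqd])
    also have "\<dots> \<le> liminf (\<lambda>j. ennreal ((1/4) ^ k))"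
    proof (rule Liminf_mono)
      show "\<forall>\<^sub>F j in sequentially. ennreal (?d n (r j)) \<le> ennreal ((1/4) ^ k)"
        unfolding eventually_sequentially
      proof (intro exI allI impI)
        fix j assume "k \<le> j"
        then have "r k \<le> r j" using strict_mono_mono[OF r] by (simp add: mono_def)
        then show "ennreal (?d n (r j)) \<le> ennreal ((1/4) ^ k)"
          using rd[OF n] by (intro ennreal_leI less_imp_le)
      qed
    qed
    also have "\<dots> = ennreal ((1/4) ^ k)" by (rule Liminf_const) simp
    finally show ?thesis .
  qed
  have sqf: "square_integrable (\<lambda>x. F (r 0) x - f x)"
    unfolding square_integrable_def
  proof
    show m: "(\<lambda>x. F (r 0) x - f x) \<in> borel_measurable lebesgue"
      by (intro borel_measurable_diff square_integrable_meas[OF F] fm)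
    show "integrable lebesgue (\<lambda>x. (cmod (F (r 0) x - f x))\<^sup>2)"
    proof (rule integrableI_nonneg)
      show "(\<lambda>x. (cmod (F (r 0) x - f x))\<^sup>2) \<in> borel_measurable lebesgue" using m by measurable
      show "(\<integral>\<^sup>+x. ennreal ((cmod (F (r 0) x - f x))\<^sup>2) \<partial>lebesgue) < \<infinity>"
        using le_less_trans[OF fatou[OF order_refl, of 0] ennreal_less_top] by simp
    qed simp
  qed
  have f: "square_integrable f"
    using square_integrable_diff[OF F[of "r 0"] sqf] by simp
  have le: "(LINT x|lebesgue. (cmod (F n x - f x))\<^sup>2) \<le> (1/4) ^ k" if "r k \<le> n" for n k
  proof -
    have "ennreal (LINT x|lebesgue. (cmod (F n x - f x))\<^sup>2) \<le> ennreal ((1/4) ^ k)"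
      using fatou[OF that] by (simp only: nn_integral_sq[OF square_integrable_diff[OF F[of n] f]])
    then show ?thesis by (subst (asm) ennreal_le_iff) simp_all
  qed
  have "(\<lambda>n. LINT x|lebesgue. (cmod (F n x - f x))\<^sup>2) \<longlonglongrightarrow> 0"
  proof (rule LIMSEQ_I)
    fix e :: real assume "0 < e"
    then obtain k where k: "(1/4) ^ k < e" using real_arch_pow_inv[of e "1/4"] by auto
    show "\<exists>N. \<forall>n\<ge>N. norm ((LINT x|lebesgue. (cmod (F n x - f x))\<^sup>2) - 0) < e"
    proof (intro exI allI impI)
      fix n assume "r k \<le> n"
      then show "norm ((LINT x|lebesgue. (cmod (F n x - f x))\<^sup>2) - 0) < e"
        using le[of k n] k by (simp add: integral_nonneg_AE)
    qed
  qed
  then show ?thesis using f lim by blast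
qed

section \<open>$L^2(\Omega)$ as a Hilbert space\<close>

lemma integrable_inner:
  assumes f: "square_integrable f" and g: "square_integrable g"
  shows "integrable lebesgue (\<lambda>x. f x * cnj (g x))"
proof (rule Bochner_Integration.integrable_bound)
  show "integrable lebesgue (\<lambda>x. (cmod (f x))\<^sup>2 + (cmod (g x))\<^sup>2)"
    using f g by (simp add: square_integrable_def)
  have "(\<lambda>x. cnj (g x)) \<in> borel_measurable lebesgue"
    by (rule borel_measurable_continuous_on[OF _ square_integrable_meas[OF g]]) (intro continuous_intros)
  then show "(\<lambda>x. f x * cnj (g x)) \<in> borel_measurable lebesgue"
    using square_integrable_meas[OF f] by (intro borel_measurable_times)
  show "AE x in lebesgue. norm (f x * cnj (g x)) \<le> norm ((cmod (f x))\<^sup>2 + (cmod (g x))\<^sup>2)"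
  proof (intro AE_I2)
    fix x
    have "2 * cmod (f x) * cmod (g x) \<le> (cmod (f x))\<^sup>2 + (cmod (g x))\<^sup>2"
      by (rule sum_squares_bound)
    moreover have "0 \<le> cmod (f x) * cmod (g x)" by simp
    ultimately have "cmod (f x) * cmod (g x) \<le> (cmod (f x))\<^sup>2 + (cmod (g x))\<^sup>2" by linarith
    then show "norm (f x * cnj (g x)) \<le> norm ((cmod (f x))\<^sup>2 + (cmod (g x))\<^sup>2)"
      by (simp add: norm_mult)
  qed
qed

lemma l2_inner_add_left: "l2_inner (f + g) h = l2_inner f h + l2_inner g h"
  by transfer (simp add: l2_rel_def distrib_right integrable_inner)

lemma l2_inner_scale_left: "l2_inner (c *\<^sub>C f) h = c * l2_inner f h"
  by transfer (simp add: l2_rel_def mult.assoc)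

lemma l2_inner_abs:
  "square_integrable f \<Longrightarrow> square_integrable g \<Longrightarrow>
    l2_inner (abs_l2 f) (abs_l2 g) = (LINT x|lebesgue. f x * cnj (g x))"
  by (rule l2_inner.abs_eq) (simp_all add: l2_rel_def)

lemma rep_l2_square_integrable: "square_integrable (rep_l2 f)"
  using Quotient3_rep_reflp[OF Quotient3_l2, of f] by (simp add: l2_rel_def)

lemma abs_rep_l2: "abs_l2 (rep_l2 f) = f"
  by (rule Quotient3_abs_rep[OF Quotient3_l2])

lemma l2_inner_commute: "l2_inner g f = cnj (l2_inner f g)"
proof -
  have eq: "l2_inner f g = (LINT x|lebesgue. rep_l2 f x * cnj (rep_l2 g x))" for f g :: "'a l2"
    using l2_inner_abs[OF rep_l2_square_integrable rep_l2_square_integrable, of f g] by (simp add: abs_rep_l2)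
  have "cnj (l2_inner f g) = (LINT x|lebesgue. cnj (rep_l2 f x * cnj (rep_l2 g x)))"
    unfolding eq
    by (rule integral_bounded_linear[symmetric, OF bounded_linear_cnj])
       (intro integrable_inner rep_l2_square_integrable)
  then show ?thesis by (simp add: eq mult.commute)
qed

lemma abs_l2_eq_iff:
  "square_integrable f \<Longrightarrow> square_integrable g \<Longrightarrow> abs_l2 f = abs_l2 g \<longleftrightarrow> (AE x in lebesgue. f x = g x)"
  using Quotient3_rel[OF Quotient3_l2, of f g] by (simp add: l2_rel_def)

lemma abs_l2_diff:
  "square_integrable f \<Longrightarrow> square_integrable g \<Longrightarrow> abs_l2 f - abs_l2 g = abs_l2 (\<lambda>x. f x - g x)"
  by (rule minus_l2.abs_eq) (simp_all add: l2_rel_def)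

lemma l2_vanishes_off_abs:
  "square_integrable f \<Longrightarrow> l2_vanishes_off \<Omega> (abs_l2 f) \<longleftrightarrow> (AE x in lebesgue. x \<notin> \<Omega> \<longrightarrow> f x = 0)"
  by (rule l2_vanishes_off.abs_eq) (simp add: l2_rel_def)

lemma l2_norm_abs:
  assumes f: "square_integrable f"
  shows "l2_inner (abs_l2 f) (abs_l2 f) = complex_of_real (LINT x|lebesgue. (cmod (f x))\<^sup>2)"
  by (simp add: l2_inner_abs f complex_norm_square[symmetric] flip: of_real_power)

lemma L2_sel: "carrier (L2 \<Omega>) = {f. l2_vanishes_off \<Omega> f}" "ip (L2 \<Omega>) = l2_inner"
  by (simp_all add: L2_def)

lemma L2_inner_space: "inner_space (L2 \<Omega>)"
proof
  show "0 \<in> carrier (L2 \<Omega>)" unfolding L2_sel mem_Collect_eq by transfer simp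
  fix x y z :: "'a l2" and c
  show "x \<in> carrier (L2 \<Omega>) \<Longrightarrow> y \<in> carrier (L2 \<Omega>) \<Longrightarrow> x + y \<in> carrier (L2 \<Omega>)"
    unfolding L2_sel mem_Collect_eq by transfer (auto elim: eventually_elim2)
  show "x \<in> carrier (L2 \<Omega>) \<Longrightarrow> c *\<^sub>C x \<in> carrier (L2 \<Omega>)"
    unfolding L2_sel mem_Collect_eq by transfer (auto elim: eventually_mono)
  show "ip (L2 \<Omega>) (x + y) z = ip (L2 \<Omega>) x z + ip (L2 \<Omega>) y z"
    by (simp add: L2_sel l2_inner_add_left)
  show "ip (L2 \<Omega>) (c *\<^sub>C x) y = c * ip (L2 \<Omega>) x y"
    by (simp add: L2_sel l2_inner_scale_left)
  show "ip (L2 \<Omega>) y x = cnj (ip (L2 \<Omega>) x y)"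
    unfolding L2_sel by (rule l2_inner_commute)
  show "0 \<le> Re (ip (L2 \<Omega>) x x)"
    using l2_norm_abs[OF rep_l2_square_integrable, of x] by (simp add: L2_sel abs_rep_l2 integral_nonneg_AE)
  assume "ip (L2 \<Omega>) x x = 0"
  then have z: "(LINT t|lebesgue. (cmod (rep_l2 x t))\<^sup>2) = 0"
    using l2_norm_abs[OF rep_l2_square_integrable, of x] by (simp add: L2_sel abs_rep_l2)
  have "AE t in lebesgue. (cmod (rep_l2 x t))\<^sup>2 = 0"
    using z rep_l2_square_integrable[of x]
    by (subst (asm) integral_nonneg_eq_0_iff_AE) (auto simp: square_integrable_def)
  then have "abs_l2 (rep_l2 x) = abs_l2 (\<lambda>t. 0)"
    by (subst abs_l2_eq_iff) (auto simp: rep_l2_square_integrable square_integrable_zero)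
  then show "x = 0" by (simp add: abs_rep_l2 zero_l2_def)
qed

theorem L2_hilbert: "hilbert (L2 \<Omega>)"
proof -
  interpret inner_space "L2 \<Omega>" by (rule L2_inner_space)
  show ?thesis
  proof
    fix X assume X: "ip_cauchy X"
    define F where "F n = rep_l2 (X n)" for n
    have F: "square_integrable (F n)" and XF: "X n = abs_l2 (F n)" for n
      by (simp_all add: F_def rep_l2_square_integrable abs_rep_l2)
    have XH: "X n \<in> carrier (L2 \<Omega>)" for n using X by (simp add: ip_cauchy_def)
    have nrm: "ip_norm (L2 \<Omega>) (abs_l2 f - abs_l2 g) = sqrt (LINT x|lebesgue. (cmod (f x - g x))\<^sup>2)"
      if "square_integrable f" "square_integrable g" for f g
      using that by (simp add: ip_norm_def L2_sel abs_l2_diff l2_norm_abs square_integrable_diff)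
    have cau: "\<exists>N. \<forall>m\<ge>N. \<forall>n\<ge>N. (LINT x|lebesgue. (cmod (F m x - F n x))\<^sup>2) < e" if e: "0 < e" for e
    proof -
      have "0 < sqrt e" using e by simp
      then obtain N where N: "\<forall>m\<ge>N. \<forall>n\<ge>N. ip_norm (L2 \<Omega>) (X m - X n) < sqrt e"
        using X unfolding ip_cauchy_def by blast
      then show ?thesis unfolding XF nrm[OF F F] real_sqrt_less_iff by blast
    qed
    obtain f r where f: "square_integrable f"
      and lim: "(\<lambda>n. LINT x|lebesgue. (cmod (F n x - f x))\<^sup>2) \<longlonglongrightarrow> 0"
      and ae: "AE x in lebesgue. (\<lambda>k::nat. F (r k) x) \<longlonglongrightarrow> f x"
      using riesz_fischer[of F, OF F cau] by blast
    have "AE x in lebesgue. x \<notin> \<Omega> \<longrightarrow> F n x = 0" for n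
      using XH[of n] l2_vanishes_off_abs[OF F[of n], of \<Omega>] by (simp add: L2_sel XF)
    then have "AE x in lebesgue. \<forall>n. x \<notin> \<Omega> \<longrightarrow> F n x = 0" by (subst AE_all_countable) blast
    with ae have "AE x in lebesgue. x \<notin> \<Omega> \<longrightarrow> f x = 0"
      by eventually_elim (auto simp: LIMSEQ_const_iff)
    then have fH: "abs_l2 f \<in> carrier (L2 \<Omega>)" by (simp add: L2_sel l2_vanishes_off_abs[OF f])
    have "(\<lambda>n. ip_norm (L2 \<Omega>) (X n - abs_l2 f)) \<longlonglongrightarrow> 0"
      unfolding XF nrm[OF F f] using tendsto_real_sqrt[OF lim] by simp
    then show "\<exists>x. ip_lim X x" using XH fH unfolding ip_lim_def by blast
  qed
qed

section \<open>Weak derivatives and $H^1$\<close>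

lemma test_function_L2: "\<phi> \<in> test_functions \<Omega> \<Longrightarrow> abs_l2 \<phi> \<in> carrier (L2 \<Omega>)"
  by (simp add: L2_sel l2_vanishes_off_abs test_function_square_integrable test_functions_vanish)

lemma L2_orthogonal_to_test_functions:
  assumes \<Omega>: "open \<Omega>" and u: "u \<in> carrier (L2 \<Omega>)"
    and orth: "\<And>\<phi>. \<phi> \<in> test_functions \<Omega> \<Longrightarrow> l2_inner u (abs_l2 \<phi>) = 0"
  shows "u = 0"
proof -
  let ?F = "rep_l2 u"
  note sq = rep_l2_square_integrable[of u]
  have "AE x in lebesgue. x \<in> \<Omega> \<longrightarrow> ?F x = 0"
  proof (rule orthogonal_to_test_functions[OF \<Omega> sq])
    fix \<phi> assume \<phi>: "\<phi> \<in> test_functions \<Omega>"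
    show "(LINT x|lebesgue. ?F x * cnj (\<phi> x)) = 0"
      using orth[OF \<phi>] l2_inner_abs[OF sq test_function_square_integrable[OF \<phi>]] by (simp add: abs_rep_l2)
  qed
  moreover have "AE x in lebesgue. x \<notin> \<Omega> \<longrightarrow> ?F x = 0"
    using u l2_vanishes_off_abs[OF sq, of \<Omega>] by (simp add: L2_sel abs_rep_l2)
  ultimately have "AE x in lebesgue. ?F x = 0" by eventually_elim blast
  then have "abs_l2 ?F = abs_l2 (\<lambda>x. 0)"
    by (subst abs_l2_eq_iff[OF sq square_integrable_zero])
  then show ?thesis by (simp add: abs_rep_l2 zero_l2_def)
qed

lemma L2_ip: "ip (L2 \<Omega>) = l2_inner" by (simp add: L2_sel)

context
  fixes \<Omega> :: "'a::euclidean_space set"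
  assumes \<Omega>: "open \<Omega>"
begin

interpretation L: hilbert "L2 \<Omega>" by (rule L2_hilbert)

text \<open>
Two weak derivatives have the same inner products with all test functions, so their difference is \<open>0\<close>
by \<open>L2_orthogonal_to_test_functions\<close>.
\<close>

lemma weak_deriv_eq:
  assumes g: "g \<in> carrier (L2 \<Omega>)" "has_weak_deriv \<Omega> b f g"
  shows "weak_deriv \<Omega> b f = g"
  unfolding weak_deriv_def
proof (rule the_equality)
  show "g \<in> carrier (L2 \<Omega>) \<and> has_weak_deriv \<Omega> b f g" using g by blast
  fix h assume h: "h \<in> carrier (L2 \<Omega>) \<and> has_weak_deriv \<Omega> b f h"
  have "h - g = 0"
  proof (rule L2_orthogonal_to_test_functions[OF \<Omega>])
    show "h - g \<in> carrier (L2 \<Omega>)" using g h by (intro L.diff_mem) auto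
    fix \<phi> assume \<phi>: "\<phi> \<in> test_functions \<Omega>"
    have "l2_inner h (abs_l2 \<phi>) = l2_inner g (abs_l2 \<phi>)"
      using g(2) h \<phi> unfolding has_weak_deriv_def by (metis neg_equal_iff_equal)
    then show "l2_inner (h - g) (abs_l2 \<phi>) = 0"
      using L.ip_diff_left[of h g "abs_l2 \<phi>"] g h test_function_L2[OF \<phi>] by (simp add: L2_ip)
  qed
  then show "h = g" by simp
qed

lemma has_weak_deriv_add:
  "has_weak_deriv \<Omega> b f g \<Longrightarrow> has_weak_deriv \<Omega> b f' g' \<Longrightarrow> has_weak_deriv \<Omega> b (f + f') (g + g')"
  unfolding has_weak_deriv_def by (simp add: l2_inner_add_left)

lemma has_weak_deriv_scale:
  "has_weak_deriv \<Omega> b f g \<Longrightarrow> has_weak_deriv \<Omega> b (c *\<^sub>C f) (c *\<^sub>C g)"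
  unfolding has_weak_deriv_def by (simp add: l2_inner_scale_left)

lemma H1_carrier:
  "f \<in> carrier (H1 \<Omega>) \<longleftrightarrow> f \<in> carrier (L2 \<Omega>) \<and> (\<forall>b\<in>Basis. \<exists>g\<in>carrier (L2 \<Omega>). has_weak_deriv \<Omega> b f g)"
  by (simp add: H1_def)

lemma H1_ip:
  "ip (H1 \<Omega>) f g = l2_inner f g + (\<Sum>b\<in>Basis. l2_inner (weak_deriv \<Omega> b f) (weak_deriv \<Omega> b g))"
  by (simp add: H1_def)

lemma H1_L2: "f \<in> carrier (H1 \<Omega>) \<Longrightarrow> f \<in> carrier (L2 \<Omega>)"
  by (simp add: H1_carrier)

lemma H1_weak_deriv:
  assumes "f \<in> carrier (H1 \<Omega>)" "b \<in> Basis"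
  shows "weak_deriv \<Omega> b f \<in> carrier (L2 \<Omega>)" "has_weak_deriv \<Omega> b f (weak_deriv \<Omega> b f)"
proof -
  obtain g where "g \<in> carrier (L2 \<Omega>)" "has_weak_deriv \<Omega> b f g"
    using assms by (auto simp: H1_carrier)
  with weak_deriv_eq[OF this] show "weak_deriv \<Omega> b f \<in> carrier (L2 \<Omega>)" "has_weak_deriv \<Omega> b f (weak_deriv \<Omega> b f)"
    by simp_all
qed

lemma weak_deriv_add:
  "f \<in> carrier (H1 \<Omega>) \<Longrightarrow> g \<in> carrier (H1 \<Omega>) \<Longrightarrow> b \<in> Basis \<Longrightarrow>
    weak_deriv \<Omega> b (f + g) = weak_deriv \<Omega> b f + weak_deriv \<Omega> b g"
  by (intro weak_deriv_eq L.add_mem has_weak_deriv_add H1_weak_deriv)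

lemma weak_deriv_scale:
  "f \<in> carrier (H1 \<Omega>) \<Longrightarrow> b \<in> Basis \<Longrightarrow> weak_deriv \<Omega> b (c *\<^sub>C f) = c *\<^sub>C weak_deriv \<Omega> b f"
  by (intro weak_deriv_eq L.scale_mem has_weak_deriv_scale H1_weak_deriv)

lemma H1_inner_space: "inner_space (H1 \<Omega>)"
proof
  have sum_re: "0 \<le> Re (\<Sum>b\<in>Basis. l2_inner (weak_deriv \<Omega> b x) (weak_deriv \<Omega> b x))"
    if "x \<in> carrier (H1 \<Omega>)" for x
    unfolding Re_sum using L.ip_nonneg[OF H1_weak_deriv(1)[OF that]] by (intro sum_nonneg) (simp add: L2_ip)
  have "has_weak_deriv \<Omega> b 0 0" for b
    unfolding has_weak_deriv_def using l2_inner_scale_left[of 0 "0::'a l2"] by simp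
  then show "0 \<in> carrier (H1 \<Omega>)" using L.zero_mem by (auto simp: H1_carrier)
  fix x y z :: "'a l2" and c
  show add: "x + y \<in> carrier (H1 \<Omega>)" if x: "x \<in> carrier (H1 \<Omega>)" and y: "y \<in> carrier (H1 \<Omega>)"
    unfolding H1_carrier
  proof (intro conjI ballI)
    show "x + y \<in> carrier (L2 \<Omega>)" by (intro L.add_mem H1_L2 x y)
    fix b :: 'a assume b: "b \<in> Basis"
    show "\<exists>g\<in>carrier (L2 \<Omega>). has_weak_deriv \<Omega> b (x + y) g"
      using has_weak_deriv_add[OF H1_weak_deriv(2)[OF x b] H1_weak_deriv(2)[OF y b]]
        L.add_mem[OF H1_weak_deriv(1)[OF x b] H1_weak_deriv(1)[OF y b]] by (rule bexI)
  qed
  show scale: "c *\<^sub>C x \<in> carrier (H1 \<Omega>)" if x: "x \<in> carrier (H1 \<Omega>)"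
    unfolding H1_carrier
  proof (intro conjI ballI)
    show "c *\<^sub>C x \<in> carrier (L2 \<Omega>)" by (intro L.scale_mem H1_L2 x)
    fix b :: 'a assume b: "b \<in> Basis"
    show "\<exists>g\<in>carrier (L2 \<Omega>). has_weak_deriv \<Omega> b (c *\<^sub>C x) g"
      using has_weak_deriv_scale[OF H1_weak_deriv(2)[OF x b]]
        L.scale_mem[OF H1_weak_deriv(1)[OF x b]] by (rule bexI)
  qed
  show "ip (H1 \<Omega>) (x + y) z = ip (H1 \<Omega>) x z + ip (H1 \<Omega>) y z"
    if "x \<in> carrier (H1 \<Omega>)" "y \<in> carrier (H1 \<Omega>)" "z \<in> carrier (H1 \<Omega>)"
    using that by (simp add: H1_ip weak_deriv_add l2_inner_add_left sum.distrib)
  show "ip (H1 \<Omega>) (c *\<^sub>C x) y = c * ip (H1 \<Omega>) x y"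
    if "x \<in> carrier (H1 \<Omega>)" "y \<in> carrier (H1 \<Omega>)"
    using that by (simp add: H1_ip weak_deriv_scale l2_inner_scale_left distrib_left sum_distrib_left)
  show "ip (H1 \<Omega>) y x = cnj (ip (H1 \<Omega>) x y)"
    unfolding H1_ip complex_cnj_add cnj_sum by (simp only: l2_inner_commute[symmetric])
  show "0 \<le> Re (ip (H1 \<Omega>) x x)" if x: "x \<in> carrier (H1 \<Omega>)"
    using L.ip_nonneg[OF H1_L2[OF x]] sum_re[OF x] by (simp add: H1_ip L2_ip)
  show "x = 0" if x: "x \<in> carrier (H1 \<Omega>)" and z: "ip (H1 \<Omega>) x x = 0"
  proof (rule L.ip_definite[OF H1_L2[OF x]])
    have "Re (l2_inner x x) = 0"
      using L.ip_nonneg[OF H1_L2[OF x]] sum_re[OF x] z by (simp add: H1_ip L2_ip complex_eq_iff)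
    then show "ip (L2 \<Omega>) x x = 0" using L.ip_self_im[OF H1_L2[OF x]] by (simp add: L2_ip complex_eq_iff)
  qed
qed

interpretation H1: inner_space "H1 \<Omega>" by (rule H1_inner_space)

lemma H1_norm_sq:
  assumes f: "f \<in> carrier (H1 \<Omega>)"
  shows "(ip_norm (H1 \<Omega>) f)\<^sup>2 = (ip_norm (L2 \<Omega>) f)\<^sup>2 + (\<Sum>b\<in>Basis. (ip_norm (L2 \<Omega>) (weak_deriv \<Omega> b f))\<^sup>2)"
  using f by (simp add: H1.norm_sq L.norm_sq H1_L2 H1_weak_deriv(1) H1_ip L2_ip)

lemma H1_norm_ge:
  assumes f: "f \<in> carrier (H1 \<Omega>)"
  shows "ip_norm (L2 \<Omega>) f \<le> ip_norm (H1 \<Omega>) f"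
    and "b \<in> Basis \<Longrightarrow> ip_norm (L2 \<Omega>) (weak_deriv \<Omega> b f) \<le> ip_norm (H1 \<Omega>) f"
proof -
  have s: "0 \<le> (\<Sum>b\<in>Basis. (ip_norm (L2 \<Omega>) (weak_deriv \<Omega> b f))\<^sup>2)" by (intro sum_nonneg) simp
  show "ip_norm (L2 \<Omega>) f \<le> ip_norm (H1 \<Omega>) f"
    by (rule power2_le_imp_le[OF _ H1.norm_nonneg[OF f]]) (use s in \<open>simp add: H1_norm_sq[OF f]\<close>)
  assume b: "b \<in> Basis"
  have "(ip_norm (L2 \<Omega>) (weak_deriv \<Omega> b f))\<^sup>2 \<le> (\<Sum>b\<in>Basis. (ip_norm (L2 \<Omega>) (weak_deriv \<Omega> b f))\<^sup>2)"
    using b by (intro member_le_sum) auto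
  then show "ip_norm (L2 \<Omega>) (weak_deriv \<Omega> b f) \<le> ip_norm (H1 \<Omega>) f"
    by (intro power2_le_imp_le[OF _ H1.norm_nonneg[OF f]])
       (simp add: H1_norm_sq[OF f] add_increasing)
qed

lemma weak_deriv_diff:
  assumes "f \<in> carrier (H1 \<Omega>)" "g \<in> carrier (H1 \<Omega>)" "b \<in> Basis"
  shows "weak_deriv \<Omega> b (f - g) = weak_deriv \<Omega> b f - weak_deriv \<Omega> b g"
  using weak_deriv_add[OF assms(1) H1.scale_mem[OF assms(2), of "-1"] assms(3)]
    weak_deriv_scale[OF assms(2,3), of "-1"] by (simp add: scaleC_minus_one)

text \<open>
A Cauchy sequence in \<open>H1 \<Omega>\<close> converges in $L^2$ together with its weak derivatives. The defining
equation of a weak derivative involves only inner products with fixed elements of $L^2$, so it passes to the limit.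
\<close>

theorem H1_hilbert: "hilbert (H1 \<Omega>)"
proof
  fix X assume X: "H1.ip_cauchy X"
  then have XH: "X n \<in> carrier (H1 \<Omega>)" for n by (simp add: H1.ip_cauchy_def)
  have cau: "\<exists>N. \<forall>m\<ge>N. \<forall>n\<ge>N. ip_norm (H1 \<Omega>) (X m - X n) < e" if "0 < e" for e
    using X that unfolding H1.ip_cauchy_def by blast
  have "L.ip_cauchy X"
    unfolding L.ip_cauchy_def
  proof (intro conjI allI impI H1_L2 XH)
    fix e :: real assume "0 < e"
    then obtain N where "\<forall>m\<ge>N. \<forall>n\<ge>N. ip_norm (H1 \<Omega>) (X m - X n) < e" using cau by blast
    then show "\<exists>N. \<forall>m\<ge>N. \<forall>n\<ge>N. ip_norm (L2 \<Omega>) (X m - X n) < e"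
      using H1_norm_ge(1)[OF H1.diff_mem[OF XH XH]] by (meson le_less_trans)
  qed
  then obtain f where f: "L.ip_lim X f" using L.complete by blast
  have "\<exists>g. L.ip_lim (\<lambda>n. weak_deriv \<Omega> b (X n)) g" if b: "b \<in> Basis" for b
  proof (rule L.complete, unfold L.ip_cauchy_def, intro conjI allI impI H1_weak_deriv(1)[OF XH b])
    fix e :: real assume "0 < e"
    then obtain N where N: "\<forall>m\<ge>N. \<forall>n\<ge>N. ip_norm (H1 \<Omega>) (X m - X n) < e" using cau by blast
    have "ip_norm (L2 \<Omega>) (weak_deriv \<Omega> b (X m) - weak_deriv \<Omega> b (X n)) < e" if "N \<le> m" "N \<le> n" for m n
      using H1_norm_ge(2)[OF H1.diff_mem[OF XH XH] b, of m n] N that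
      by (auto simp: weak_deriv_diff[OF XH XH b] intro: le_less_trans)
    then show "\<exists>N. \<forall>m\<ge>N. \<forall>n\<ge>N. ip_norm (L2 \<Omega>) (weak_deriv \<Omega> b (X m) - weak_deriv \<Omega> b (X n)) < e"
      by blast
  qed
  then obtain g where g: "\<And>b. b \<in> Basis \<Longrightarrow> L.ip_lim (\<lambda>n. weak_deriv \<Omega> b (X n)) (g b)" by metis
  have fL: "f \<in> carrier (L2 \<Omega>)" using f by (simp add: L.ip_lim_def)
  have gL: "g b \<in> carrier (L2 \<Omega>)" if "b \<in> Basis" for b using g[OF that] by (simp add: L.ip_lim_def)
  have wd: "has_weak_deriv \<Omega> b f (g b)" if b: "b \<in> Basis" for b
    unfolding has_weak_deriv_def
  proof
    fix \<phi> assume \<phi>: "\<phi> \<in> test_functions \<Omega>"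
    let ?d = "abs_l2 (\<lambda>x. frechet_derivative \<phi> (at x) b)"
    have lim1: "(\<lambda>n. l2_inner (X n) ?d) \<longlonglongrightarrow> l2_inner f ?d"
      using L.ip_lim_ip_left[OF f test_function_L2[OF test_functions_deriv(2)[OF \<phi> b]]] by (simp add: L2_ip)
    have lim2: "(\<lambda>n. - l2_inner (weak_deriv \<Omega> b (X n)) (abs_l2 \<phi>)) \<longlonglongrightarrow> - l2_inner (g b) (abs_l2 \<phi>)"
      using tendsto_minus[OF L.ip_lim_ip_left[OF g[OF b] test_function_L2[OF \<phi>]]] by (simp add: L2_ip)
    have "l2_inner (X n) ?d = - l2_inner (weak_deriv \<Omega> b (X n)) (abs_l2 \<phi>)" for n
      using H1_weak_deriv(2)[OF XH b] \<phi> unfolding has_weak_deriv_def by blast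
    then have "(\<lambda>n. - l2_inner (weak_deriv \<Omega> b (X n)) (abs_l2 \<phi>)) \<longlonglongrightarrow> l2_inner f ?d"
      using lim1 by simp
    then show "l2_inner f ?d = - l2_inner (g b) (abs_l2 \<phi>)" by (rule LIMSEQ_unique[OF _ lim2])
  qed
  have fH: "f \<in> carrier (H1 \<Omega>)" using fL gL wd by (auto simp: H1_carrier)
  have wf: "weak_deriv \<Omega> b f = g b" if "b \<in> Basis" for b
    by (rule weak_deriv_eq[OF gL[OF that] wd[OF that]])
  have "ip_norm (H1 \<Omega>) (X n - f) =
      sqrt ((ip_norm (L2 \<Omega>) (X n - f))\<^sup>2 + (\<Sum>b\<in>Basis. (ip_norm (L2 \<Omega>) (weak_deriv \<Omega> b (X n) - g b))\<^sup>2))" for n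
  proof -
    have "(\<Sum>b\<in>Basis. (ip_norm (L2 \<Omega>) (weak_deriv \<Omega> b (X n - f)))\<^sup>2) =
        (\<Sum>b\<in>Basis. (ip_norm (L2 \<Omega>) (weak_deriv \<Omega> b (X n) - g b))\<^sup>2)"
      by (rule sum.cong) (simp_all add: weak_deriv_diff[OF XH fH] wf)
    then show ?thesis
      using H1_norm_sq[OF H1.diff_mem[OF XH fH], of n] H1.norm_nonneg[OF H1.diff_mem[OF XH fH], of n]
      by (simp add: real_sqrt_unique)
  qed
  moreover have "(\<lambda>n. sqrt ((ip_norm (L2 \<Omega>) (X n - f))\<^sup>2 +
      (\<Sum>b\<in>Basis. (ip_norm (L2 \<Omega>) (weak_deriv \<Omega> b (X n) - g b))\<^sup>2))) \<longlonglongrightarrow> sqrt (0\<^sup>2 + (\<Sum>b\<in>(Basis::'a set). 0\<^sup>2))"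
    using f g by (intro tendsto_intros) (auto simp: L.ip_lim_def)
  ultimately have "(\<lambda>n. ip_norm (H1 \<Omega>) (X n - f)) \<longlonglongrightarrow> 0" by simp
  then show "\<exists>x. H1.ip_lim X x" using XH fH unfolding H1.ip_lim_def by blast
qed

section \<open>$H^1_0$\<close>

lemma test_function_H1:
  assumes \<phi>: "\<phi> \<in> test_functions \<Omega>"
  shows "abs_l2 \<phi> \<in> carrier (H1 \<Omega>)"
  unfolding H1_carrier
proof (intro conjI ballI test_function_L2[OF \<phi>])
  fix b :: 'a assume b: "b \<in> Basis"
  let ?d = "\<lambda>x. frechet_derivative \<phi> (at x) b"
  note d = test_functions_deriv(2)[OF \<phi> b]
  have "has_weak_deriv \<Omega> b (abs_l2 \<phi>) (abs_l2 ?d)"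
    unfolding has_weak_deriv_def
  proof
    fix \<psi> assume \<psi>: "\<psi> \<in> test_functions \<Omega>"
    note e = test_functions_deriv(2)[OF \<psi> b]
    show "l2_inner (abs_l2 \<phi>) (abs_l2 (\<lambda>x. frechet_derivative \<psi> (at x) b)) = - l2_inner (abs_l2 ?d) (abs_l2 \<psi>)"
      using test_functions_integration_by_parts[OF \<phi> \<psi> b]
      by (simp add: l2_inner_abs test_function_square_integrable[OF \<phi>] test_function_square_integrable[OF \<psi>]
          test_function_square_integrable[OF d] test_function_square_integrable[OF e])
  qed
  then show "\<exists>g\<in>carrier (L2 \<Omega>). has_weak_deriv \<Omega> b (abs_l2 \<phi>) g"
    using test_function_L2[OF d] by blast
qed

lemma test_functions_add:
  assumes \<phi>: "\<phi> \<in> test_functions \<Omega>" and \<psi>: "\<psi> \<in> test_functions \<Omega>"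
  shows "(\<lambda>x. \<phi> x + \<psi> x) \<in> test_functions \<Omega>"
proof -
  let ?K = "closure {x. \<phi> x \<noteq> 0} \<union> closure {x. \<psi> x \<noteq> 0}"
  have K: "compact ?K" "?K \<subseteq> \<Omega>" using \<phi> \<psi> by (auto simp: test_functions_def)
  have "{x. \<phi> x + \<psi> x \<noteq> 0} \<subseteq> {x. \<phi> x \<noteq> 0} \<union> {x. \<psi> x \<noteq> 0}" by auto
  also have "\<dots> \<subseteq> ?K" by (intro Un_mono closure_subset)
  finally have sub: "closure {x. \<phi> x + \<psi> x \<noteq> 0} \<subseteq> ?K"
    by (rule closure_minimal) (intro closed_Un closed_closure)
  have "compact (closure {x. \<phi> x + \<psi> x \<noteq> 0})"
    using bounded_subset[OF compact_imp_bounded[OF K(1)] sub] by (simp add: compact_eq_bounded_closed)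
  moreover have "\<forall>k. times_cont_diff k (\<lambda>x. \<phi> x + \<psi> x)"
    by (intro allI times_cont_diff_add test_functions_smooth[OF \<phi>] test_functions_smooth[OF \<psi>])
  ultimately show ?thesis
    unfolding test_functions_def using order_trans[OF sub K(2)] by blast
qed

lemma test_functions_scale:
  assumes \<phi>: "\<phi> \<in> test_functions \<Omega>"
  shows "(\<lambda>x. c * \<phi> x) \<in> test_functions \<Omega>"
proof -
  let ?K = "closure {x. \<phi> x \<noteq> 0}"
  have K: "compact ?K" "?K \<subseteq> \<Omega>" using \<phi> by (auto simp: test_functions_def)
  have sub: "closure {x. c * \<phi> x \<noteq> 0} \<subseteq> ?K" by (rule closure_mono) auto
  have "compact (closure {x. c * \<phi> x \<noteq> 0})"
    using bounded_subset[OF compact_imp_bounded[OF K(1)] sub] by (simp add: compact_eq_bounded_closed)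
  then show ?thesis
    using times_cont_diff_mult[OF times_cont_diff_const test_functions_smooth[OF \<phi>]] sub K(2)
    by (auto simp: test_functions_def)
qed

lemma H10_carrier:
  "f \<in> carrier (H10 \<Omega>) \<longleftrightarrow> f \<in> carrier (H1 \<Omega>) \<and>
    (\<forall>\<epsilon>>0. \<exists>\<phi>\<in>test_functions \<Omega>. ip_norm (H1 \<Omega>) (f - abs_l2 \<phi>) < \<epsilon>)"
  by (simp add: H10_def)

lemma H10_ip: "ip (H10 \<Omega>) = ip (H1 \<Omega>)"
  by (simp add: H10_def)

lemma H10_norm: "ip_norm (H10 \<Omega>) = ip_norm (H1 \<Omega>)"
  by (simp add: ip_norm_def fun_eq_iff H10_ip)

lemma H10_H1: "f \<in> carrier (H10 \<Omega>) \<Longrightarrow> f \<in> carrier (H1 \<Omega>)"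
  by (simp add: H10_carrier)

lemma test_function_zero: "(\<lambda>x. 0) \<in> test_functions \<Omega>"
  by (simp add: test_functions_def times_cont_diff_const)

lemma test_function_H10: "\<phi> \<in> test_functions \<Omega> \<Longrightarrow> abs_l2 \<phi> \<in> carrier (H10 \<Omega>)"
  unfolding H10_carrier using test_function_H1[of \<phi>] H1.norm_zero by (auto intro!: bexI[of _ \<phi>])

lemma H10_add:
  assumes f: "f \<in> carrier (H10 \<Omega>)" and g: "g \<in> carrier (H10 \<Omega>)"
  shows "f + g \<in> carrier (H10 \<Omega>)"
  unfolding H10_carrier
proof (intro conjI allI impI H1.add_mem H10_H1 f g)
  fix e :: real assume "0 < e"
  then have "0 < e / 2" by simp
  then obtain \<phi> \<psi> where \<phi>: "\<phi> \<in> test_functions \<Omega>" "ip_norm (H1 \<Omega>) (f - abs_l2 \<phi>) < e / 2"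
    and \<psi>: "\<psi> \<in> test_functions \<Omega>" "ip_norm (H1 \<Omega>) (g - abs_l2 \<psi>) < e / 2"
    using f g unfolding H10_carrier by meson
  have eq: "abs_l2 (\<lambda>x. \<phi> x + \<psi> x) = abs_l2 \<phi> + abs_l2 \<psi>"
    using test_function_square_integrable[OF \<phi>(1)] test_function_square_integrable[OF \<psi>(1)]
    by (intro plus_l2.abs_eq[symmetric]) (auto simp: l2_rel_def)
  have "ip_norm (H1 \<Omega>) ((f - abs_l2 \<phi>) + (g - abs_l2 \<psi>)) \<le> ip_norm (H1 \<Omega>) (f - abs_l2 \<phi>) + ip_norm (H1 \<Omega>) (g - abs_l2 \<psi>)"
    by (intro H1.norm_triangle H1.diff_mem H10_H1 f g test_function_H1 \<phi> \<psi>)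
  also have "\<dots> < e" using \<phi>(2) \<psi>(2) by simp
  finally have "ip_norm (H1 \<Omega>) (f + g - abs_l2 (\<lambda>x. \<phi> x + \<psi> x)) < e" by (simp add: eq algebra_simps)
  then show "\<exists>\<phi>\<in>test_functions \<Omega>. ip_norm (H1 \<Omega>) (f + g - abs_l2 \<phi>) < e"
    using test_functions_add[OF \<phi>(1) \<psi>(1)] by blast
qed

lemma H10_scale:
  assumes f: "f \<in> carrier (H10 \<Omega>)"
  shows "c *\<^sub>C f \<in> carrier (H10 \<Omega>)"
  unfolding H10_carrier
proof (intro conjI allI impI H1.scale_mem H10_H1 f)
  fix e :: real assume e: "0 < e"
  have pos: "0 < cmod c + 1" by (simp add: add_nonneg_pos)
  then have "0 < e / (cmod c + 1)" using e by simp
  then obtain \<phi> where \<phi>: "\<phi> \<in> test_functions \<Omega>" "ip_norm (H1 \<Omega>) (f - abs_l2 \<phi>) < e / (cmod c + 1)"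
    using f unfolding H10_carrier by meson
  have eq: "abs_l2 (\<lambda>x. c * \<phi> x) = c *\<^sub>C abs_l2 \<phi>"
    using test_function_square_integrable[OF \<phi>(1)]
    by (intro scaleC_l2.abs_eq[symmetric]) (auto simp: l2_rel_def)
  have m: "f - abs_l2 \<phi> \<in> carrier (H1 \<Omega>)" by (intro H1.diff_mem H10_H1 f test_function_H1 \<phi>)
  have "ip_norm (H1 \<Omega>) (c *\<^sub>C f - abs_l2 (\<lambda>x. c * \<phi> x)) = cmod c * ip_norm (H1 \<Omega>) (f - abs_l2 \<phi>)"
    using H1.norm_scale[OF m, of c] by (simp add: eq scaleC_diff_right)
  also have "\<dots> \<le> (cmod c + 1) * ip_norm (H1 \<Omega>) (f - abs_l2 \<phi>)"
    using H1.norm_nonneg[OF m] by (intro mult_right_mono) auto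
  also have "\<dots> < e" using \<phi>(2) pos by (simp add: pos_less_divide_eq mult.commute)
  finally show "\<exists>\<phi>\<in>test_functions \<Omega>. ip_norm (H1 \<Omega>) (c *\<^sub>C f - abs_l2 \<phi>) < e"
    using test_functions_scale[OF \<phi>(1), of c] by blast
qed

lemma H10_inner_space: "inner_space (H10 \<Omega>)"
proof
  have "abs_l2 (\<lambda>x. 0) = (0 :: 'a l2)" by (simp add: zero_l2_def)
  then show "0 \<in> carrier (H10 \<Omega>)" using test_function_H10[OF test_function_zero] by simp
next
  fix x y assume "x \<in> carrier (H10 \<Omega>)" "y \<in> carrier (H10 \<Omega>)"
  then show "ip (H10 \<Omega>) y x = cnj (ip (H10 \<Omega>) x y)"
    unfolding H10_ip by (intro H1.ip_commute H10_H1)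
qed (simp_all only: H10_add H10_scale H10_ip H10_H1 H1.ip_add_left H1.ip_scale_left H1.ip_nonneg H1.ip_definite)

theorem H10_hilbert: "hilbert (H10 \<Omega>)"
proof -
  interpret H10: inner_space "H10 \<Omega>" by (rule H10_inner_space)
  show ?thesis
  proof
    fix X assume X: "H10.ip_cauchy X"
    then have XH: "X n \<in> carrier (H10 \<Omega>)" for n by (simp add: H10.ip_cauchy_def)
    have "H1.ip_cauchy X"
      using X by (simp add: H10.ip_cauchy_def H1.ip_cauchy_def H10_norm H10_H1)
    then obtain f where f: "H1.ip_lim X f" using hilbert.complete[OF H1_hilbert] by blast
    then have fH: "f \<in> carrier (H1 \<Omega>)" and lim: "(\<lambda>n. ip_norm (H1 \<Omega>) (X n - f)) \<longlonglongrightarrow> 0"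
      by (simp_all add: H1.ip_lim_def)
    have "f \<in> carrier (H10 \<Omega>)"
      unfolding H10_carrier
    proof (intro conjI allI impI fH)
      fix e :: real assume "0 < e"
      then have e: "0 < e / 2" by simp
      obtain n where n: "ip_norm (H1 \<Omega>) (X n - f) < e / 2"
        using order_tendstoD(2)[OF lim e] by (auto simp: eventually_sequentially)
      obtain \<phi> where \<phi>: "\<phi> \<in> test_functions \<Omega>" "ip_norm (H1 \<Omega>) (X n - abs_l2 \<phi>) < e / 2"
        using XH[of n] e unfolding H10_carrier by blast
      have "ip_norm (H1 \<Omega>) (f - abs_l2 \<phi>) \<le> ip_norm (H1 \<Omega>) (f - X n) + ip_norm (H1 \<Omega>) (X n - abs_l2 \<phi>)"
        by (intro H1.norm_triangle_sub fH H10_H1 XH test_function_H1 \<phi>)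
      also have "\<dots> < e"
        using n \<phi>(2) H1.norm_diff_commute[OF fH H10_H1[OF XH], of n] by simp
      finally show "\<exists>\<phi>\<in>test_functions \<Omega>. ip_norm (H1 \<Omega>) (f - abs_l2 \<phi>) < e" using \<phi>(1) by blast
    qed
    then show "\<exists>x. H10.ip_lim X x"
      using XH lim by (auto simp: H10.ip_lim_def H10_norm)
  qed
qed

lemma H10_dense_embedding: "dense_embedding (L2 \<Omega>) (H10 \<Omega>)"
proof -
  interpret H10: hilbert "H10 \<Omega>" by (rule H10_hilbert)
  show ?thesis
  proof
    have sub: "carrier (H10 \<Omega>) \<subseteq> carrier (L2 \<Omega>)" using H10_H1 H1_L2 by blast
    show "L.total_in (carrier (H10 \<Omega>))"
      unfolding L.total_in_def
    proof (intro conjI ballI impI)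
      show "L.subspace_of (carrier (H10 \<Omega>))"
        unfolding L.subspace_of_def using sub H10.zero_mem H10_add H10_scale by blast
      fix u assume u: "u \<in> carrier (L2 \<Omega>)" and orth: "\<forall>v\<in>carrier (H10 \<Omega>). ip (L2 \<Omega>) v u = 0"
      show "u = 0"
      proof (rule L2_orthogonal_to_test_functions[OF \<Omega> u])
        fix \<phi> assume "\<phi> \<in> test_functions \<Omega>"
        then have "l2_inner (abs_l2 \<phi>) u = 0" using orth test_function_H10 by (simp add: L2_ip)
        then show "l2_inner u (abs_l2 \<phi>) = 0" using l2_inner_commute[of u "abs_l2 \<phi>"] by simp
      qed
    qed
    show "f \<in> carrier (H10 \<Omega>) \<Longrightarrow> ip_norm (L2 \<Omega>) f \<le> ip_norm (H10 \<Omega>) f" for f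
      by (simp add: H10_norm H1_norm_ge(1) H10_H1)
  qed
qed

end

text \<open>
The definite descriptions that define the operators and groups over \<open>\<Omega>\<close> are literally those of
\<open>dense_embedding\<close> for the pair \<open>L2 \<Omega>\<close>, \<open>H10 \<Omega>\<close>.
\<close>

theorem proposition5p3:
  fixes \<Omega> :: "(real ^ 'n) set"
  assumes "open \<Omega>"
  shows
    "(\<forall>G \<in> invertible_ops (H10 \<Omega>). (\<exists>!U. intertwines \<Omega> G U) \<longleftrightarrow> G \<in> GG \<Omega>) \<and>
     group (op_group (H10 \<Omega>) (GG \<Omega>)) \<and>
     group (op_group (H10 \<Omega>) (unitaries_fixing_range \<Omega>)) \<and>
     U_of \<Omega> \<in> iso (op_group (H10 \<Omega>) (GG \<Omega>)) (op_group (H10 \<Omega>) (unitaries_fixing_range \<Omega>)) \<and>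
     A_ext_half \<Omega> \<in> unitary_ops (L2 \<Omega>) (H10 \<Omega>) \<and>
     cstar_iso (L2 \<Omega>) (H10 \<Omega>) (Ad (L2 \<Omega>) (H10 \<Omega>) (A_ext_half \<Omega>)) \<and>
     Ad (L2 \<Omega>) (H10 \<Omega>) (A_ext_half \<Omega>) `
         {U \<in> unitary_ops (L2 \<Omega>) (L2 \<Omega>). U ` carrier (H10 \<Omega>) = carrier (H10 \<Omega>)}
       = unitaries_fixing_range \<Omega>"
proof -
  interpret E: dense_embedding "L2 \<Omega>" "H10 \<Omega>" by (rule H10_dense_embedding[OF assms])
  have A: "A_op \<Omega> = E.A" by (simp add: A_op_def E.A_def)
  have Ahalf: "A_half \<Omega> = E.R" by (simp add: A_half_def E.R_def A)
  have Aext: "A_ext \<Omega> = E.A_extension" by (simp add: A_ext_def E.A_extension_def A)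
  have S: "A_ext_half \<Omega> = E.S" by (simp add: A_ext_half_def E.S_def Aext)
  have GG: "GG \<Omega> = E.isometric_ops" by (simp add: GG_def E.isometric_ops_def)
  have int: "intertwines \<Omega> = E.intertw" by (intro ext) (simp add: intertwines_def E.intertw_def Ahalf)
  have U: "U_of \<Omega> = E.U_map" by (intro ext) (simp add: U_of_def E.U_map_def int)
  have fix_range: "unitaries_fixing_range \<Omega> = E.range_unitaries"
    by (simp add: unitaries_fixing_range_def E.range_unitaries_def Ahalf)
  show ?thesis
    unfolding S GG int U fix_range
    using E.ex1_intertw_iff E.isometric_ops_group E.range_unitaries_group E.U_map_iso E.S_unitary
      Ad_cstar_iso[OF L2_hilbert H10_hilbert[OF assms] E.S_unitary] E.Ad_image by blast
qed

end
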